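(* Let $\kappa\in\{1/2,3/2\}$ and let $\mathbf g=(g_1,\dots,g_r):\mathbb H\to\mathbb C^r$ be a vector-valued cusp form of weight $\kappa$ for $\mathsf{Mp}_2(\mathbb Z)$ with unitary multiplier system $\varrho$, where $\varrho(T)=\mathrm{diag}(e^{2\pi i\alpha_1},\dots,e^{2\pi i\alpha_r})$ has finite order, $\alpha_k\in\mathbb Q\cap[0,1)$. Let $\widetilde{\mathsf{EI}}[\mathbf g](\tau)=\sum_{\ell\ge0}\mathbf c_\ell\tau^\ell$ be the asymptotic expansion of the vector of Eichler integrals $\mathsf{EI}[\mathbf g](\tau)$ as $\tau\to0$ with $\mathrm{Im}(\tau)>0$. Then, component-wise, $$\mathcal S^{\mathrm{med}}_{\pi/2}\big[\widetilde{\mathsf{EI}}[\mathbf g]\big](\tau)=\mathsf{EI}[\mathbf g](\tau),\qquad\tau\in\mathbb H.$$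
   Context: $\mathbb H$ is the upper half-plane, $q=e^{2\pi i\tau}$, $T=\begin{pmatrix}1&1\\0&1\end{pmatrix}$, $S=\begin{pmatrix}0&-1\\1&0\end{pmatrix}$; powers of $c\tau+d$ use the principal branch. A multiplier system of weight $\kappa$ is a map $\varrho:\mathsf{SL}_2(\mathbb Z)\to\mathsf{GL}_r(\mathbb C)$ such that $\mathbf j(\tau;\gamma)=(c\tau+d)^\kappa\varrho(\gamma)$ satisfies $\mathbf j(\tau;\gamma\gamma')=\mathbf j(\gamma'\tau;\gamma)\,\mathbf j(\tau;\gamma')$ (equivalently, it comes from a representation of $\mathsf{Mp}_2(\mathbb Z)$). That $\mathbf g$ is a cusp form of weight $\kappa$ and multiplier $\varrho$ means that $\mathbf g$ is holomorphic, $\mathbf g(\gamma\tau)=(c\tau+d)^\kappa\varrho(\gamma)\mathbf g(\tau)$ for all $\gamma\in\mathsf{SL}_2(\mathbb Z)$, and $g_k(\tau)=\sum_{\lambda\in\alpha_k+\mathbb Z_{\ge0},\lambda>0}a_k(\lambda)q^\lambda$ with $a_k(\lambda)=O(\lambda^{\kappa/2})$. The Eichler integrals are $\mathsf{EI}[g_k](\tau)=\sum_\lambda\lambda^{1-\kappa}a_k(\lambda)q^\lambda$ and $\mathsf{EI}[\mathbf g]=(\mathsf{EI}[g_k])_k$. Let $\mathscr L_k(s)=\sum_\lambda a_k(\lambda)\lambda^{-s}$ (analytically continued) and $\boldsymbol{\mathscr L}=(\mathscr L_k)_k$. The asymptotic coefficients are $$\mathbf c_\ell=\mathfrak c_\kappa\,\Gamma(2-\kappa+\ell)\,(2\pi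 i)^{-\ell}\,\varrho(S)\,\boldsymbol{\mathscr L}(\ell+1),\qquad\mathfrak c_\kappa=\frac{i^\kappa\sin(\pi(\kappa-1))}{\pi}(2\pi)^{\kappa-2}.$$ Resummation. Let $\eta=2-\kappa$. With $\mathcal B[\tau^a](\xi)=\xi^{a-1}/\Gamma(a)$ for $a>0$ (term by term, analytically continued), set $s_\theta[\tau^\eta f](\tau)=\int_{e^{i\theta}\mathbb R_{\ge0}}e^{-\xi/\tau}\mathcal B[\tau^\eta f](\xi)\,d\xi$ and $s_\theta[f]=\tau^{-\eta}s_\theta[\tau^\eta f]$, component-wise. The median resummation is $\mathcal S^{\mathrm{med}}_\theta[f](\tau)=\tfrac12(s_{\theta_+}[f](\tau)+s_{\theta_-}[f](\tau))$ with $\theta_\pm=\theta\pm\epsilon$, $\epsilon>0$ small (depending on $\tau$), defined for $\mathrm{Re}(e^{-i\theta}\tau)>0$. *)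

theory Defs
  imports "HOL-Analysis.Analysis" "HOL-Library.Landau_Symbols"
begin

definition upper_half_plane :: "complex set" where
  "upper_half_plane = {\<tau>. Im \<tau> > 0}"

definition SL2Z :: "(int^2^2) set" where
  "SL2Z = {\<gamma>. det \<gamma> = 1}"

definition S_mat :: "int^2^2" where
  "S_mat = vector [vector [0, -1], vector [1, 0]]"

definition T_mat :: "int^2^2" where
  "T_mat = vector [vector [1, 1], vector [0, 1]]"

definition moebius :: "int^2^2 \<Rightarrow> complex \<Rightarrow> complex" where
  "moebius \<gamma> \<tau> =
     (of_int (\<gamma>$1$1) * \<tau> + of_int (\<gamma>$1$2)) / (of_int (\<gamma>$2$1) * \<tau> + of_int (\<gamma>$2$2))"

text \<open>Complex \<open>powr\<close> is the principal branch, with argument in \<open>(-\<pi>, \<pi>]\<close>.\<close>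

definition cocycle_factor :: "real \<Rightarrow> complex \<Rightarrow> int^2^2 \<Rightarrow> complex" where
  "cocycle_factor \<kappa> \<tau> \<gamma> = (of_int (\<gamma>$2$1) * \<tau> + of_int (\<gamma>$2$2)) powr (of_real \<kappa>)"

definition automorphy_factor ::
    "real \<Rightarrow> (int^2^2 \<Rightarrow> complex^'r^'r) \<Rightarrow> complex \<Rightarrow> int^2^2 \<Rightarrow> complex^'r^'r" where
  "automorphy_factor \<kappa> \<rho> \<tau> \<gamma> = (\<chi> i j. cocycle_factor \<kappa> \<tau> \<gamma> * \<rho> \<gamma> $ i $ j)"

definition multiplier_system :: "real \<Rightarrow> (int^2^2 \<Rightarrow> complex^'r^'r) \<Rightarrow> bool" where
  "multiplier_system \<kappa> \<rho> \<longleftrightarrow>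
     (\<forall>\<gamma>\<in>SL2Z. invertible (\<rho> \<gamma>)) \<and>
     (\<forall>\<gamma>\<in>SL2Z. \<forall>\<gamma>'\<in>SL2Z. \<forall>\<tau>\<in>upper_half_plane.
        automorphy_factor \<kappa> \<rho> \<tau> (\<gamma> ** \<gamma>') =
        automorphy_factor \<kappa> \<rho> (moebius \<gamma>' \<tau>) \<gamma> ** automorphy_factor \<kappa> \<rho> \<tau> \<gamma>')"

definition unitary_matrix :: "complex^'r^'r \<Rightarrow> bool" where
  "unitary_matrix U \<longleftrightarrow>
     U ** (\<chi> i j. cnj (U $ j $ i)) = mat 1 \<and> (\<chi> i j. cnj (U $ j $ i)) ** U = mat 1"

definition exponents :: "real \<Rightarrow> real set" where
  "exponents \<alpha> = {\<mu>. \<mu> > 0 \<and> (\<exists>n::nat. \<mu> = \<alpha> + real n)}"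

definition qpow :: "complex \<Rightarrow> real \<Rightarrow> complex" where
  "qpow \<tau> \<mu> = exp (2 * of_real pi * \<i> * of_real \<mu> * \<tau>)"

text \<open>
  The Fourier coefficients \<open>a k \<mu>\<close> are determined by \<open>g\<close> for \<open>\<mu> \<in> exponents (\<alpha> k)\<close>; the
  values at other \<open>\<mu>\<close> are never used.
\<close>

definition cusp_form ::
    "real \<Rightarrow> (int^2^2 \<Rightarrow> complex^'r^'r) \<Rightarrow> ('r \<Rightarrow> real) \<Rightarrow> (complex \<Rightarrow> complex^'r)
       \<Rightarrow> ('r \<Rightarrow> real \<Rightarrow> complex) \<Rightarrow> bool" where
  "cusp_form \<kappa> \<rho> \<alpha> g a \<longleftrightarrow>
     (\<forall>k. (\<lambda>\<tau>. g \<tau> $ k) holomorphic_on upper_half_plane) \<and>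
     (\<forall>\<gamma>\<in>SL2Z. \<forall>\<tau>\<in>upper_half_plane.
        g (moebius \<gamma> \<tau>) = cocycle_factor \<kappa> \<tau> \<gamma> *s (\<rho> \<gamma> *v g \<tau>)) \<and>
     (\<forall>k. \<forall>\<tau>\<in>upper_half_plane.
        ((\<lambda>\<mu>. a k \<mu> * qpow \<tau> \<mu>) has_sum (g \<tau> $ k)) (exponents (\<alpha> k))) \<and>
     (\<forall>k. \<exists>C. \<forall>\<mu>\<in>exponents (\<alpha> k). norm (a k \<mu>) \<le> C * \<mu> powr (\<kappa> / 2))"

definition eichler_integral ::
    "real \<Rightarrow> ('r \<Rightarrow> real) \<Rightarrow> ('r \<Rightarrow> real \<Rightarrow> complex) \<Rightarrow> complex \<Rightarrow> complex^'r" where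
  "eichler_integral \<kappa> \<alpha> a \<tau> =
     (\<chi> k. infsum (\<lambda>\<mu>. of_real (\<mu> powr (1 - \<kappa>)) * a k \<mu> * qpow \<tau> \<mu>) (exponents (\<alpha> k)))"

text \<open>
  The analytic continuation of the L-series of a cusp form is entire, and an entire function is
  determined by its values on any right half-plane.
\<close>

definition L_function :: "real \<Rightarrow> (real \<Rightarrow> complex) \<Rightarrow> complex \<Rightarrow> complex" where
  "L_function \<alpha> b = (THE F. F holomorphic_on UNIV \<and>
     (\<exists>\<sigma>. \<forall>s. Re s > \<sigma> \<longrightarrow> ((\<lambda>\<mu>. b \<mu> * of_real \<mu> powr (- s)) has_sum F s) (exponents \<alpha>)))"

definition asymptotic_coeff ::
    "real \<Rightarrow> (int^2^2 \<Rightarrow> complex^'r^'r) \<Rightarrow> ('r \<Rightarrow> real) \<Rightarrow> ('r \<Rightarrow> real \<Rightarrow> complex)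
       \<Rightarrow> nat \<Rightarrow> complex^'r" where
  "asymptotic_coeff \<kappa> \<rho> \<alpha> a l =
     (\<i> powr (of_real \<kappa>) * of_real (sin (pi * (\<kappa> - 1)) / pi * (2 * pi) powr (\<kappa> - 2))
        * of_real (Gamma (2 - \<kappa> + real l)) / (2 * of_real pi * \<i>) ^ l)
     *s (\<rho> S_mat *v (\<chi> k. L_function (\<alpha> k) (a k) (of_nat (l + 1))))"

text \<open>
  Poincare asymptotics as \<open>\<tau> \<rightarrow> 0\<close> in the upper half-plane, uniformly on each sector
  \<open>Im \<tau> \<ge> \<delta> * norm \<tau>\<close>. For Eichler integrals the expansion fails in general when \<open>\<tau>\<close> is allowed
  to approach \<open>0\<close> tangentially to the real axis, e.g. along a horocycle.
\<close>

definition has_asymptotic_expansion_at_0 ::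
    "(complex \<Rightarrow> complex) \<Rightarrow> (nat \<Rightarrow> complex) \<Rightarrow> bool" where
  "has_asymptotic_expansion_at_0 F c \<longleftrightarrow>
     (\<forall>\<delta>>0. \<forall>N. (\<lambda>\<tau>. F \<tau> - (\<Sum>l<N. c l * \<tau> ^ l))
        \<in> O[at 0 within {\<tau>\<in>upper_half_plane. Im \<tau> \<ge> \<delta> * norm \<tau>}](\<lambda>\<tau>. \<tau> ^ N))"

text \<open>
  A formal power series is given by its coefficient sequence \<open>f\<close>. The function \<open>B\<close> continues the
  Borel transform of \<open>\<tau>\<^sup>\<eta> f\<close> analytically along the open ray of direction \<open>\<theta>\<close>; by the identity
  theorem its values on the ray are unique. The branch of \<open>\<xi> powr _\<close> is that of the ray only for
  \<open>-\<pi> < \<theta> < \<pi>\<close>.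
\<close>

definition borel_continuation ::
    "real \<Rightarrow> real \<Rightarrow> (nat \<Rightarrow> complex) \<Rightarrow> (complex \<Rightarrow> complex) \<Rightarrow> bool" where
  "borel_continuation \<eta> \<theta> f B \<longleftrightarrow>
     (\<exists>U. open U \<and> (\<forall>t>0. of_real t * cis \<theta> \<in> U) \<and> B holomorphic_on U) \<and>
     (\<forall>\<^sub>F t in at_right 0.
        (\<lambda>l. f l * (of_real t * cis \<theta>) powr of_real (\<eta> + real l - 1)
               / of_real (Gamma (\<eta> + real l))) sums B (of_real t * cis \<theta>))"

text \<open>
  \<open>has_borel_sum \<eta> \<theta> f \<tau> s\<close>: the lateral sum \<open>s\<^sub>\<theta>[f](\<tau>)\<close> exists and equals \<open>s\<close>, the ray being
  parametrised by \<open>\<xi> = t * cis \<theta>\<close>.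
\<close>

definition has_borel_sum ::
    "real \<Rightarrow> real \<Rightarrow> (nat \<Rightarrow> complex) \<Rightarrow> complex \<Rightarrow> complex \<Rightarrow> bool" where
  "has_borel_sum \<eta> \<theta> f \<tau> s \<longleftrightarrow>
     (\<exists>B. borel_continuation \<eta> \<theta> f B \<and>
        set_integrable lborel {0<..}
          (\<lambda>t. exp (- (of_real t * cis \<theta>) / \<tau>) * B (of_real t * cis \<theta>) * cis \<theta>) \<and>
        s = \<tau> powr (- of_real \<eta>) *
          set_lebesgue_integral lborel {0<..}
            (\<lambda>t. exp (- (of_real t * cis \<theta>) / \<tau>) * B (of_real t * cis \<theta>) * cis \<theta>))"

definition has_median_sum ::
    "real \<Rightarrow> real \<Rightarrow> (nat \<Rightarrow> complex) \<Rightarrow> complex \<Rightarrow> complex \<Rightarrow> bool" where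
  "has_median_sum \<eta> \<theta> f \<tau> s \<longleftrightarrow>
     Re (cis (- \<theta>) * \<tau>) > 0 \<and>
     (\<forall>\<^sub>F \<epsilon> in at_right 0. \<exists>s_plus s_minus.
        has_borel_sum \<eta> (\<theta> + \<epsilon>) f \<tau> s_plus \<and> has_borel_sum \<eta> (\<theta> - \<epsilon>) f \<tau> s_minus \<and>
        s = (s_plus + s_minus) / 2)"

end

theory Submission
  imports Defs "HOL-Complex_Analysis.Complex_Analysis"
begin

text \<open>
  Write \<open>\<eta> = 2 - \<kappa>\<close> and let \<open>G\<close> be one component of the cusp form. Since \<open>G\<close> decays exponentially at
  \<open>\<i>\<infinity>\<close> and, by the transformation under \<open>S\<close>, also at \<open>0\<close>, all its moments exist. The functional
  equation turns the vector of values \<open>\<rho>(S) L(l + 1)\<close> into moments of this same component (lemma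
  \<open>S_matrix_moment\<close>), so that up to one constant the coefficients are
  \<open>\<Gamma>(\<eta> + l) / l! \<integral> G(w) w\<^sup>-\<^sup>\<eta>\<^sup>-\<^sup>l dw\<close>, integrated from \<open>0\<close> to infinity along any ray in the upper half-plane
  (lemma \<open>asymptotic_coeff_eq\<close>).

  Dividing by \<open>\<Gamma>(\<eta> + l)\<close> and summing gives the Borel transform
  \<open>\<xi>\<^sup>\<eta>\<^sup>-\<^sup>1 \<integral> G(w) w\<^sup>-\<^sup>\<eta> exp(\<xi>/w) dw\<close>. It converges for small \<open>\<xi>\<close>, and turning the ray of integration to a
  direction with \<open>Re(\<xi>/w) < 0\<close> continues it past the singularities on the positive imaginary axis, on
  either side, as a function whose ray integral is bounded. By Fubini and the Laplace integral of a
  power, the two lateral sums become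
  \<open>\<integral> G(w) (w - \<tau>)\<^sup>-\<^sup>\<eta> dw\<close> along a ray passing to the right, respectively to the left, of \<open>\<tau>\<close>, where the
  two branches agree above \<open>\<tau>\<close> (lemmas \<open>laplace_borel_eq_ray_integral\<close>, \<open>branch_right\<close>,
  \<open>branch_left\<close>).

  As \<open>\<eta>\<close> is half an odd integer, the two branches are opposite below \<open>\<tau>\<close>. Hence in the sum of the two
  integrals everything below \<open>\<tau>\<close> cancels, and what is left is twice the classical integral of
  \<open>G(w) (w - \<tau>)\<^sup>-\<^sup>\<eta>\<close> from \<open>\<tau>\<close> to \<open>\<i>\<infinity>\<close>, regularised if \<open>\<eta> = 3/2\<close>. Integrating the Fourier series term by
  term gives the Eichler integral (theorems \<open>two_rays_eq\<close> and \<open>two_ray_integral\<close>); the reflection formula of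
  the Gamma function disposes of the constants. The cancellation is proved for single exponentials with
  both rays starting at a common point \<open>p\<close> strictly below \<open>\<tau>\<close>, where the series converges absolutely, and
  \<open>p\<close> tends to \<open>0\<close> afterwards.

  For the asymptotic expansion, the same representation of the Eichler integral as the mean of two
  lateral sums is used with a fixed pair of directions for a whole sector: the Taylor remainder of \<open>exp\<close>
  on the left half-plane bounds the remainder of the Borel transform on the whole ray, and the Laplace
  integral turns this into \<open>O(\<tau>\<^sup>N)\<close>.
\<close>

section \<open>Integrals with a holomorphic parameter\<close>

text \<open>
  Restricting the measure space itself means that measurability and domination are needed only at
  positive arguments, where real powers are continuous.
\<close>

definition half_line :: "real measure" where
  "half_line = restrict_space lborel {0<..}"

lemma space_half_line [simp]: "space half_line = {0<..}"
  by (simp add: half_line_def space_restrict_space)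

lemma integral_half_line:
  fixes f :: "real \<Rightarrow> 'a :: {banach, second_countable_topology}"
  shows "(\<integral>t. f t \<partial>half_line) = (LINT t:{0<..}|lborel. f t)"
  by (simp add: half_line_def integral_restrict_space set_lebesgue_integral_def)

lemma integrable_half_line:
  fixes f :: "real \<Rightarrow> 'a :: {banach, second_countable_topology}"
  shows "integrable half_line f \<longleftrightarrow> set_integrable lborel {0<..} f"
  by (simp add: half_line_def integrable_restrict_space set_integrable_def)

lemma measurable_half_line:
  fixes f :: "real \<Rightarrow> 'a :: topological_space"
  assumes "continuous_on {0<..} f"
  shows "f \<in> borel_measurable half_line"
  using borel_measurable_continuous_on_restrict[OF assms]
  by (simp add: half_line_def measurable_def space_restrict_space sets_restrict_space)

lemma sigma_finite_half_line: "sigma_finite_measure half_line"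
  unfolding half_line_def
  by (intro sigma_finite_measure_restrict_space) (auto intro: sigma_finite_lborel)

text \<open>
  Cauchy's inequality bounds the difference quotients near \<open>z\<close> by a multiple of the dominating
  function \<open>h\<close>, so that no bound on the derivative has to be supplied.
\<close>

lemma has_field_derivative_integral:
  fixes f :: "complex \<Rightarrow> 'a \<Rightarrow> complex"
  assumes r: "r > 0"
    and meas: "\<And>w. w \<in> ball z r \<Longrightarrow> f w \<in> borel_measurable M"
    and hol: "\<And>x. x \<in> space M \<Longrightarrow> (\<lambda>w. f w x) holomorphic_on ball z r"
    and h: "integrable M h"
    and dom: "\<And>w x. w \<in> ball z r \<Longrightarrow> x \<in> space M \<Longrightarrow> norm (f w x) \<le> h x"
  shows "((\<lambda>w. \<integral>x. f w x \<partial>M) has_field_derivative (\<integral>x. deriv (\<lambda>w. f w x) z \<partial>M)) (at z)"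
proof -
  have int: "integrable M (f w)" if "w \<in> ball z r" for w
    by (rule Bochner_Integration.integrable_bound[OF h]) (use meas dom that in \<open>force intro!: AE_I2\<close>)+
  have lip: "norm (f w x - f z x) \<le> 4 * h x / r * norm (w - z)"
    if x: "x \<in> space M" and w: "w \<in> ball z (r/2)" for w x
  proof (rule field_differentiable_bound[where S = "ball z (r/2)" and f' = "deriv (\<lambda>w. f w x)"])
    fix u assume u: "u \<in> ball z (r/2)"
    \<comment> \<open>Discs of radius \<open>r / 4\<close> around points of \<open>ball z (r / 2)\<close> stay inside \<open>ball z r\<close>.\<close>
    have sub: "cball u (r/4) \<subseteq> ball z r"
    proof
      fix y assume "y \<in> cball u (r/4)"
      then have "dist z y \<le> dist z u + dist u y" "dist u y \<le> r/4" "dist z u < r/2"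
        using u by (auto intro: dist_triangle)
      then show "y \<in> ball z r" using r by simp
    qed
    have "u \<in> ball z r" using u r by simp
    then have "(\<lambda>w. f w x) field_differentiable at u"
      using hol[OF x] holomorphic_on_imp_differentiable_at open_ball by blast
    then have "((\<lambda>w. f w x) has_field_derivative deriv (\<lambda>w. f w x) u) (at u)"
      by (simp add: DERIV_deriv_iff_field_differentiable)
    then show "((\<lambda>w. f w x) has_field_derivative deriv (\<lambda>w. f w x) u) (at u within ball z (r/2))"
      by (rule has_field_derivative_at_within)
    have "norm ((deriv ^^ 1) (\<lambda>w. f w x) u) \<le> fact 1 * h x / (r/4) ^ 1"
    proof (rule Cauchy_inequality)
      show "(\<lambda>w. f w x) holomorphic_on ball u (r/4)"
        using hol[OF x] sub ball_subset_cball holomorphic_on_subset by blast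
      show "continuous_on (cball u (r/4)) (\<lambda>w. f w x)"
        using hol[OF x] sub holomorphic_on_imp_continuous_on holomorphic_on_subset by blast
      show "norm (f v x) \<le> h x" if "norm (u - v) = r/4" for v
        using sub that dom[OF _ x] by (auto simp: dist_norm)
    qed (use r in auto)
    then show "norm (deriv (\<lambda>w. f w x) u) \<le> 4 * h x / r" by (simp add: field_simps)
  qed (use r w in auto)
  have z: "z \<in> ball z r" using r by simp
  show ?thesis
    unfolding has_field_derivative_iff tendsto_at_iff_sequentially
  proof (intro allI impI)
    fix X :: "nat \<Rightarrow> complex"
    assume X: "\<forall>i. X i \<in> UNIV - {z}" and lim: "X \<longlonglongrightarrow> z"
    from lim r obtain N where N: "\<And>n. n \<ge> N \<Longrightarrow> dist (X n) z < r/2"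
      unfolding lim_sequentially by (metis half_gt_zero)
    define Y where "Y n = X (n + N)" for n
    have Y: "Y n \<in> ball z (r/2)" "Y n \<noteq> z" for n
      using N[of "n+N"] X by (auto simp: Y_def dist_commute)
    then have Y': "Y n \<in> ball z r" for n using r less_trans[of "dist z (Y n)" "r/2" r] by simp
    have limY: "Y \<longlonglongrightarrow> z" unfolding Y_def by (rule LIMSEQ_ignore_initial_segment[OF lim])
    have ptw: "(\<lambda>n. (f (Y n) x - f z x) / (Y n - z)) \<longlonglongrightarrow> deriv (\<lambda>w. f w x) z"
      if x: "x \<in> space M" for x
    proof -
      have "(\<lambda>w. f w x) field_differentiable at z"
        using hol[OF x] holomorphic_on_imp_differentiable_at z open_ball by blast
      then have "((\<lambda>w. f w x) has_field_derivative deriv (\<lambda>w. f w x) z) (at z)"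
        by (simp add: DERIV_deriv_iff_field_differentiable)
      then show ?thesis
        unfolding has_field_derivative_iff tendsto_at_iff_sequentially o_def
        using limY Y(2) by blast
    qed
    have "(\<lambda>n. \<integral>x. (f (Y n) x - f z x) / (Y n - z) \<partial>M) \<longlonglongrightarrow> (\<integral>x. deriv (\<lambda>w. f w x) z \<partial>M)"
    proof (rule integral_dominated_convergence[where w = "\<lambda>x. 4 * h x / r"])
      show m: "(\<lambda>x. (f (Y n) x - f z x) / (Y n - z)) \<in> borel_measurable M" for n
        using meas[OF Y'[of n]] meas[OF z] by measurable
      show "(\<lambda>x. deriv (\<lambda>w. f w x) z) \<in> borel_measurable M"
        by (rule borel_measurable_LIMSEQ_metric[OF m ptw])
      show "integrable M (\<lambda>x. 4 * h x / r)" using h by simp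
      show "AE x in M. (\<lambda>n. (f (Y n) x - f z x) / (Y n - z)) \<longlonglongrightarrow> deriv (\<lambda>w. f w x) z"
        using ptw by (intro AE_I2)
      show "AE x in M. norm ((f (Y n) x - f z x) / (Y n - z)) \<le> 4 * h x / r" for n
        using lip[OF _ Y(1)[of n]] Y(2)[of n] by (intro AE_I2) (simp add: norm_divide field_simps)
    qed
    moreover have "(\<integral>x. (f (Y n) x - f z x) / (Y n - z) \<partial>M)
        = ((\<integral>x. f (Y n) x \<partial>M) - (\<integral>x. f z x \<partial>M)) / (Y n - z)" for n
      using Bochner_Integration.integral_diff[OF int[OF Y'[of n]] int[OF z]] by simp
    ultimately have "(\<lambda>n. ((\<integral>x. f (Y n) x \<partial>M) - (\<integral>x. f z x \<partial>M)) / (Y n - z))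
        \<longlonglongrightarrow> (\<integral>x. deriv (\<lambda>w. f w x) z \<partial>M)"
      using Y(2) by simp
    then show "((\<lambda>y. ((\<integral>x. f y x \<partial>M) - (\<integral>x. f z x \<partial>M)) / (y - z)) \<circ> X)
        \<longlonglongrightarrow> (\<integral>x. deriv (\<lambda>w. f w x) z \<partial>M)"
      unfolding Y_def o_def by (rule LIMSEQ_offset)
  qed
qed

lemma holomorphic_on_integral:
  fixes f :: "complex \<Rightarrow> 'a \<Rightarrow> complex"
  assumes "\<And>z. z \<in> U \<Longrightarrow> \<exists>r>0. \<exists>h. ball z r \<subseteq> U \<and> integrable M h \<and>
      (\<forall>w\<in>ball z r. \<forall>x\<in>space M. norm (f w x) \<le> h x)"
    and "\<And>w. w \<in> U \<Longrightarrow> f w \<in> borel_measurable M"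
    and "\<And>x. x \<in> space M \<Longrightarrow> (\<lambda>w. f w x) holomorphic_on U"
  shows "(\<lambda>w. \<integral>x. f w x \<partial>M) holomorphic_on U"
proof -
  have "(\<lambda>w. \<integral>x. f w x \<partial>M) field_differentiable at z" if "z \<in> U" for z
  proof -
    from assms(1)[OF that] obtain r h where *: "r > 0" "ball z r \<subseteq> U" "integrable M h"
      "\<forall>w\<in>ball z r. \<forall>x\<in>space M. norm (f w x) \<le> h x" by blast
    show ?thesis
      unfolding field_differentiable_def
      by (rule exI, rule has_field_derivative_integral[of r z f M h])
         (use * assms(2,3) holomorphic_on_subset in blast)+
  qed
  then show ?thesis
    by (meson field_differentiable_at_within holomorphic_on_def)
qed

section \<open>Gamma and Laplace integrals\<close>

lemma half_line_scale:
  fixes f :: "real \<Rightarrow> complex"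
  assumes "c > 0"
  shows "(\<integral>t. f t \<partial>half_line) = of_real c * (\<integral>t. f (c * t) \<partial>half_line)"
proof -
  have "indicator {0<..} (c * t) = (indicator {0<..} t :: real)" for t
    using assms by (simp add: indicator_def zero_less_mult_iff)
  then show ?thesis
    using lborel_integral_real_affine[of c "\<lambda>t. indicator {0<..} t *\<^sub>R f t" 0] assms
    by (simp add: integral_half_line set_lebesgue_integral_def scaleR_conv_of_real)
qed

lemma integrable_half_line_scale:
  fixes f :: "real \<Rightarrow> complex"
  assumes "c > 0"
  shows "integrable half_line (\<lambda>t. f (c * t)) \<longleftrightarrow> integrable half_line f"
proof -
  have "indicator {0<..} (c * t) = (indicator {0<..} t :: real)" for t
    using assms by (simp add: indicator_def zero_less_mult_iff)
  then show ?thesis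
    using lborel_integrable_real_affine_iff[of c "\<lambda>t. indicator {0<..} t *\<^sub>R f t" 0] assms
    by (simp add: integrable_half_line set_integrable_def)
qed

lemma Gamma_integral_half_line_1:
  assumes "Re a > 0"
  shows "integrable half_line (\<lambda>t. of_real t powr (a - 1) * exp (- of_real t))"
    and "(\<integral>t. of_real t powr (a - 1) * exp (- of_real t) \<partial>half_line) = Gamma a"
proof -
  let ?f = "\<lambda>t. of_real t powr (a - 1) * exp (- of_real t) :: complex"
  let ?g = "\<lambda>t. of_real t powr (a - 1) / of_real (exp t) :: complex"
  have eq: "?f t = ?g t" for t
    by (simp add: exp_minus divide_inverse exp_of_real)
  have "?g absolutely_integrable_on {0<..}"
    by (rule absolutely_integrable_Gamma_integral'[OF assms])
  then have 1: "?f absolutely_integrable_on {0<..}" unfolding eq .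
  have cont: "continuous_on {0<..} ?f"
    by (intro continuous_intros) auto
  have m: "(\<lambda>t. indicator {0<..} t *\<^sub>R ?f t) \<in> borel_measurable lborel"
    using cont borel_measurable_continuous_on_indicator[of "{0<..}" ?f] by simp
  have si: "set_integrable lborel {0<..} ?f"
    using 1 integrable_completion[OF m] by (simp add: set_integrable_def)
  then show "integrable half_line ?f" by (simp add: integrable_half_line)
  have "(\<integral>t. ?f t \<partial>half_line) = integral {0<..} ?f"
    using set_borel_integral_eq_integral(2)[OF si] by (simp add: integral_half_line)
  also have "\<dots> = Gamma a"
    unfolding eq using Gamma_integral_complex'[OF assms] by (rule integral_unique)
  finally show "(\<integral>t. ?f t \<partial>half_line) = Gamma a" .
qed

lemma
  assumes "Re a > 0" "x > 0"
  shows integrable_Gamma_integral_real_rate: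
      "integrable half_line (\<lambda>t. of_real t powr (a - 1) * exp (- (of_real x * of_real t)))"
    and Gamma_integral_real_rate:
      "(\<integral>t. of_real t powr (a - 1) * exp (- (of_real x * of_real t)) \<partial>half_line)
        = Gamma a * of_real x powr (- a)"
proof -
  let ?f = "\<lambda>t. of_real t powr (a - 1) * exp (- of_real t) :: complex"
  have eq: "of_real t powr (a - 1) * exp (- (of_real x * of_real t))
      = of_real x powr (1 - a) * ?f (x * t)" if "t > 0" for t
  proof -
    have "of_real (x * t) powr (a - 1) = (of_real x powr (a - 1) * of_real t powr (a - 1) :: complex)"
      using that assms by (simp add: powr_times_real)
    moreover have "of_real x powr (1 - a) * of_real x powr (a - 1) = (1 :: complex)"
      using assms by (simp add: powr_add[symmetric])
    ultimately show ?thesis by (simp add: mult.assoc[symmetric])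
  qed
  have "integrable half_line (\<lambda>t. of_real x powr (1 - a) * ?f (x * t))"
    using Gamma_integral_half_line_1(1)[OF assms(1)]
    by (intro integrable_mult_right integrable_half_line_scale[OF assms(2), of ?f, THEN iffD2])
  then show "integrable half_line (\<lambda>t. of_real t powr (a - 1) * exp (- (of_real x * of_real t)))"
    by (rule Bochner_Integration.integrable_cong[THEN iffD1, rotated 2]) (use eq in auto)
  have "(\<integral>t. of_real t powr (a - 1) * exp (- (of_real x * of_real t)) \<partial>half_line)
      = (\<integral>t. of_real x powr (1 - a) * ?f (x * t) \<partial>half_line)"
    by (rule Bochner_Integration.integral_cong) (use eq in auto)
  also have "\<dots> = of_real x powr (1 - a) * (\<integral>t. ?f (x * t) \<partial>half_line)" by simp
  also have "(\<integral>t. ?f (x * t) \<partial>half_line) = Gamma a / of_real x"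
    using half_line_scale[OF assms(2), of ?f] Gamma_integral_half_line_1(2)[OF assms(1)] assms
    by (simp add: field_simps)
  also have "of_real x powr (1 - a) * (Gamma a / of_real x) = Gamma a * of_real x powr (- a)"
    using assms by (simp add: powr_diff powr_minus field_simps)
  finally show "(\<integral>t. of_real t powr (a - 1) * exp (- (of_real x * of_real t)) \<partial>half_line)
        = Gamma a * of_real x powr (- a)" .
qed

lemma
  fixes b x :: real
  assumes "b > 0" "x > 0"
  shows integrable_powr_exp: "integrable half_line (\<lambda>t. t powr (b - 1) * exp (- (x * t)))"
    and integral_powr_exp:
      "(\<integral>t. t powr (b - 1) * exp (- (x * t)) \<partial>half_line) = Gamma b * x powr (- b)"
proof -
  have eq: "of_real (t powr (b - 1) * exp (- (x * t)))
      = of_real t powr (of_real b - 1) * exp (- (of_real x * of_real t :: complex))" if "t > 0" for t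
    using that powr_of_real[of t "b - 1"] by (simp add: exp_of_real[symmetric])
  have i: "integrable half_line (\<lambda>t. of_real (t powr (b - 1) * exp (- (x * t))) :: complex)"
    by (rule Bochner_Integration.integrable_cong[THEN iffD1, rotated 2,
          OF integrable_Gamma_integral_real_rate[of "of_real b" x]])
       (use eq assms in auto)
  show "integrable half_line (\<lambda>t. t powr (b - 1) * exp (- (x * t)))"
    using integrable_bounded_linear[OF bounded_linear_Re i] by (simp only: Re_complex_of_real)
  have "complex_of_real (\<integral>t. t powr (b - 1) * exp (- (x * t)) \<partial>half_line)
      = (\<integral>t. of_real (t powr (b - 1) * exp (- (x * t))) \<partial>half_line)"
    by (rule integral_complex_of_real[symmetric])
  also have "\<dots> = (\<integral>t. of_real t powr (of_real b - 1) * exp (- (of_real x * of_real t)) \<partial>half_line)"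
    by (rule Bochner_Integration.integral_cong) (use eq in auto)
  also have "\<dots> = Gamma (of_real b) * of_real x powr (- of_real b)"
    using Gamma_integral_real_rate[of "of_real b" x] assms by simp
  also have "\<dots> = of_real (Gamma b * x powr (- b))"
    using assms powr_of_real[of x "- b"] by (simp add: Gamma_complex_of_real)
  finally show "(\<integral>t. t powr (b - 1) * exp (- (x * t)) \<partial>half_line) = Gamma b * x powr (- b)"
    by (simp only: of_real_eq_iff)
qed

lemma integrable_exp_half_line: "x > 0 \<Longrightarrow> integrable half_line (\<lambda>t. exp (- (x * t)))"
  by (rule Bochner_Integration.integrable_cong[THEN iffD1, rotated 2,
        OF integrable_powr_exp[of 1 x]]) auto

lemma norm_powr_of_real: "norm (w powr of_real a :: complex) = norm w powr a"
  by (cases "w = 0") (simp_all add: norm_powr_real_powr')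

text \<open>
  For real \<open>z\<close> the value follows by scaling; both sides are holomorphic in \<open>z\<close> on the right half-plane.
\<close>

lemma
  fixes b :: real and z :: complex
  assumes "b > 0" "Re z > 0"
  shows integrable_laplace_powr:
      "integrable half_line (\<lambda>t. of_real t powr of_real (b - 1) * exp (- (z * of_real t)))"
    and laplace_powr:
      "(\<integral>t. of_real t powr of_real (b - 1) * exp (- (z * of_real t)) \<partial>half_line)
        = of_real (Gamma b) * z powr of_real (- b)"
proof -
  let ?f = "\<lambda>z t. of_real t powr of_real (b - 1) * exp (- (z * of_real t)) :: complex"
  have meas: "?f z \<in> borel_measurable half_line" for z
    by (intro measurable_half_line continuous_intros) auto
  have norm: "norm (?f z t) = t powr (b - 1) * exp (- (Re z * t))" if "t > 0" for z t
    using that by (simp add: norm_mult norm_powr_of_real del: of_real_diff)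
  show "integrable half_line (?f z)"
    by (rule Bochner_Integration.integrable_bound[OF integrable_powr_exp[OF assms] meas])
       (intro AE_I2, use norm in auto)
  let ?U = "{z. Re z > 0}"
  have hol: "(\<lambda>z. \<integral>t. ?f z t \<partial>half_line) holomorphic_on ?U"
  proof (rule holomorphic_on_integral)
    fix z :: complex assume z: "z \<in> ?U"
    have "Re w \<ge> Re z / 2" if "w \<in> ball z (Re z / 2)" for w
      using that abs_Re_le_cmod[of "z - w"] by (simp add: dist_norm)
    moreover from this have "ball z (Re z / 2) \<subseteq> ?U" using z by force
    ultimately show "\<exists>r>0. \<exists>h. ball z r \<subseteq> ?U \<and> integrable half_line h \<and>
        (\<forall>w\<in>ball z r. \<forall>t\<in>space half_line. norm (?f w t) \<le> h t)"
      using z integrable_powr_exp[of b "Re z / 2"] assms norm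
      by (intro exI[of _ "Re z / 2"] exI[of _ "\<lambda>t. t powr (b - 1) * exp (- (Re z / 2 * t))"])
         (auto intro!: mult_left_mono mult_right_mono)
  qed (use meas in \<open>auto intro!: holomorphic_intros\<close>)
  have "(\<integral>t. ?f z t \<partial>half_line) - of_real (Gamma b) * z powr of_real (- b) = 0"
  proof (rule analytic_continuation[where S = ?U and \<xi> = 1 and U = "{of_real x |x. x > 0}"
        and f = "\<lambda>z. (\<integral>t. ?f z t \<partial>half_line) - of_real (Gamma b) * z powr of_real (- b)"])
    show "(\<lambda>z. (\<integral>t. ?f z t \<partial>half_line) - of_real (Gamma b) * z powr of_real (- b)) holomorphic_on ?U"
      by (intro holomorphic_intros hol) (auto simp: complex_nonpos_Reals_iff)
    show "(1::complex) islimpt {of_real x |x. x > 0}"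
      unfolding islimpt_approachable
    proof (intro allI impI)
      fix e :: real assume "e > 0"
      then show "\<exists>x'\<in>{complex_of_real x |x. x > 0}. x' \<noteq> 1 \<and> dist x' 1 < e"
        by (intro bexI[of _ "of_real (1 + e/2)"] CollectI exI[of _ "1 + e/2"])
           (auto simp: dist_norm)
    qed
    fix w assume "w \<in> {complex_of_real x |x. x > 0}"
    then obtain x where x: "w = of_real x" "x > 0" by auto
    then show "(\<integral>t. ?f w t \<partial>half_line) - of_real (Gamma b) * w powr of_real (- b) = 0"
      using Gamma_integral_real_rate[of "of_real b" x] assms by (simp add: Gamma_complex_of_real)
  qed (use assms in \<open>auto simp: open_halfspace_Re_gt convex_halfspace_Re_gt intro: convex_connected\<close>)
  then show "(\<integral>t. ?f z t \<partial>half_line) = of_real (Gamma b) * z powr of_real (- b)" by simp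
qed

section \<open>Integrals along rays in the upper half-plane\<close>

text \<open>
  Exponential decay at \<open>0\<close> and at infinity, uniform in every sector around the imaginary axis but not
  up to the real axis. Together with holomorphy this is all that is used of a cusp form until its Fourier
  series enters.
\<close>

definition sector_decay :: "(complex \<Rightarrow> complex) \<Rightarrow> bool" where
  "sector_decay f \<longleftrightarrow> (\<forall>\<delta>>0. \<exists>C\<ge>0. \<exists>c>0. \<forall>w. w \<noteq> 0 \<longrightarrow> Im w \<ge> \<delta> * norm w \<longrightarrow>
     norm (f w) \<le> C * exp (- (c * (norm w + 1 / norm w))))"

lemma sector_decayE:
  assumes "sector_decay f" "\<delta> > 0"
  obtains C c where "C \<ge> 0" "c > 0"
    "\<And>w. w \<noteq> 0 \<Longrightarrow> Im w \<ge> \<delta> * norm w \<Longrightarrow> norm (f w) \<le> C * exp (- (c * (norm w + 1 / norm w)))"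
proof -
  have "\<exists>C\<ge>0. \<exists>c>0. \<forall>w. w \<noteq> 0 \<longrightarrow> Im w \<ge> \<delta> * norm w \<longrightarrow>
      norm (f w) \<le> C * exp (- (c * (norm w + 1 / norm w)))"
    using assms unfolding sector_decay_def by simp
  then show ?thesis using that by (elim exE conjE) simp
qed

definition ray_integral :: "(complex \<Rightarrow> complex) \<Rightarrow> complex \<Rightarrow> complex" where
  "ray_integral f \<sigma> = (\<integral>t. f (\<sigma> * of_real t) * \<sigma> \<partial>half_line)"

text \<open>
  A power costs only an arbitrarily small part of the exponential decay, because \<open>\<bar>ln r\<bar>\<close> is bounded by
  any positive multiple of \<open>r + 1 / r\<close> up to a constant.
\<close>

lemma powr_le_exp:
  fixes a c :: real
  assumes "c > 0"
  obtains C where "C \<ge> 0" "\<And>r. r > 0 \<Longrightarrow> r powr a \<le> C * exp (c * (r + 1 / r))"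
proof -
  define d where "d = c / (\<bar>a\<bar> + 1)"
  have d: "d > 0" "\<bar>a\<bar> * d \<le> c" using assms by (auto simp: d_def field_simps)
  have "r powr a \<le> exp (\<bar>a\<bar> * \<bar>ln d\<bar>) * exp (c * (r + 1 / r))" if "r > 0" for r
  proof -
    have "ln (d * r) \<le> d * r" "ln (d / r) \<le> d / r"
      using d that ln_le_minus_one[of "d * r"] ln_le_minus_one[of "d / r"] by auto
    then have "ln d + ln r \<le> d * r" "ln d - ln r \<le> d / r"
      using d that by (simp_all add: ln_mult ln_div)
    moreover have "d * r \<ge> 0" "d / r \<ge> 0" using d that by auto
    ultimately have "\<bar>ln r\<bar> \<le> \<bar>ln d\<bar> + d * (r + 1 / r)"
      by (simp add: algebra_simps abs_if split: if_splits)
    then have "\<bar>a\<bar> * \<bar>ln r\<bar> \<le> \<bar>a\<bar> * (\<bar>ln d\<bar> + d * (r + 1 / r))"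
      by (rule mult_left_mono) simp
    also have "\<dots> = \<bar>a\<bar> * \<bar>ln d\<bar> + (\<bar>a\<bar> * d) * (r + 1 / r)" by (simp add: algebra_simps)
    also have "\<dots> \<le> \<bar>a\<bar> * \<bar>ln d\<bar> + c * (r + 1 / r)"
      using d that by (intro add_left_mono mult_right_mono) auto
    finally have "\<bar>a\<bar> * \<bar>ln r\<bar> \<le> \<bar>a\<bar> * \<bar>ln d\<bar> + c * (r + 1 / r)" .
    moreover have "a * ln r \<le> \<bar>a\<bar> * \<bar>ln r\<bar>" by (metis abs_ge_self abs_mult)
    ultimately show ?thesis using that by (simp add: powr_def exp_add[symmetric])
  qed
  then show ?thesis by (intro that[of "exp (\<bar>a\<bar> * \<bar>ln d\<bar>)"]) auto
qed

lemma sector_decay_powr: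
  assumes "sector_decay f" and le: "\<And>w. Im w > 0 \<Longrightarrow> norm (g w) \<le> norm w powr a * norm (f w)"
  shows "sector_decay g"
  unfolding sector_decay_def
proof (intro allI impI)
  fix \<delta> :: real assume \<delta>: "\<delta> > 0"
  obtain C c where C: "C \<ge> 0" "c > 0"
    and bd: "\<And>w. w \<noteq> 0 \<Longrightarrow> Im w \<ge> \<delta> * norm w \<Longrightarrow> norm (f w) \<le> C * exp (- (c * (norm w + 1 / norm w)))"
    using sector_decayE[OF assms(1) \<delta>] by blast
  have "c / 2 > 0" using C by simp
  then obtain D where D: "D \<ge> 0" "\<And>r. r > 0 \<Longrightarrow> r powr a \<le> D * exp (c / 2 * (r + 1 / r))"
    using powr_le_exp[of "c/2" a] by blast
  have "norm (g w) \<le> (D * C) * exp (- (c / 2 * (norm w + 1 / norm w)))"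
    if w: "w \<noteq> 0" "Im w \<ge> \<delta> * norm w" for w
  proof -
    have "Im w > 0" using w \<delta> by (smt (verit) mult_pos_pos zero_less_norm_iff)
    then have "norm (g w) \<le> norm w powr a * norm (f w)" by (rule le)
    also have "\<dots> \<le> (D * exp (c / 2 * (norm w + 1 / norm w))) * (C * exp (- (c * (norm w + 1 / norm w))))"
      using w D bd[OF w] C by (intro mult_mono) auto
    also have "\<dots> = (D * C) * exp (- (c / 2 * (norm w + 1 / norm w)))"
      by (simp add: exp_add[symmetric] field_simps)
    finally show ?thesis .
  qed
  then show "\<exists>C\<ge>0. \<exists>c>0. \<forall>w. w \<noteq> 0 \<longrightarrow> Im w \<ge> \<delta> * norm w \<longrightarrow>
     norm (g w) \<le> C * exp (- (c * (norm w + 1 / norm w)))"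
    using C D(1) by (intro exI[of _ "D * C"] conjI exI[of _ "c / 2"]) auto
qed

text \<open>
  The bound is uniform for directions near \<open>\<sigma>0\<close>, as needed for holomorphy in the direction.
\<close>

lemma sector_decay_ray:
  assumes "sector_decay f" "Im \<sigma>0 > 0"
  obtains r C c where "r > 0" "C \<ge> 0" "c > 0" "ball \<sigma>0 r \<subseteq> {z. Im z > 0}"
    "\<forall>\<sigma>\<in>ball \<sigma>0 r. \<forall>t>0. norm (f (\<sigma> * of_real t)) \<le> C * exp (- (c * (t + 1 / t)))"
proof -
  define r where "r = Im \<sigma>0 / 2"
  define R where "R = norm \<sigma>0 + r"
  have r: "r > 0" "R > 0" using assms by (auto simp: r_def R_def intro: add_nonneg_pos)
  have 1: "Im \<sigma> \<ge> r" "norm \<sigma> \<le> R" if "\<sigma> \<in> ball \<sigma>0 r" for \<sigma>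
  proof -
    have "norm (\<sigma>0 - \<sigma>) < r" using that by (simp add: dist_norm)
    then show "Im \<sigma> \<ge> r" "norm \<sigma> \<le> R"
      using abs_Im_le_cmod[of "\<sigma>0 - \<sigma>"] norm_triangle_ineq4[of \<sigma>0 "\<sigma>0 - \<sigma>"]
      by (auto simp: r_def R_def)
  qed
  obtain C c where C: "C \<ge> 0" "c > 0"
    and bd: "\<And>w. w \<noteq> 0 \<Longrightarrow> Im w \<ge> (r / R) * norm w \<Longrightarrow> norm (f w) \<le> C * exp (- (c * (norm w + 1 / norm w)))"
    using sector_decayE[OF assms(1) divide_pos_pos[OF r]] by blast
  \<comment> \<open>Near \<open>\<sigma>0\<close> the norm of the direction lies between \<open>r\<close> and \<open>R\<close>; this rescales the rates at infinity and at \<open>0\<close>.\<close>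
  define d where "d = c * min r (1 / R)"
  have d: "d > 0" "d \<le> c * r" "d \<le> c / R"
    using C r by (auto simp: d_def min_def field_simps)
  have "norm (f (\<sigma> * of_real t)) \<le> C * exp (- (d * (t + 1 / t)))"
    if s: "\<sigma> \<in> ball \<sigma>0 r" and t: "t > 0" for \<sigma> t
  proof -
    have n: "norm \<sigma> \<ge> r" using 1[OF s] abs_Im_le_cmod[of \<sigma>] r by linarith
    have "\<sigma> * of_real t \<noteq> 0" using n r t by auto
    moreover have "Im (\<sigma> * of_real t) \<ge> (r / R) * norm (\<sigma> * of_real t)"
    proof -
      have "(r / R) * norm \<sigma> \<le> r / R * R" using 1[OF s] r by (intro mult_left_mono) auto
      also have "\<dots> \<le> Im \<sigma>" using 1[OF s] r by simp
      finally have "(r / R) * norm \<sigma> * t \<le> Im \<sigma> * t" using t by (intro mult_right_mono) auto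
      then show ?thesis using t by (simp add: norm_mult)
    qed
    ultimately have "norm (f (\<sigma> * of_real t))
        \<le> C * exp (- (c * (norm (\<sigma> * of_real t) + 1 / norm (\<sigma> * of_real t))))" by (rule bd)
    also have "\<dots> \<le> C * exp (- (d * (t + 1 / t)))"
    proof -
      have "d * t \<le> c * r * t" using d t by (intro mult_right_mono) auto
      also have "\<dots> \<le> c * (norm \<sigma> * t)" using n C t by simp
      finally have a: "d * t \<le> c * (norm \<sigma> * t)" .
      have "d * (1 / t) \<le> c / R * (1 / t)" using d t by (intro mult_right_mono) auto
      also have "\<dots> = c * (1 / (R * t))" by simp
      also have "\<dots> \<le> c * (1 / (norm \<sigma> * t))"
        using 1[OF s] n r C t by (intro mult_left_mono divide_left_mono mult_right_mono mult_pos_pos) auto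
      finally have "d * (1 / t) \<le> c * (1 / (norm \<sigma> * t))" .
      with a have "d * (t + 1 / t) \<le> c * (norm \<sigma> * t + 1 / (norm \<sigma> * t))"
        by (simp add: algebra_simps)
      then show ?thesis using C t by (intro mult_left_mono) (auto simp: norm_mult)
    qed
    finally show ?thesis .
  qed
  moreover have "ball \<sigma>0 r \<subseteq> {z. Im z > 0}"
  proof
    fix z assume "z \<in> ball \<sigma>0 r"
    from 1(1)[OF this] r show "z \<in> {z. Im z > 0}" by simp
  qed
  ultimately show ?thesis
    using that[of r C d] r(1) C(1) d(1) by blast
qed

lemma integrable_ray:
  assumes "sector_decay f" "continuous_on {z. Im z > 0} f" "Im \<sigma> > 0"
  shows "integrable half_line (\<lambda>t. f (\<sigma> * of_real t))"
proof -
  obtain r C c where *: "r > 0" "C \<ge> 0" "c > 0" "ball \<sigma> r \<subseteq> {z. Im z > 0}"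
    "\<forall>s\<in>ball \<sigma> r. \<forall>t>0. norm (f (s * of_real t)) \<le> C * exp (- (c * (t + 1 / t)))"
    using sector_decay_ray[OF assms(1,3)] by blast
  have h: "integrable half_line (\<lambda>t. C * exp (- (c * t)))"
    using integrable_exp_half_line[of c] * by simp
  show ?thesis
  proof (rule Bochner_Integration.integrable_bound[OF h])
    show "(\<lambda>t. f (\<sigma> * of_real t)) \<in> borel_measurable half_line"
    proof (rule measurable_half_line, rule continuous_on_compose2[OF assms(2)])
      show "(\<lambda>t. \<sigma> * of_real t) ` {0<..} \<subseteq> {z. Im z > 0}" using assms(3) by auto
    qed (intro continuous_intros)
    show "AE t in half_line. norm (f (\<sigma> * of_real t)) \<le> norm (C * exp (- (c * t)))"
    proof (intro AE_I2)
      fix t assume "t \<in> space half_line"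
      then have t: "t > 0" by simp
      have "norm (f (\<sigma> * of_real t)) \<le> C * exp (- (c * (t + 1 / t)))"
        using *(1) t by (intro *(5)[rule_format]) auto
      also have "\<dots> \<le> C * exp (- (c * t))"
        using *(2,3) t by (intro mult_left_mono) (auto simp: algebra_simps)
      finally show "norm (f (\<sigma> * of_real t)) \<le> norm (C * exp (- (c * t)))"
        using *(2) by simp
    qed
  qed
qed

text \<open>
  A substitute for Cauchy's theorem that needs no contours: the integral is holomorphic in the
  direction \<open>\<sigma>\<close> and does not change when \<open>\<sigma>\<close> is multiplied by a positive number. It is thus constant on
  the imaginary axis, and by the identity theorem everywhere.
\<close>

theorem ray_integral_independent:
  assumes dec: "sector_decay f" and hol: "f holomorphic_on {z. Im z > 0}" and \<sigma>: "Im \<sigma> > 0"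
  shows "ray_integral f \<sigma> = ray_integral f \<i>"
proof -
  let ?U = "{z. Im z > 0}"
  have meas: "(\<lambda>t. f (\<sigma> * of_real t) * \<sigma>) \<in> borel_measurable half_line" if "Im \<sigma> > 0" for \<sigma>
    using integrable_ray[OF dec holomorphic_on_imp_continuous_on[OF hol] that] by simp
  have F: "ray_integral f holomorphic_on ?U"
    unfolding ray_integral_def [abs_def]
  proof (rule holomorphic_on_integral)
    fix z assume "z \<in> ?U"
    then have "Im z > 0" by simp
    obtain r C c where *: "r > 0" "C \<ge> 0" "c > 0" "ball z r \<subseteq> ?U"
      "\<forall>s\<in>ball z r. \<forall>t>0. norm (f (s * of_real t)) \<le> C * exp (- (c * (t + 1 / t)))"
      using sector_decay_ray[OF dec \<open>Im z > 0\<close>] by blast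
    have "norm (f (s * of_real t) * s) \<le> C * exp (- (c * t)) * (norm z + r)"
      if s: "s \<in> ball z r" and t: "t > 0" for s t
    proof -
      have "norm s \<le> norm z + r"
        using s norm_triangle_ineq4[of z "z - s"] by (simp add: dist_norm)
      moreover have "C * exp (- (c * (t + 1 / t))) \<le> C * exp (- (c * t))"
        using * t by (intro mult_left_mono) (auto simp: algebra_simps)
      ultimately show ?thesis
        using *(5)[rule_format, OF s t] *(2) by (simp only: norm_mult) (intro mult_mono, auto)
    qed
    moreover have "integrable half_line (\<lambda>t. C * exp (- (c * t)) * (norm z + r))"
      using integrable_exp_half_line[of c] * by simp
    ultimately show "\<exists>r>0. \<exists>h. ball z r \<subseteq> ?U \<and> integrable half_line h \<and>
        (\<forall>w\<in>ball z r. \<forall>x\<in>space half_line. norm (f (w * of_real x) * w) \<le> h x)"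
      using * by (intro exI[of _ r] conjI exI[of _ "\<lambda>t. C * exp (- (c * t)) * (norm z + r)"]) auto
  next
    fix t :: real assume "t \<in> space half_line"
    then show "(\<lambda>w. f (w * of_real t) * w) holomorphic_on ?U"
      by (intro holomorphic_intros holomorphic_on_compose_gen[OF _ hol, unfolded o_def]) auto
  qed (use meas in auto)
  have scale: "ray_integral f (\<i> * of_real c) = ray_integral f \<i>" if "c > 0" for c
    using half_line_scale[OF that, of "\<lambda>t. f (\<i> * of_real t) * \<i>"]
    by (simp add: ray_integral_def mult_ac)
  have "ray_integral f \<sigma> - ray_integral f \<i> = 0"
  proof (rule analytic_continuation[where S = ?U and \<xi> = \<i> and U = "{\<i> * of_real c |c. c > 0}"
        and f = "\<lambda>z. ray_integral f z - ray_integral f \<i>"])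
    show "(\<lambda>z. ray_integral f z - ray_integral f \<i>) holomorphic_on ?U"
      by (intro holomorphic_intros F)
    show "\<i> islimpt {\<i> * of_real c |c. c > 0}"
      unfolding islimpt_approachable
    proof (intro allI impI)
      fix e :: real assume "e > 0"
      moreover have "\<i> * of_real (1 + e/2) - \<i> = \<i> * of_real (e/2)" by (simp add: algebra_simps)
      then have "norm (\<i> * of_real (1 + e/2) - \<i>) = \<bar>e/2\<bar>" by (simp only: norm_mult norm_of_real) simp
      ultimately show "\<exists>x'\<in>{\<i> * of_real c |c. c > 0}. x' \<noteq> \<i> \<and> dist x' \<i> < e"
        by (intro bexI[of _ "\<i> * of_real (1 + e/2)"] CollectI exI[of _ "1 + e/2"])
           (auto simp: dist_norm)
    qed
  qed (use scale \<sigma> in \<open>auto simp: open_halfspace_Im_gt convex_halfspace_Im_gt intro: convex_connected\<close>)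
  then show ?thesis by simp
qed

section \<open>The Borel transform as a ray integral\<close>

text \<open>
  All derivatives of \<open>exp\<close> are bounded by \<open>1\<close> on the left half-plane, which is convex and contains \<open>0\<close>.
  The weaker denominator \<open>fact (N - 1)\<close> suffices below, and for \<open>N = 0\<close> it is \<open>1\<close>.
\<close>

lemma norm_exp_minus_partial_sum:
  fixes z :: complex
  assumes "Re z \<le> 0"
  shows "norm (exp z - (\<Sum>l<N. z ^ l / fact l)) \<le> norm z ^ N / fact (N - 1)"
proof (cases N)
  case 0
  then show ?thesis using assms by simp
next
  case (Suc n)
  have "norm (exp z - (\<Sum>l\<le>n. exp 0 * (z - 0) ^ l / fact l)) \<le> 1 * norm (z - 0) ^ Suc n / fact n"
    by (rule complex_Taylor[where S = "{z. Re z \<le> 0}" and f = "\<lambda>_. exp"])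
       (use assms in \<open>auto intro: convex_halfspace_Re_le DERIV_subset DERIV_exp\<close>)
  then show ?thesis
    using Suc by (simp add: lessThan_Suc_atMost)
qed

text \<open>
  The application is \<open>W w = G w * w powr - \<eta>\<close> with \<open>G\<close> a component of the cusp form.
\<close>

locale decaying =
  fixes W :: "complex \<Rightarrow> complex"
  assumes holomorphic: "W holomorphic_on {z. Im z > 0}"
    and decay: "sector_decay W"
begin

text \<open>
  The function \<open>borel_ray \<sigma>\<close> is the exponential generating function of the moments, summed under the
  integral. The direction \<open>\<sigma>\<close> does not matter for the moments, but it decides for which \<open>\<xi>\<close> the integral
  converges.
\<close>

definition moment :: "nat \<Rightarrow> complex" where
  "moment l = ray_integral (\<lambda>w. W w / w ^ l) \<i>"

definition borel_ray :: "complex \<Rightarrow> complex \<Rightarrow> complex" where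
  "borel_ray \<sigma> \<xi> = ray_integral (\<lambda>w. W w * exp (\<xi> / w)) \<sigma>"

definition abs_moment :: "complex \<Rightarrow> nat \<Rightarrow> real" where
  "abs_moment \<sigma> N = (\<integral>t. norm (W (\<sigma> * of_real t) / (\<sigma> * of_real t) ^ N * \<sigma>) \<partial>half_line)"

lemma holomorphic_div_power: "(\<lambda>w. W w / w ^ l) holomorphic_on {z. Im z > 0}"
  by (intro holomorphic_intros holomorphic) auto

lemma decay_div_power: "sector_decay (\<lambda>w. W w / w ^ l)"
proof (rule sector_decay_powr[OF decay, of _ "- real l"])
  fix w :: complex assume "Im w > 0"
  then have "w \<noteq> 0" by auto
  then show "norm (W w / w ^ l) \<le> norm w powr - real l * norm (W w)"
    by (simp add: norm_divide norm_power powr_minus powr_realpow field_simps)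
qed

lemma integrable_div_power:
  assumes "Im \<sigma> > 0"
  shows "integrable half_line (\<lambda>t. W (\<sigma> * of_real t) / (\<sigma> * of_real t) ^ l)"
  by (rule integrable_ray[OF decay_div_power holomorphic_on_imp_continuous_on[OF holomorphic_div_power] assms])

lemma moment_eq: "Im \<sigma> > 0 \<Longrightarrow> ray_integral (\<lambda>w. W w / w ^ l) \<sigma> = moment l"
  unfolding moment_def by (rule ray_integral_independent[OF decay_div_power holomorphic_div_power])

lemma Re_divide_ray_nonpos:
  assumes "Re (\<xi> / \<sigma>) \<le> 0" "t > 0"
  shows "Re (\<xi> / (\<sigma> * of_real t)) \<le> 0"
proof -
  have "\<xi> / (\<sigma> * of_real t) = (\<xi> / \<sigma>) / of_real t" by simp
  then have "Re (\<xi> / (\<sigma> * of_real t)) = Re (\<xi> / \<sigma>) / t" by (simp only: Re_divide_of_real)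
  then show ?thesis using assms by (simp add: divide_nonpos_pos)
qed

lemma measurable_ray:
  assumes "Im \<sigma> > 0"
  shows "(\<lambda>t. W (\<sigma> * of_real t)) \<in> borel_measurable half_line"
  using integrable_div_power[OF assms, of 0] by simp

lemma integrable_borel_ray:
  assumes "Im \<sigma> > 0" "Re (\<xi> / \<sigma>) \<le> 0"
  shows "integrable half_line (\<lambda>t. W (\<sigma> * of_real t) * exp (\<xi> / (\<sigma> * of_real t)))"
proof (rule Bochner_Integration.integrable_bound[OF integrable_div_power[OF assms(1), of 0]])
  show "(\<lambda>t. W (\<sigma> * of_real t) * exp (\<xi> / (\<sigma> * of_real t))) \<in> borel_measurable half_line"
    using assms(1) by (intro borel_measurable_times measurable_ray measurable_half_line continuous_intros) auto
  show "AE t in half_line. norm (W (\<sigma> * of_real t) * exp (\<xi> / (\<sigma> * of_real t)))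
      \<le> norm (W (\<sigma> * of_real t) / (\<sigma> * of_real t) ^ 0)"
    using Re_divide_ray_nonpos[OF assms(2)]
    by (intro AE_I2) (auto simp: norm_mult intro!: mult_left_le)
qed

text \<open>
  The estimate is global in \<open>\<xi>\<close>. It serves twice: with \<open>\<xi>\<close> fixed and \<open>N\<close> growing it gives convergence of
  the Borel series, with \<open>N\<close> fixed it gives the asymptotic expansion of the Laplace integral.
\<close>

lemma borel_ray_remainder:
  assumes \<sigma>: "Im \<sigma> > 0" and \<xi>: "Re (\<xi> / \<sigma>) \<le> 0"
  shows "norm (borel_ray \<sigma> \<xi> - (\<Sum>l<N. \<xi> ^ l / fact l * moment l))
    \<le> norm \<xi> ^ N / fact (N - 1) * abs_moment \<sigma> N"
proof -
  let ?w = "\<lambda>t. \<sigma> * of_real t"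
  have i1: "integrable half_line (\<lambda>t. W (?w t) * exp (\<xi> / ?w t) * \<sigma>)"
    using integrable_borel_ray[OF assms] by simp
  have i2: "integrable half_line (\<lambda>t. \<xi> ^ l / fact l * (W (?w t) / ?w t ^ l * \<sigma>))" for l
    using integrable_div_power[OF \<sigma>] by (intro integrable_mult_right integrable_mult_left)
  have i3: "integrable half_line (\<lambda>t. norm \<xi> ^ N / fact (N - 1) * norm (W (?w t) / ?w t ^ N * \<sigma>))"
    using integrable_div_power[OF \<sigma>, of N]
    by (intro integrable_mult_right integrable_norm integrable_mult_left)
  have "(\<Sum>l<N. \<xi> ^ l / fact l * moment l)
      = (\<Sum>l<N. \<integral>t. \<xi> ^ l / fact l * (W (?w t) / ?w t ^ l * \<sigma>) \<partial>half_line)"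
    by (intro sum.cong refl)
       (simp only: moment_eq[OF \<sigma>, symmetric] ray_integral_def integral_mult_right_zero)
  also have "\<dots> = (\<integral>t. (\<Sum>l<N. \<xi> ^ l / fact l * (W (?w t) / ?w t ^ l * \<sigma>)) \<partial>half_line)"
    using i2 by (intro Bochner_Integration.integral_sum[symmetric])
  finally have sum_eq: "(\<Sum>l<N. \<xi> ^ l / fact l * moment l)
      = (\<integral>t. (\<Sum>l<N. \<xi> ^ l / fact l * (W (?w t) / ?w t ^ l * \<sigma>)) \<partial>half_line)" .
  have diff_eq: "borel_ray \<sigma> \<xi> - (\<Sum>l<N. \<xi> ^ l / fact l * moment l)
      = (\<integral>t. W (?w t) * exp (\<xi> / ?w t) * \<sigma>
          - (\<Sum>l<N. \<xi> ^ l / fact l * (W (?w t) / ?w t ^ l * \<sigma>)) \<partial>half_line)"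
    unfolding borel_ray_def ray_integral_def sum_eq
    by (rule Bochner_Integration.integral_diff[symmetric, OF i1 Bochner_Integration.integrable_sum[OF i2]])
  have "norm (borel_ray \<sigma> \<xi> - (\<Sum>l<N. \<xi> ^ l / fact l * moment l))
      \<le> (\<integral>t. norm \<xi> ^ N / fact (N - 1) * norm (W (?w t) / ?w t ^ N * \<sigma>) \<partial>half_line)"
    unfolding diff_eq
  proof (rule Bochner_Integration.integral_norm_bound_integral[OF _ i3])
    show "integrable half_line (\<lambda>t. W (?w t) * exp (\<xi> / ?w t) * \<sigma>
          - (\<Sum>l<N. \<xi> ^ l / fact l * (W (?w t) / ?w t ^ l * \<sigma>)))"
      by (rule Bochner_Integration.integrable_diff[OF i1 Bochner_Integration.integrable_sum[OF i2]])
    fix t assume "t \<in> space half_line"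
    then have t: "t > 0" by simp
    have "W (?w t) * exp (\<xi> / ?w t) * \<sigma> - (\<Sum>l<N. \<xi> ^ l / fact l * (W (?w t) / ?w t ^ l * \<sigma>))
        = W (?w t) * \<sigma> * (exp (\<xi> / ?w t) - (\<Sum>l<N. (\<xi> / ?w t) ^ l / fact l))"
      unfolding right_diff_distrib sum_distrib_left power_divide
      by (intro arg_cong2[of _ _ _ _ "(-)"] sum.cong refl)
         (simp_all only: divide_inverse mult_ac)
    also have "norm \<dots> \<le> norm (W (?w t) * \<sigma>) * (norm (\<xi> / ?w t) ^ N / fact (N - 1))"
      unfolding norm_mult[of "W (?w t) * \<sigma>"]
      by (intro mult_left_mono norm_exp_minus_partial_sum Re_divide_ray_nonpos[OF \<xi> t]) auto
    also have "\<dots> = norm \<xi> ^ N / fact (N - 1) * norm (W (?w t) / ?w t ^ N * \<sigma>)"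
      unfolding norm_mult norm_divide norm_power power_divide
      by (simp only: divide_inverse inverse_mult_distrib mult_ac)
    finally show "norm (W (?w t) * exp (\<xi> / ?w t) * \<sigma>
          - (\<Sum>l<N. \<xi> ^ l / fact l * (W (?w t) / ?w t ^ l * \<sigma>)))
        \<le> norm \<xi> ^ N / fact (N - 1) * norm (W (?w t) / ?w t ^ N * \<sigma>)" .
  qed
  also have "\<dots> = norm \<xi> ^ N / fact (N - 1) * abs_moment \<sigma> N"
    unfolding abs_moment_def by (rule integral_mult_right_zero)
  finally show ?thesis .
qed

lemma abs_moment_nonneg: "abs_moment \<sigma> N \<ge> 0"
  unfolding abs_moment_def by (intro Bochner_Integration.integral_nonneg) auto

lemma norm_borel_ray_le:
  assumes "Im \<sigma> > 0" "Re (\<xi> / \<sigma>) \<le> 0"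
  shows "norm (borel_ray \<sigma> \<xi>) \<le> abs_moment \<sigma> 0"
  using borel_ray_remainder[OF assms, of 0] by simp

text \<open>
  The decay \<open>exp (- c / t)\<close> at \<open>0\<close> absorbs \<open>t\<^sup>-\<^sup>N\<close> at the price of \<open>N! / c\<^sup>N\<close>; after division by the factorial
  in the Borel transform a geometric series remains.
\<close>

lemma abs_moment_bound:
  assumes \<sigma>: "Im \<sigma> > 0" "norm \<sigma> = 1"
  obtains D c where "c > 0" "D \<ge> 0" "\<forall>N. abs_moment \<sigma> N \<le> D * fact N / c ^ N"
proof -
  obtain r C c where *: "r > 0" "C \<ge> 0" "c > 0" "ball \<sigma> r \<subseteq> {z. Im z > 0}"
    "\<forall>s\<in>ball \<sigma> r. \<forall>t>0. norm (W (s * of_real t)) \<le> C * exp (- (c * (t + 1 / t)))"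
    using sector_decay_ray[OF decay \<sigma>(1)] by blast
  have "abs_moment \<sigma> N \<le> (C * (\<integral>t. exp (- (c * t)) \<partial>half_line)) * fact N / c ^ N" for N
  proof -
    have "abs_moment \<sigma> N \<le> (\<integral>t. C * fact N / c ^ N * exp (- (c * t)) \<partial>half_line)"
      unfolding abs_moment_def
    proof (rule Bochner_Integration.integral_mono)
      show "integrable half_line (\<lambda>t. norm (W (\<sigma> * of_real t) / (\<sigma> * of_real t) ^ N * \<sigma>))"
        using integrable_div_power[OF \<sigma>(1), of N] by (intro integrable_norm integrable_mult_left)
      show "integrable half_line (\<lambda>t. C * fact N / c ^ N * exp (- (c * t)))"
        using integrable_exp_half_line[OF *(3)] by (intro integrable_mult_right)
      fix t assume "t \<in> space half_line"
      then have t: "t > 0" by simp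
      have "(c / t) ^ N / fact N \<le> exp (c / t)"
      proof -
        have "(\<Sum>n\<in>{N}. (c / t) ^ n /\<^sub>R fact n) \<le> exp (c / t)"
          unfolding exp_def using t *(3)
          by (intro sum_le_suminf summable_exp_generic) auto
        then show ?thesis by (simp add: divide_inverse mult.commute)
      qed
      then have a: "1 / t ^ N \<le> fact N / c ^ N * exp (c / t)"
        using t *(3) by (simp add: power_divide field_simps)
      have "norm (W (\<sigma> * of_real t) / (\<sigma> * of_real t) ^ N * \<sigma>) = norm (W (\<sigma> * of_real t)) * (1 / t ^ N)"
        using \<sigma> t by (simp add: norm_mult norm_divide norm_power)
      also have "\<dots> \<le> (C * exp (- (c * (t + 1 / t)))) * (fact N / c ^ N * exp (c / t))"
        using * a t by (intro mult_mono a) auto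
      also have "\<dots> = C * fact N / c ^ N * exp (- (c * t))"
        by (simp add: exp_add[symmetric] algebra_simps)
      finally show "norm (W (\<sigma> * of_real t) / (\<sigma> * of_real t) ^ N * \<sigma>)
          \<le> C * fact N / c ^ N * exp (- (c * t))" .
    qed
    also have "\<dots> = (C * (\<integral>t. exp (- (c * t)) \<partial>half_line)) * fact N / c ^ N" by simp
    finally show ?thesis .
  qed
  moreover have "C * (\<integral>t. exp (- (c * t)) \<partial>half_line) \<ge> 0"
    using * by (intro mult_nonneg_nonneg Bochner_Integration.integral_nonneg) auto
  ultimately show ?thesis using that *(3) by blast
qed

lemma borel_ray_sums:
  assumes \<sigma>: "Im \<sigma> > 0" "norm \<sigma> = 1"
  obtains c where "c > 0"
    "\<And>\<xi>. norm \<xi> < c \<Longrightarrow> Re (\<xi> / \<sigma>) \<le> 0 \<Longrightarrow> (\<lambda>l. \<xi> ^ l / fact l * moment l) sums borel_ray \<sigma> \<xi>"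
proof -
  obtain D c where c: "c > 0" "D \<ge> 0" "\<forall>N. abs_moment \<sigma> N \<le> D * fact N / c ^ N"
    using abs_moment_bound[OF \<sigma>] by blast
  have "(\<lambda>l. \<xi> ^ l / fact l * moment l) sums borel_ray \<sigma> \<xi>"
    if \<xi>: "norm \<xi> < c" "Re (\<xi> / \<sigma>) \<le> 0" for \<xi>
  proof -
    let ?x = "norm \<xi> / c"
    have "(\<lambda>N. (\<Sum>l<N. \<xi> ^ l / fact l * moment l) - borel_ray \<sigma> \<xi>) \<longlonglongrightarrow> 0"
    proof (rule Lim_null_comparison)
      have "(\<lambda>N. D * (real N * ?x ^ N)) \<longlonglongrightarrow> D * 0"
        using \<xi> c by (intro tendsto_mult_left powser_times_n_limit_0) auto
      then show "(\<lambda>N. D * (real N * ?x ^ N)) \<longlonglongrightarrow> 0" by simp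
      show "\<forall>\<^sub>F N in sequentially.
          norm ((\<Sum>l<N. \<xi> ^ l / fact l * moment l) - borel_ray \<sigma> \<xi>) \<le> D * (real N * ?x ^ N)"
        using eventually_gt_at_top[of 0]
      proof eventually_elim
        case (elim N)
        have "norm ((\<Sum>l<N. \<xi> ^ l / fact l * moment l) - borel_ray \<sigma> \<xi>)
            \<le> norm \<xi> ^ N / fact (N - 1) * abs_moment \<sigma> N"
          using borel_ray_remainder[OF \<sigma>(1) \<xi>(2), of N] by (simp add: norm_minus_commute)
        also have "\<dots> \<le> norm \<xi> ^ N / fact (N - 1) * (D * fact N / c ^ N)"
          using c by (intro mult_left_mono) auto
        also have "\<dots> = D * (real N * ?x ^ N)"
          using fact_reduce[OF elim, where ?'a = real] by (simp add: power_divide)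
        finally show ?case .
      qed
    qed
    then show ?thesis unfolding sums_def by (simp add: LIM_zero_iff)
  qed
  then show ?thesis using that c(1) by blast
qed

lemma holomorphic_borel_ray:
  assumes \<sigma>: "Im \<sigma> > 0"
  shows "borel_ray \<sigma> holomorphic_on {\<xi>. Re (\<xi> / \<sigma>) < 0}"
  unfolding borel_ray_def[abs_def] ray_integral_def
proof (rule holomorphic_on_integral)
  let ?U = "{\<xi>. Re (\<xi> / \<sigma>) < 0}"
  have op: "open ?U"
    using \<sigma> by (intro open_Collect_less continuous_intros) auto
  let ?h = "\<lambda>t. norm (W (\<sigma> * of_real t) * \<sigma>)"
  fix z assume "z \<in> ?U"
  then obtain r where r: "r > 0" "ball z r \<subseteq> ?U" using op open_contains_ball by blast
  have "integrable half_line ?h"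
    using integrable_div_power[OF \<sigma>, of 0] by simp
  moreover have "norm (W (\<sigma> * of_real t) * exp (\<xi> / (\<sigma> * of_real t)) * \<sigma>) \<le> ?h t"
    if "t > 0" "\<xi> \<in> ?U" for \<xi> t
    using Re_divide_ray_nonpos[of \<xi> \<sigma> t] that by (simp add: norm_mult mult_left_le mult_right_mono)
  ultimately show "\<exists>r>0. \<exists>h. ball z r \<subseteq> ?U \<and> integrable half_line h \<and>
      (\<forall>w\<in>ball z r. \<forall>t\<in>space half_line. norm (W (\<sigma> * of_real t) * exp (w / (\<sigma> * of_real t)) * \<sigma>) \<le> h t)"
    using r by (intro exI[of _ r] conjI exI[of _ ?h]) auto
next
  fix \<xi> assume "\<xi> \<in> {\<xi>. Re (\<xi> / \<sigma>) < 0}"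
  then show "(\<lambda>t. W (\<sigma> * of_real t) * exp (\<xi> / (\<sigma> * of_real t)) * \<sigma>) \<in> borel_measurable half_line"
    using integrable_borel_ray[OF \<sigma>, of \<xi>] by simp
next
  fix t :: real assume "t \<in> space half_line"
  then show "(\<lambda>\<xi>. W (\<sigma> * of_real t) * exp (\<xi> / (\<sigma> * of_real t)) * \<sigma>) holomorphic_on {\<xi>. Re (\<xi> / \<sigma>) < 0}"
    using \<sigma> by (intro holomorphic_intros) auto
qed

end

section \<open>Laplace integrals of the Borel transform\<close>

lemma Ln_of_real_cis:
  assumes "t > 0" "-pi < \<theta>" "\<theta> < pi"
  shows "Ln (of_real t * cis \<theta>) = of_real (ln t) + \<i> * of_real \<theta>"
proof -
  have "of_real t * cis \<theta> = exp (of_real (ln t) + \<i> * of_real \<theta>)"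
    using assms by (simp add: exp_add cis_conv_exp exp_of_real)
  then show ?thesis using assms by (simp add: Ln_exp)
qed

lemma powr_of_real_cis:
  assumes "t > 0" "-pi < \<theta>" "\<theta> < pi"
  shows "(of_real t * cis \<theta>) powr of_real a = of_real (t powr a) * cis (a * \<theta>)"
proof -
  have "(of_real t * cis \<theta>) powr of_real a = exp (of_real a * (of_real (ln t) + \<i> * of_real \<theta>))"
    using assms Ln_of_real_cis[OF assms] by (simp add: powr_def)
  also have "\<dots> = exp (of_real (a * ln t)) * exp (\<i> * of_real (a * \<theta>))"
    by (simp add: exp_add[symmetric] algebra_simps)
  also have "exp (complex_of_real (a * ln t)) = of_real (t powr a)"
    unfolding exp_of_real using assms by (simp add: powr_def)
  also have "exp (\<i> * complex_of_real (a * \<theta>)) = cis (a * \<theta>)"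
    by (simp only: cis_conv_exp)
  finally show ?thesis .
qed

lemma
  fixes b \<theta> :: real and v :: complex
  assumes \<theta>: "0 < \<theta>" "\<theta> < pi" and b: "b > 0" and v: "Re (cis \<theta> * v) > 0"
  shows integrable_laplace_ray: "integrable half_line (\<lambda>t. exp (- (of_real t * cis \<theta> * v)) *
      (of_real t * cis \<theta>) powr of_real (b - 1) * cis \<theta>)"
    and laplace_ray: "(\<integral>t. exp (- (of_real t * cis \<theta> * v)) *
      (of_real t * cis \<theta>) powr of_real (b - 1) * cis \<theta> \<partial>half_line)
      = of_real (Gamma b) * (cis (b * \<theta>) * (cis \<theta> * v) powr of_real (- b))"
proof -
  have eq: "exp (- (of_real t * cis \<theta> * v)) * (of_real t * cis \<theta>) powr of_real (b - 1) * cis \<theta>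
      = (of_real t powr of_real (b - 1) * exp (- ((cis \<theta> * v) * of_real t))) * cis (b * \<theta>)"
    if "t \<in> space half_line" for t
  proof -
    have "t > 0" using that by simp
    then have "(of_real t * cis \<theta>) powr of_real (b - 1) * cis \<theta>
        = of_real (t powr (b - 1)) * (cis ((b - 1) * \<theta>) * cis \<theta>)"
      using powr_of_real_cis[of t \<theta> "b - 1"] \<theta> by simp
    also have "cis ((b - 1) * \<theta>) * cis \<theta> = cis (b * \<theta>)"
      by (simp add: cis_mult algebra_simps)
    finally show ?thesis using \<open>t > 0\<close> powr_of_real[of t "b - 1"] by (simp add: mult_ac)
  qed
  show "integrable half_line (\<lambda>t. exp (- (of_real t * cis \<theta> * v)) *
      (of_real t * cis \<theta>) powr of_real (b - 1) * cis \<theta>)"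
    by (rule Bochner_Integration.integrable_cong[OF refl eq, THEN iffD2])
       (use integrable_laplace_powr[OF b v] in \<open>auto intro!: integrable_mult_left simp del: of_real_diff\<close>)
  have "(\<integral>t. exp (- (of_real t * cis \<theta> * v)) *
      (of_real t * cis \<theta>) powr of_real (b - 1) * cis \<theta> \<partial>half_line)
      = (\<integral>t. (of_real t powr of_real (b - 1) * exp (- ((cis \<theta> * v) * of_real t))) * cis (b * \<theta>) \<partial>half_line)"
    by (rule Bochner_Integration.integral_cong[OF refl eq])
  then show "(\<integral>t. exp (- (of_real t * cis \<theta> * v)) *
      (of_real t * cis \<theta>) powr of_real (b - 1) * cis \<theta> \<partial>half_line)
      = of_real (Gamma b) * (cis (b * \<theta>) * (cis \<theta> * v) powr of_real (- b))"
    using laplace_powr[OF b v] by (simp del: of_real_diff add: mult_ac)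
qed

text \<open>
  Here no multiple of \<open>2\<pi>\<close> intervenes: \<open>\<theta>\<close> and the argument of \<open>\<tau>\<close> both lie in \<open>(0, \<pi>)\<close>.
\<close>

lemma cis_powr_inverse:
  assumes \<theta>: "0 < \<theta>" "\<theta> < pi" and \<tau>: "Im \<tau> > 0"
  shows "cis (b * \<theta>) * (cis \<theta> * (1 / \<tau>)) powr of_real (- b) = \<tau> powr of_real b"
proof -
  have [simp]: "\<tau> \<noteq> 0" using \<tau> by auto
  have im: "0 < Im (Ln \<tau>)" "Im (Ln \<tau>) < pi" using \<tau> Im_Ln_pos_lt_imp by auto
  have "cis \<theta> * (1 / \<tau>) = exp (\<i> * of_real \<theta> - Ln \<tau>)"
    by (simp add: exp_diff cis_conv_exp)
  then have "Ln (cis \<theta> * (1 / \<tau>)) = \<i> * of_real \<theta> - Ln \<tau>"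
    using im \<theta> by (simp add: Ln_exp)
  then have "(cis \<theta> * (1 / \<tau>)) powr of_real (- b) = exp (of_real (- b) * (\<i> * of_real \<theta> - Ln \<tau>))"
    unfolding powr_def by (simp del: of_real_minus)
  then show ?thesis
    by (simp add: powr_def cis_conv_exp exp_add[symmetric] algebra_simps)
qed

lemma measurable_fst_half_line:
  "f \<in> borel_measurable half_line \<Longrightarrow> (\<lambda>p. f (fst p)) \<in> borel_measurable (half_line \<Otimes>\<^sub>M half_line)"
  by (rule measurable_compose[OF measurable_fst])

lemma measurable_snd_half_line:
  "f \<in> borel_measurable half_line \<Longrightarrow> (\<lambda>p. f (snd p)) \<in> borel_measurable (half_line \<Otimes>\<^sub>M half_line)"
  by (rule measurable_compose[OF measurable_snd])

lemma half_line_Fubini: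
  fixes f :: "real \<Rightarrow> real \<Rightarrow> complex"
  assumes m: "(\<lambda>p. f (fst p) (snd p)) \<in> borel_measurable (half_line \<Otimes>\<^sub>M half_line)"
    and A: "integrable half_line A" and B: "integrable half_line B"
    and le: "\<And>t r. t > 0 \<Longrightarrow> r > 0 \<Longrightarrow> norm (f t r) \<le> (A t :: real) * B r"
  shows "(\<integral>t. (\<integral>r. f t r \<partial>half_line) \<partial>half_line) = (\<integral>r. (\<integral>t. f t r \<partial>half_line) \<partial>half_line)"
proof -
  interpret S: sigma_finite_measure half_line by (rule sigma_finite_half_line)
  interpret P: pair_sigma_finite half_line half_line ..
  have mAB: "(\<lambda>p. A (fst p) * B (snd p)) \<in> borel_measurable (half_line \<Otimes>\<^sub>M half_line)"
    using A B by (intro borel_measurable_times measurable_fst_half_line measurable_snd_half_line) auto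
  have "integrable (half_line \<Otimes>\<^sub>M half_line) (\<lambda>p. A (fst p) * B (snd p))"
    by (rule P.Fubini_integrable[OF mAB]) (use A B in \<open>auto simp: abs_mult\<close>)
  then have "integrable (half_line \<Otimes>\<^sub>M half_line) (\<lambda>p. f (fst p) (snd p))"
    by (rule Bochner_Integration.integrable_bound[OF _ m])
       (intro AE_I2, use le in \<open>force simp: space_pair_measure\<close>)
  moreover have "(\<lambda>p. f (fst p) (snd p)) = (\<lambda>(t, r). f t r)" by (simp add: fun_eq_iff)
  ultimately have "integrable (half_line \<Otimes>\<^sub>M half_line) (\<lambda>(t, r). f t r)" by simp
  from P.Fubini_integral[OF this] show ?thesis by simp
qed

lemma norm_laplace_kernel:
  "norm (exp (- (of_real t * cis \<theta>) / \<tau>)) = exp (- (Re (cis \<theta> / \<tau>) * t))"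
proof -
  have "- (of_real t * cis \<theta>) / \<tau> = of_real (- t) * (cis \<theta> / \<tau>)" by simp
  then have "Re (- (of_real t * cis \<theta>) / \<tau>) = - (Re (cis \<theta> / \<tau>) * t)"
    by (simp only: Re_complex_of_real times_complex.sel Im_complex_of_real) simp
  then show ?thesis by (simp only: norm_exp_eq_Re)
qed

lemma Re_ray_divide_neg:
  assumes "Re (cis \<theta> / \<sigma>) < 0" "t > 0"
  shows "Re (of_real t * cis \<theta> / \<sigma>) < 0"
proof -
  have "Re (of_real t * (cis \<theta> / \<sigma>)) = t * Re (cis \<theta> / \<sigma>)"
    by (simp only: Re_complex_of_real times_complex.sel Im_complex_of_real)
  then show ?thesis using assms by (simp add: mult_pos_neg)
qed

lemma norm_powr_ray:
  "t > 0 \<Longrightarrow> norm ((of_real t * cis \<theta>) powr of_real a) = t powr a"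
  by (simp add: norm_powr_of_real norm_mult)

lemma powr_add_nat:
  fixes x :: complex
  assumes "x \<noteq> 0"
  shows "x powr of_real (\<eta> + real l - 1) = x powr of_real (\<eta> - 1) * x ^ l"
proof -
  have "complex_of_real (\<eta> + real l - 1) = of_real (\<eta> - 1) + of_nat l" by simp
  then show ?thesis using assms by (simp only: powr_add powr_nat') simp
qed

context decaying
begin

definition borel_transform :: "real \<Rightarrow> complex \<Rightarrow> complex \<Rightarrow> complex" where
  "borel_transform \<eta> \<sigma> \<xi> = \<xi> powr of_real (\<eta> - 1) * borel_ray \<sigma> \<xi>"

definition coeff :: "real \<Rightarrow> nat \<Rightarrow> complex" where
  "coeff \<eta> l = of_real (Gamma (\<eta> + real l)) / fact l * moment l"

lemma borel_continuation_borel_transform: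
  assumes \<theta>: "0 < \<theta>" "\<theta> < pi" and \<sigma>: "Im \<sigma> > 0" "norm \<sigma> = 1" "Re (cis \<theta> / \<sigma>) < 0" and \<eta>: "\<eta> > 0"
  shows "borel_continuation \<eta> \<theta> (\<lambda>l. K * coeff \<eta> l) (\<lambda>\<xi>. K * borel_transform \<eta> \<sigma> \<xi>)"
  unfolding borel_continuation_def
proof (intro conjI exI[of _ "{\<xi>. Re (\<xi> / \<sigma>) < 0} \<inter> {\<xi>. Im \<xi> > 0}"] allI impI)
  let ?U = "{\<xi>. Re (\<xi> / \<sigma>) < 0} \<inter> {\<xi>. Im \<xi> > 0}"
  have \<sigma>0: "\<sigma> \<noteq> 0" using \<sigma> by auto
  show "open ?U" using \<sigma>0
    by (intro open_Int open_Collect_less continuous_intros) auto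
  have neg: "Re (of_real t * cis \<theta> / \<sigma>) < 0" if "t > 0" for t
    using Re_ray_divide_neg[OF \<sigma>(3) that] .
  show "of_real t * cis \<theta> \<in> ?U" if "t > 0" for t
    using neg[OF that] that \<theta> sin_gt_zero by simp
  show "(\<lambda>\<xi>. K * borel_transform \<eta> \<sigma> \<xi>) holomorphic_on ?U"
    unfolding borel_transform_def
    by (intro holomorphic_intros holomorphic_on_subset[OF holomorphic_borel_ray[OF \<sigma>(1)]])
       (auto simp: complex_nonpos_Reals_iff)
  obtain c where c: "c > 0"
    "\<And>\<xi>. norm \<xi> < c \<Longrightarrow> Re (\<xi> / \<sigma>) \<le> 0 \<Longrightarrow> (\<lambda>l. \<xi> ^ l / fact l * moment l) sums borel_ray \<sigma> \<xi>"
    using borel_ray_sums[OF \<sigma>(1,2)] by blast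
  show "\<forall>\<^sub>F t in at_right 0. (\<lambda>l. K * coeff \<eta> l * (of_real t * cis \<theta>) powr of_real (\<eta> + real l - 1)
      / of_real (Gamma (\<eta> + real l))) sums (K * borel_transform \<eta> \<sigma> (of_real t * cis \<theta>))"
    unfolding eventually_at_right_field
  proof (intro exI[of _ c] conjI c(1) allI impI)
    fix t :: real assume t: "0 < t" "t < c"
    let ?\<xi> = "of_real t * cis \<theta>"
    have x0: "?\<xi> \<noteq> 0" using t by simp
    have "(\<lambda>l. K * ?\<xi> powr of_real (\<eta> - 1) * (?\<xi> ^ l / fact l * moment l)) sums
        (K * ?\<xi> powr of_real (\<eta> - 1) * borel_ray \<sigma> ?\<xi>)"
      by (intro sums_mult c(2)) (use t neg[of t] in \<open>auto simp: norm_mult\<close>)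
    moreover have "K * ?\<xi> powr of_real (\<eta> - 1) * (?\<xi> ^ l / fact l * moment l)
        = K * coeff \<eta> l * ?\<xi> powr of_real (\<eta> + real l - 1) / of_real (Gamma (\<eta> + real l))" for l
    proof -
      have "?\<xi> powr of_real (\<eta> + real l - 1) = ?\<xi> powr of_real (\<eta> - 1) * ?\<xi> ^ l"
        by (rule powr_add_nat[OF x0])
      moreover have "Gamma (\<eta> + real l) \<noteq> 0"
        using Gamma_real_pos[of "\<eta> + real l"] \<eta> by (metis add_pos_nonneg of_nat_0_le_iff less_irrefl)
      ultimately show ?thesis by (simp add: coeff_def)
    qed
    ultimately show "(\<lambda>l. K * coeff \<eta> l * ?\<xi> powr of_real (\<eta> + real l - 1)
      / of_real (Gamma (\<eta> + real l))) sums (K * borel_transform \<eta> \<sigma> ?\<xi>)"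
      by (simp only: borel_transform_def mult.assoc)
  qed
qed

context
  fixes \<eta> \<theta> :: real and \<sigma> :: complex
  assumes \<eta>: "\<eta> > 0" and \<theta>: "0 < \<theta>" "\<theta> < pi"
    and \<sigma>: "Im \<sigma> > 0" "norm \<sigma> = 1" "Re (cis \<theta> / \<sigma>) < 0"
begin

lemma integrable_laplace_borel:
  assumes \<tau>: "Re (cis \<theta> / \<tau>) > 0"
  shows "integrable half_line (\<lambda>t. exp (- (of_real t * cis \<theta>) / \<tau>) *
      borel_transform \<eta> \<sigma> (of_real t * cis \<theta>) * cis \<theta>)"
proof -
  have c1: "continuous_on {0<..} (\<lambda>t. borel_ray \<sigma> (of_real t * cis \<theta>))"
    by (rule continuous_on_compose2[OF holomorphic_on_imp_continuous_on[OF holomorphic_borel_ray[OF \<sigma>(1)]]])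
       (use Re_ray_divide_neg[OF \<sigma>(3)] in \<open>auto intro!: continuous_intros\<close>)
  have "sin \<theta> > 0" using \<theta> sin_gt_zero by blast
  then have c2: "continuous_on {0<..} (\<lambda>t. (of_real t * cis \<theta>) powr of_real (\<eta> - 1))"
    by (intro continuous_intros) (auto simp: complex_nonpos_Reals_iff)
  have m: "(\<lambda>t. exp (- (of_real t * cis \<theta>) / \<tau>) * borel_transform \<eta> \<sigma> (of_real t * cis \<theta>) * cis \<theta>)
      \<in> borel_measurable half_line"
    unfolding borel_transform_def
    by (intro measurable_half_line continuous_intros c1 c2) (use \<tau> in auto)
  have h: "integrable half_line (\<lambda>t. abs_moment \<sigma> 0 * (t powr (\<eta> - 1) * exp (- (Re (cis \<theta> / \<tau>) * t))))"
    by (intro integrable_mult_right integrable_powr_exp \<eta> \<tau>)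
  show ?thesis
  proof (rule Bochner_Integration.integrable_bound[OF h m], intro AE_I2)
    fix t assume "t \<in> space half_line"
    then have t: "t > 0" by simp
    have "norm (exp (- (of_real t * cis \<theta>) / \<tau>) * borel_transform \<eta> \<sigma> (of_real t * cis \<theta>) * cis \<theta>)
        = norm (borel_ray \<sigma> (of_real t * cis \<theta>)) * (t powr (\<eta> - 1) * exp (- (Re (cis \<theta> / \<tau>) * t)))"
      unfolding borel_transform_def norm_mult norm_laplace_kernel norm_powr_ray[OF t] by simp
    also have "\<dots> \<le> abs_moment \<sigma> 0 * (t powr (\<eta> - 1) * exp (- (Re (cis \<theta> / \<tau>) * t)))"
      using Re_ray_divide_neg[OF \<sigma>(3) t] by (intro mult_right_mono norm_borel_ray_le \<sigma>(1)) auto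
    finally show "norm (exp (- (of_real t * cis \<theta>) / \<tau>) * borel_transform \<eta> \<sigma> (of_real t * cis \<theta>) * cis \<theta>)
        \<le> norm (abs_moment \<sigma> 0 * (t powr (\<eta> - 1) * exp (- (Re (cis \<theta> / \<tau>) * t))))"
      using abs_moment_nonneg by simp
  qed
qed

lemma laplace_monomial:
  assumes "Im \<tau> > 0" "Re (cis \<theta> / \<tau>) > 0"
  shows "integrable half_line (\<lambda>t. exp (- (of_real t * cis \<theta>) / \<tau>) *
      (of_real t * cis \<theta>) powr of_real (\<eta> + real l - 1) * cis \<theta>)"
    and "(\<integral>t. exp (- (of_real t * cis \<theta>) / \<tau>) *
      (of_real t * cis \<theta>) powr of_real (\<eta> + real l - 1) * cis \<theta> \<partial>half_line)
      = of_real (Gamma (\<eta> + real l)) * \<tau> powr of_real (\<eta> + real l)"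
  using integrable_laplace_ray[OF \<theta>, of "\<eta> + real l" "1 / \<tau>"] laplace_ray[OF \<theta>, of "\<eta> + real l" "1 / \<tau>"]
    cis_powr_inverse[OF \<theta> assms(1), of "\<eta> + real l"] assms \<eta>
  by (simp_all del: of_real_add of_real_diff of_real_minus)

lemma laplace_borel_remainder:
  assumes \<tau>: "Im \<tau> > 0" "Re (cis \<theta> / \<tau>) > 0"
  shows "norm ((\<integral>t. exp (- (of_real t * cis \<theta>) / \<tau>) *
          borel_transform \<eta> \<sigma> (of_real t * cis \<theta>) * cis \<theta> \<partial>half_line)
        - (\<Sum>l<N. coeff \<eta> l * \<tau> powr of_real (\<eta> + real l)))
    \<le> abs_moment \<sigma> N / fact (N - 1) * Gamma (\<eta> + real N) * Re (cis \<theta> / \<tau>) powr (- (\<eta> + real N))"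
proof -
  let ?x = "Re (cis \<theta> / \<tau>)"
  let ?B = "\<lambda>t. exp (- (of_real t * cis \<theta>) / \<tau>) * borel_transform \<eta> \<sigma> (of_real t * cis \<theta>) * cis \<theta>"
  let ?M = "\<lambda>l t. moment l / fact l * (exp (- (of_real t * cis \<theta>) / \<tau>) *
      (of_real t * cis \<theta>) powr of_real (\<eta> + real l - 1) * cis \<theta>)"
  let ?h = "\<lambda>t. abs_moment \<sigma> N / fact (N - 1) * (t powr ((\<eta> + real N) - 1) * exp (- (?x * t)))"
  have iM: "integrable half_line (?M l)" for l
    by (intro integrable_mult_right laplace_monomial(1) \<tau>)
  have ih: "integrable half_line ?h"
    using \<eta> \<tau> by (intro integrable_mult_right integrable_powr_exp) auto
  have "(\<Sum>l<N. coeff \<eta> l * \<tau> powr of_real (\<eta> + real l)) = (\<Sum>l<N. \<integral>t. ?M l t \<partial>half_line)"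
  proof (intro sum.cong refl)
    fix l
    have "(\<integral>t. ?M l t \<partial>half_line)
        = moment l / fact l * (of_real (Gamma (\<eta> + real l)) * \<tau> powr of_real (\<eta> + real l))"
      unfolding laplace_monomial(2)[OF \<tau>, symmetric] by (rule integral_mult_right_zero)
    then show "coeff \<eta> l * \<tau> powr of_real (\<eta> + real l) = (\<integral>t. ?M l t \<partial>half_line)"
      by (simp only: coeff_def divide_inverse mult_ac)
  qed
  moreover have "(\<integral>t. (\<Sum>l<N. ?M l t) \<partial>half_line) = (\<Sum>l<N. \<integral>t. ?M l t \<partial>half_line)"
    by (rule Bochner_Integration.integral_sum[OF iM])
  ultimately have sum_eq: "(\<Sum>l<N. coeff \<eta> l * \<tau> powr of_real (\<eta> + real l)) = (\<integral>t. (\<Sum>l<N. ?M l t) \<partial>half_line)"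
    by (rule trans[OF _ sym])
  have diff_eq: "(\<integral>t. ?B t \<partial>half_line) - (\<Sum>l<N. coeff \<eta> l * \<tau> powr of_real (\<eta> + real l))
      = (\<integral>t. ?B t - (\<Sum>l<N. ?M l t) \<partial>half_line)"
    unfolding sum_eq
    by (rule Bochner_Integration.integral_diff[symmetric, OF integrable_laplace_borel[OF \<tau>(2)]
          Bochner_Integration.integrable_sum[OF iM]])
  have "norm ((\<integral>t. ?B t \<partial>half_line) - (\<Sum>l<N. coeff \<eta> l * \<tau> powr of_real (\<eta> + real l)))
      \<le> (\<integral>t. ?h t \<partial>half_line)"
    unfolding diff_eq
  proof (rule Bochner_Integration.integral_norm_bound_integral[OF _ ih])
    show "integrable half_line (\<lambda>t. ?B t - (\<Sum>l<N. ?M l t))"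
      by (rule Bochner_Integration.integrable_diff[OF integrable_laplace_borel[OF \<tau>(2)]
            Bochner_Integration.integrable_sum[OF iM]])
    fix t assume "t \<in> space half_line"
    then have t: "t > 0" by simp
    let ?\<xi> = "of_real t * cis \<theta>"
    have x0: "?\<xi> \<noteq> 0" using t by simp
    have "?M l t = exp (- ?\<xi> / \<tau>) * ?\<xi> powr of_real (\<eta> - 1) * cis \<theta> * (?\<xi> ^ l / fact l * moment l)" for l
      unfolding powr_add_nat[OF x0] divide_inverse by (simp only: mult_ac)
    then have "(\<Sum>l<N. ?M l t) = exp (- ?\<xi> / \<tau>) * ?\<xi> powr of_real (\<eta> - 1) * cis \<theta> *
        (\<Sum>l<N. ?\<xi> ^ l / fact l * moment l)"
      by (simp only: sum_distrib_left)
    moreover have "?B t = exp (- ?\<xi> / \<tau>) * ?\<xi> powr of_real (\<eta> - 1) * cis \<theta> * borel_ray \<sigma> ?\<xi>"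
      unfolding borel_transform_def by (simp only: mult_ac)
    ultimately have "?B t - (\<Sum>l<N. ?M l t) = exp (- ?\<xi> / \<tau>) * ?\<xi> powr of_real (\<eta> - 1) * cis \<theta> *
        (borel_ray \<sigma> ?\<xi> - (\<Sum>l<N. ?\<xi> ^ l / fact l * moment l))"
      by (simp only: right_diff_distrib)
    then have "norm (?B t - (\<Sum>l<N. ?M l t)) = exp (- (?x * t)) * t powr (\<eta> - 1) *
        norm (borel_ray \<sigma> ?\<xi> - (\<Sum>l<N. ?\<xi> ^ l / fact l * moment l))"
      by (simp only: norm_mult norm_laplace_kernel norm_powr_ray[OF t] norm_cis mult_1_right)
    moreover have "\<dots> \<le> exp (- (?x * t)) * t powr (\<eta> - 1) * (norm ?\<xi> ^ N / fact (N - 1) * abs_moment \<sigma> N)"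
      using Re_ray_divide_neg[OF \<sigma>(3) t] by (intro mult_left_mono borel_ray_remainder \<sigma>(1)) auto
    moreover have "\<dots> = ?h t"
    proof -
      have "t powr (\<eta> + real N - 1) = t powr (\<eta> - 1) * t ^ N"
        using t by (simp add: powr_add[symmetric] powr_realpow[symmetric] algebra_simps)
      then show ?thesis using t by (simp add: norm_mult)
    qed
    ultimately show "norm (?B t - (\<Sum>l<N. ?M l t)) \<le> ?h t" by linarith
  qed
  also have "(\<integral>t. ?h t \<partial>half_line)
      = abs_moment \<sigma> N / fact (N - 1) * (Gamma (\<eta> + real N) * ?x powr (- (\<eta> + real N)))"
    using \<eta> \<tau> by (subst integral_mult_right_zero, subst integral_powr_exp) auto
  finally show ?thesis by (simp only: mult.assoc)
qed

text \<open>
  Fubini: the inner integral over \<open>\<xi>\<close> is the Laplace integral of \<open>\<xi>\<^sup>\<eta>\<^sup>-\<^sup>1\<close> at \<open>1 / \<tau> - 1 / w\<close>. Since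
  \<open>Re (\<xi> / w) \<le> 0\<close>, the double integrand is dominated by a product of functions of one variable.
\<close>

lemma laplace_borel_eq_ray_integral:
  assumes \<tau>: "Re (cis \<theta> / \<tau>) > 0"
  shows "(\<integral>t. exp (- (of_real t * cis \<theta>) / \<tau>) *
          borel_transform \<eta> \<sigma> (of_real t * cis \<theta>) * cis \<theta> \<partial>half_line)
    = of_real (Gamma \<eta>) * ray_integral
        (\<lambda>w. W w * (cis (\<eta> * \<theta>) * (cis \<theta> * (1 / \<tau> - 1 / w)) powr of_real (- \<eta>))) \<sigma>"
proof -
  let ?E = "\<lambda>t. exp (- (of_real t * cis \<theta>) / \<tau>) * (of_real t * cis \<theta>) powr of_real (\<eta> - 1) * cis \<theta>"
  let ?V = "\<lambda>r. W (\<sigma> * of_real r) * \<sigma>"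
  let ?f = "\<lambda>t r. ?E t * (?V r * exp (of_real t * cis \<theta> / (\<sigma> * of_real r)))"
  have \<tau>0: "\<tau> \<noteq> 0" using \<tau> by auto
  have iV: "integrable half_line ?V" using integrable_div_power[OF \<sigma>(1), of 0] by simp
  have iE: "integrable half_line ?E"
    using integrable_laplace_ray[OF \<theta> \<eta>, of "1 / \<tau>"] \<tau> by (simp del: of_real_diff)
  have eq1: "?f t r = exp (- (of_real t * cis \<theta> * (1 / \<tau> - 1 / (\<sigma> * of_real r)))) *
      (of_real t * cis \<theta>) powr of_real (\<eta> - 1) * cis \<theta> * ?V r" for t r
  proof -
    have "- (of_real t * cis \<theta> * (1 / \<tau> - 1 / (\<sigma> * of_real r)))
        = - (of_real t * cis \<theta>) / \<tau> + of_real t * cis \<theta> / (\<sigma> * of_real r)"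
      by (simp add: right_diff_distrib)
    then show ?thesis by (simp only: exp_add mult_ac)
  qed
  have id: "(\<lambda>t. complex_of_real t) \<in> borel_measurable half_line"
    by (intro measurable_half_line continuous_intros)
  have m: "(\<lambda>p. ?f (fst p) (snd p)) \<in> borel_measurable (half_line \<Otimes>\<^sub>M half_line)"
    using measurable_fst_half_line[OF borel_measurable_integrable[OF iE]]
      measurable_snd_half_line[OF borel_measurable_integrable[OF iV]]
      measurable_fst_half_line[OF id] measurable_snd_half_line[OF id]
    by measurable
  have "(\<integral>t. exp (- (of_real t * cis \<theta>) / \<tau>) *
          borel_transform \<eta> \<sigma> (of_real t * cis \<theta>) * cis \<theta> \<partial>half_line)
      = (\<integral>t. (\<integral>r. ?f t r \<partial>half_line) \<partial>half_line)"
  proof (rule Bochner_Integration.integral_cong[OF refl])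
    fix t assume "t \<in> space half_line"
    have "(\<integral>r. ?f t r \<partial>half_line) = ?E t * (\<integral>r. ?V r * exp (of_real t * cis \<theta> / (\<sigma> * of_real r)) \<partial>half_line)"
      by (rule integral_mult_right_zero)
    then show "exp (- (of_real t * cis \<theta>) / \<tau>) * borel_transform \<eta> \<sigma> (of_real t * cis \<theta>) * cis \<theta>
        = (\<integral>r. ?f t r \<partial>half_line)"
      unfolding borel_transform_def borel_ray_def ray_integral_def by (simp only: mult_ac)
  qed
  moreover have "(\<integral>t. (\<integral>r. ?f t r \<partial>half_line) \<partial>half_line) = (\<integral>r. (\<integral>t. ?f t r \<partial>half_line) \<partial>half_line)"
  proof (rule half_line_Fubini[OF m integrable_norm[OF iE] integrable_norm[OF iV]])
    fix t r :: real assume tr: "t > 0" "r > 0"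
    have "Re (of_real t * cis \<theta> / (\<sigma> * of_real r)) \<le> 0"
      using Re_divide_ray_nonpos[of "of_real t * cis \<theta>" \<sigma> r] Re_ray_divide_neg[OF \<sigma>(3) tr(1)] tr by simp
    then have "norm (exp (of_real t * cis \<theta> / (\<sigma> * of_real r))) \<le> 1"
      by (simp only: norm_exp_eq_Re exp_le_one_iff)
    then have "norm (?V r) * norm (exp (of_real t * cis \<theta> / (\<sigma> * of_real r))) \<le> norm (?V r)"
      by (intro mult_left_le) auto
    then have "norm (?E t) * (norm (?V r) * norm (exp (of_real t * cis \<theta> / (\<sigma> * of_real r))))
        \<le> norm (?E t) * norm (?V r)" by (rule mult_left_mono) simp
    then show "norm (?f t r) \<le> norm (?E t) * norm (?V r)" by (simp only: norm_mult)
  qed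
  moreover have "(\<integral>r. (\<integral>t. ?f t r \<partial>half_line) \<partial>half_line)
      = (\<integral>r. of_real (Gamma \<eta>) * (W (\<sigma> * of_real r) * (cis (\<eta> * \<theta>) *
          (cis \<theta> * (1 / \<tau> - 1 / (\<sigma> * of_real r))) powr of_real (- \<eta>)) * \<sigma>) \<partial>half_line)"
  proof (rule Bochner_Integration.integral_cong[OF refl])
    fix r assume "r \<in> space half_line"
    then have r: "r > 0" by simp
    have "cis \<theta> * (1 / \<tau> - 1 / (\<sigma> * of_real r)) = cis \<theta> / \<tau> - cis \<theta> / (\<sigma> * of_real r)"
      by (simp add: right_diff_distrib)
    then have "Re (cis \<theta> * (1 / \<tau> - 1 / (\<sigma> * of_real r))) > 0"
      using Re_divide_ray_nonpos[of "cis \<theta>" \<sigma> r] \<sigma>(3) r \<tau> by simp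
    from laplace_ray[OF \<theta> \<eta> this]
    show "(\<integral>t. ?f t r \<partial>half_line) = of_real (Gamma \<eta>) * (W (\<sigma> * of_real r) * (cis (\<eta> * \<theta>) *
          (cis \<theta> * (1 / \<tau> - 1 / (\<sigma> * of_real r))) powr of_real (- \<eta>)) * \<sigma>)"
      unfolding eq1 integral_mult_left_zero by (simp only: mult_ac)
  qed
  moreover have "\<dots> = of_real (Gamma \<eta>) * ray_integral
        (\<lambda>w. W w * (cis (\<eta> * \<theta>) * (cis \<theta> * (1 / \<tau> - 1 / w)) powr of_real (- \<eta>))) \<sigma>"
    unfolding ray_integral_def by (rule integral_mult_right_zero)
  ultimately show ?thesis by (simp only:)
qed

end

end

section \<open>Branches of the power\<close>

lemma half_line_FTC:
  fixes F f :: "real \<Rightarrow> complex"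
  assumes F: "\<And>t. t > 0 \<Longrightarrow> (F has_vector_derivative f t) (at t)"
    and f: "continuous_on {0<..} f" "integrable half_line f"
    and lim: "(F \<longlongrightarrow> A) (at_right 0)" "(F \<longlongrightarrow> B) at_top"
  shows "(\<integral>t. f t \<partial>half_line) = B - A"
proof -
  have "(LBINT x=ereal 0..\<infinity>. f x) = B - A"
  proof (rule interval_integral_FTC_integrable)
    show "isCont f x" if "ereal 0 < ereal x" for x
      using f(1) that by (simp add: continuous_on_eq_continuous_at)
    show "set_integrable lborel (einterval (ereal 0) \<infinity>) f"
      using f(2) by (simp add: integrable_half_line)
    show "((F \<circ> real_of_ereal) \<longlongrightarrow> A) (at_right (ereal 0))"
      using lim(1) by (simp add: ereal_tendsto_simps)
    show "((F \<circ> real_of_ereal) \<longlongrightarrow> B) (at_left \<infinity>)"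
      using lim(2) by (simp add: ereal_tendsto_simps)
  qed (use F in auto)
  then show ?thesis by (simp only: interval_integral_to_infinity_eq integral_half_line)
qed

text \<open>
  The product of the three powers is \<open>exp (- \<eta> A)\<close> for a logarithm \<open>A\<close> of \<open>w - \<tau>\<close>. Which logarithm it is
  follows from the bounds on its imaginary part: they confine it to less than a full turn around the
  principal value of \<open>w - \<tau>\<close> (ray to the right of \<open>\<tau>\<close>) or of \<open>\<tau> - w\<close>, raised by \<open>\<pi>\<close> (ray to the left).
\<close>

lemma branch_identity:
  assumes \<tau>: "Im \<tau> > 0" and \<theta>: "0 < \<theta>" "\<theta> < pi" and v: "Re (cis \<theta> / \<tau>) > 0"
    and \<psi>: "0 < \<psi>" "\<psi> < pi" and r: "r > 0" and w: "w = of_real r * cis \<psi>" "Re (cis \<theta> / w) < 0"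
  obtains A where
    "\<tau> powr of_real (- \<eta>) * (w powr of_real (- \<eta>) *
      (cis (\<eta> * \<theta>) * (cis \<theta> * (1 / \<tau> - 1 / w)) powr of_real (- \<eta>))) = exp (of_real (- \<eta>) * A)"
    "exp A = w - \<tau>" "\<theta> - pi / 2 < Im (Ln \<tau>)" "Im (Ln \<tau>) < \<theta> + pi / 2"
    "Im (Ln \<tau>) + \<psi> - \<theta> - pi / 2 < Im A" "Im A < Im (Ln \<tau>) + \<psi> - \<theta> + pi / 2"
proof -
  define u where "u = cis \<theta> * (1 / \<tau> - 1 / w)"
  define A where "A = Ln \<tau> + Ln w + Ln u - \<i> * of_real \<theta>"
  have \<tau>0: "\<tau> \<noteq> 0" using \<tau> by auto
  have w0: "w \<noteq> 0" using w r by auto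
  have "u = cis \<theta> / \<tau> - cis \<theta> / w" by (simp add: u_def right_diff_distrib)
  then have u: "Re u > 0" using v w by simp
  then have u0: "u \<noteq> 0" by auto
  have "exp A = \<tau> * w * u / cis \<theta>"
    using \<tau>0 w0 u0 by (simp add: A_def exp_diff exp_add cis_conv_exp)
  also have "\<dots> = w - \<tau>" using \<tau>0 w0 by (simp add: u_def field_simps)
  finally have e: "exp A = w - \<tau>" .
  have "\<tau> powr of_real (- \<eta>) * (w powr of_real (- \<eta>) * (cis (\<eta> * \<theta>) * u powr of_real (- \<eta>)))
      = exp (of_real (- \<eta>) * A)"
    using \<tau>0 w0 u0 unfolding powr_def A_def
    by (simp add: cis_conv_exp exp_add[symmetric] exp_diff[symmetric] exp_minus[symmetric] algebra_simps)
  note 1 = this[unfolded u_def]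
  have im: "0 < Im (Ln \<tau>)" "Im (Ln \<tau>) < pi" using \<tau> Im_Ln_pos_lt_imp by auto
  have "cis \<theta> / \<tau> = exp (\<i> * of_real \<theta> - Ln \<tau>)"
    using \<tau>0 by (simp add: exp_diff cis_conv_exp)
  then have "Ln (cis \<theta> / \<tau>) = \<i> * of_real \<theta> - Ln \<tau>"
    using im \<theta> by (simp add: Ln_exp)
  with Re_Ln_pos_lt_imp[OF v] have 2: "\<theta> - pi / 2 < Im (Ln \<tau>)" "Im (Ln \<tau>) < \<theta> + pi / 2"
    by (auto simp: abs_if split: if_splits)
  have "Im A = Im (Ln \<tau>) + \<psi> + Im (Ln u) - \<theta>"
    using Ln_of_real_cis[OF r, of \<psi>] \<psi> by (simp add: A_def w)
  then have "Im (Ln \<tau>) + \<psi> - \<theta> - pi / 2 < Im A" "Im A < Im (Ln \<tau>) + \<psi> - \<theta> + pi / 2"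
    using Re_Ln_pos_lt_imp[OF u] by (auto simp: abs_if split: if_splits)
  with 1 e 2 show ?thesis by (intro that)
qed

lemma branch_right:
  assumes \<tau>: "Im \<tau> > 0" and \<epsilon>: "0 < \<epsilon>" "\<epsilon> < pi / 2" and v: "Re (cis (pi / 2 + \<epsilon>) / \<tau>) > 0"
    and r: "r > 0" and w: "w = of_real r * cis (\<epsilon> / 2)" "Re (cis (pi / 2 + \<epsilon>) / w) < 0"
  shows "\<tau> powr of_real (- \<eta>) * (w powr of_real (- \<eta>) *
      (cis (\<eta> * (pi / 2 + \<epsilon>)) * (cis (pi / 2 + \<epsilon>) * (1 / \<tau> - 1 / w)) powr of_real (- \<eta>)))
    = (w - \<tau>) powr of_real (- \<eta>)"
proof -
  have bd: "0 < pi / 2 + \<epsilon>" "pi / 2 + \<epsilon> < pi" "0 < \<epsilon> / 2" "\<epsilon> / 2 < pi" using \<epsilon> by auto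
  obtain A where A: "\<tau> powr of_real (- \<eta>) * (w powr of_real (- \<eta>) *
      (cis (\<eta> * (pi / 2 + \<epsilon>)) * (cis (pi / 2 + \<epsilon>) * (1 / \<tau> - 1 / w)) powr of_real (- \<eta>)))
      = exp (of_real (- \<eta>) * A)"
    "exp A = w - \<tau>" "pi / 2 + \<epsilon> - pi / 2 < Im (Ln \<tau>)" "Im (Ln \<tau>) < pi / 2 + \<epsilon> + pi / 2"
    "Im (Ln \<tau>) + \<epsilon> / 2 - (pi / 2 + \<epsilon>) - pi / 2 < Im A"
    "Im A < Im (Ln \<tau>) + \<epsilon> / 2 - (pi / 2 + \<epsilon>) + pi / 2"
    using branch_identity[OF \<tau> bd(1,2) v bd(3,4) r w] .
  have im: "0 < Im (Ln \<tau>)" "Im (Ln \<tau>) < pi" using \<tau> Im_Ln_pos_lt_imp by auto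
  have 0: "w - \<tau> \<noteq> 0" using A(2) by (metis exp_not_eq_zero)
  have "A = Ln (w - \<tau>)"
  proof (rule exp_complex_eqI)
    show "exp A = exp (Ln (w - \<tau>))" using A(2) 0 by simp
    show "\<bar>Im A - Im (Ln (w - \<tau>))\<bar> < 2 * pi"
      using A(3-6) mpi_less_Im_Ln[OF 0] Im_Ln_le_pi[OF 0] im \<epsilon> by linarith
  qed
  then show ?thesis using A(1) 0 by (simp add: powr_def)
qed

lemma branch_left:
  assumes \<tau>: "Im \<tau> > 0" and \<epsilon>: "0 < \<epsilon>" "\<epsilon> < pi / 2" and v: "Re (cis (pi / 2 - \<epsilon>) / \<tau>) > 0"
    and r: "r > 0" and w: "w = of_real r * cis (pi - \<epsilon> / 2)" "Re (cis (pi / 2 - \<epsilon>) / w) < 0"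
  shows "\<tau> powr of_real (- \<eta>) * (w powr of_real (- \<eta>) *
      (cis (\<eta> * (pi / 2 - \<epsilon>)) * (cis (pi / 2 - \<epsilon>) * (1 / \<tau> - 1 / w)) powr of_real (- \<eta>)))
    = cis (- pi * \<eta>) * (- (w - \<tau>)) powr of_real (- \<eta>)"
proof -
  have bd: "0 < pi / 2 - \<epsilon>" "pi / 2 - \<epsilon> < pi" "0 < pi - \<epsilon> / 2" "pi - \<epsilon> / 2 < pi" using \<epsilon> by auto
  obtain A where A: "\<tau> powr of_real (- \<eta>) * (w powr of_real (- \<eta>) *
      (cis (\<eta> * (pi / 2 - \<epsilon>)) * (cis (pi / 2 - \<epsilon>) * (1 / \<tau> - 1 / w)) powr of_real (- \<eta>)))
      = exp (of_real (- \<eta>) * A)"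
    "exp A = w - \<tau>" "pi / 2 - \<epsilon> - pi / 2 < Im (Ln \<tau>)" "Im (Ln \<tau>) < pi / 2 - \<epsilon> + pi / 2"
    "Im (Ln \<tau>) + (pi - \<epsilon> / 2) - (pi / 2 - \<epsilon>) - pi / 2 < Im A"
    "Im A < Im (Ln \<tau>) + (pi - \<epsilon> / 2) - (pi / 2 - \<epsilon>) + pi / 2"
    using branch_identity[OF \<tau> bd(1,2) v bd(3,4) r w] .
  have im: "0 < Im (Ln \<tau>)" "Im (Ln \<tau>) < pi" using \<tau> Im_Ln_pos_lt_imp by auto
  have "w - \<tau> \<noteq> 0" using A(2) by (metis exp_not_eq_zero)
  then have 0: "- (w - \<tau>) \<noteq> 0" by simp
  have "A = Ln (- (w - \<tau>)) + \<i> * of_real pi"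
  proof (rule exp_complex_eqI)
    show "exp A = exp (Ln (- (w - \<tau>)) + \<i> * of_real pi)"
      using A(2) 0 by (simp add: exp_add exp_pi_i)
    show "\<bar>Im A - Im (Ln (- (w - \<tau>)) + \<i> * of_real pi)\<bar> < 2 * pi"
      using A(3-6) mpi_less_Im_Ln[OF 0] Im_Ln_le_pi[OF 0] im \<epsilon> by simp
  qed
  then have "exp (of_real (- \<eta>) * A) = exp (\<i> * of_real (- pi * \<eta>)) * exp (of_real (- \<eta>) * Ln (- (w - \<tau>)))"
    by (simp add: exp_add[symmetric] algebra_simps)
  then show ?thesis using A(1) 0 unfolding powr_def cis_conv_exp by simp
qed

section \<open>An exponential integrated past a branch point\<close>

definition expo_ray :: "real \<Rightarrow> complex \<Rightarrow> complex \<Rightarrow> real \<Rightarrow> complex \<Rightarrow> complex" where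
  "expo_ray \<eta> s \<sigma> m z =
     (\<integral>t. exp (\<i> * of_real m * (\<sigma> * of_real t)) * (s * (\<sigma> * of_real t - z)) powr of_real (- \<eta>) * \<sigma> \<partial>half_line)"

lemma continuous_on_powr_off_slit:
  assumes "continuous_on A f" "\<And>x. x \<in> A \<Longrightarrow> f x \<notin> \<real>\<^sub>\<le>\<^sub>0"
  shows "continuous_on A (\<lambda>x. f x powr (a :: complex))"
proof (rule continuous_on_compose2[where t = "- \<real>\<^sub>\<le>\<^sub>0" and g = "\<lambda>v. v powr a"])
  show "continuous_on (- \<real>\<^sub>\<le>\<^sub>0) (\<lambda>v. v powr a)"
    by (intro holomorphic_on_imp_continuous_on holomorphic_intros) auto
qed (use assms in auto)

lemma norm_exp_i_ray: "norm (exp (\<i> * of_real m * (\<sigma> * of_real t))) = exp (- (m * Im \<sigma> * t))"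
  by (simp add: norm_exp_eq_Re)

text \<open>
  The ray starts at \<open>0\<close> and the branch point \<open>z\<close> varies in \<open>\<Omega>\<close>. The power \<open>(s * (w - z)) powr - \<eta>\<close> has its
  slit running from \<open>z\<close> horizontally to the left for \<open>s = 1\<close> and to the right for \<open>s = -1\<close>, away from
  the ray.
\<close>

locale slit_ray =
  fixes \<sigma> s :: complex and \<Omega> :: "complex set"
  assumes \<sigma>: "Im \<sigma> > 0" "norm \<sigma> = 1" and s: "s = 1 \<or> s = -1"
    and open_\<Omega>: "open \<Omega>"
    and off_slit: "\<And>z t. z \<in> \<Omega> \<Longrightarrow> t \<ge> 0 \<Longrightarrow> s * (\<sigma> * of_real t - z) \<notin> \<real>\<^sub>\<le>\<^sub>0"
    and off_line: "\<And>z. z \<in> \<Omega> \<Longrightarrow> Im (z * cnj \<sigma>) \<noteq> 0"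
begin

lemma norm_s_mult: "norm (s * w) = norm w"
  using s by (auto simp: norm_mult)

lemma norm_ray_minus_ge: "\<bar>Im (z * cnj \<sigma>)\<bar> \<le> norm (\<sigma> * of_real t - z)"
proof -
  have "\<sigma> * cnj \<sigma> = 1" using \<sigma>(2) by (simp add: complex_norm_square[symmetric])
  then have "(\<sigma> * of_real t - z) * cnj \<sigma> = of_real t - z * cnj \<sigma>"
    by (metis (no_types, lifting) left_diff_distrib mult.assoc mult.commute mult_1)
  then have "Im ((\<sigma> * of_real t - z) * cnj \<sigma>) = - Im (z * cnj \<sigma>)" by simp
  moreover have "\<bar>Im ((\<sigma> * of_real t - z) * cnj \<sigma>)\<bar> \<le> norm ((\<sigma> * of_real t - z) * cnj \<sigma>)"
    by (rule abs_Im_le_cmod)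
  ultimately show ?thesis using \<sigma>(2) by (simp add: norm_mult)
qed

lemma continuous_ray_powr:
  assumes "z \<in> \<Omega>"
  shows "continuous_on {0<..} (\<lambda>t. (s * (\<sigma> * of_real t - z)) powr of_real a)"
  by (intro continuous_on_powr_off_slit continuous_intros off_slit[OF assms]) simp

lemma continuous_expo_ray:
  assumes "z \<in> \<Omega>"
  shows "continuous_on {0<..}
    (\<lambda>t. exp (\<i> * of_real m * (\<sigma> * of_real t)) * (s * (\<sigma> * of_real t - z)) powr of_real a * \<sigma>)"
  by (intro continuous_intros continuous_ray_powr assms)

lemma measurable_expo_ray:
  assumes "z \<in> \<Omega>"
  shows "(\<lambda>t. exp (\<i> * of_real m * (\<sigma> * of_real t)) * (s * (\<sigma> * of_real t - z)) powr of_real a * \<sigma>)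
      \<in> borel_measurable half_line"
  by (intro measurable_half_line continuous_expo_ray assms)

lemma norm_ray_powr_le:
  assumes "d > 0" "d \<le> \<bar>Im (z * cnj \<sigma>)\<bar>" "\<eta> \<ge> 0"
  shows "norm ((s * (\<sigma> * of_real t - z)) powr of_real (- \<eta>)) \<le> d powr (- \<eta>)"
proof -
  have "d \<le> norm (s * (\<sigma> * of_real t - z))"
    using norm_ray_minus_ge[of z t] assms by (simp add: norm_s_mult)
  then show ?thesis
    unfolding norm_powr_of_real using assms by (intro powr_mono2') auto
qed

lemma uniformly_off_line:
  assumes "z \<in> \<Omega>"
  obtains r d where "r > 0" "d > 0" "ball z r \<subseteq> \<Omega>" "\<forall>w\<in>ball z r. d \<le> \<bar>Im (w * cnj \<sigma>)\<bar>"
proof -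
  define d where "d = \<bar>Im (z * cnj \<sigma>)\<bar> / 2"
  have d: "d > 0" using off_line[OF assms] by (simp add: d_def)
  obtain r where r: "r > 0" "ball z r \<subseteq> \<Omega>" using open_\<Omega> assms open_contains_ball by blast
  have "d \<le> \<bar>Im (w * cnj \<sigma>)\<bar>" if "w \<in> ball z (min r d)" for w
  proof -
    have "\<bar>Im ((z - w) * cnj \<sigma>)\<bar> \<le> norm ((z - w) * cnj \<sigma>)" by (rule abs_Im_le_cmod)
    also have "\<dots> < d" using that \<sigma>(2) by (simp add: norm_mult dist_norm)
    finally have "\<bar>Im (z * cnj \<sigma>) - Im (w * cnj \<sigma>)\<bar> < d" by (simp add: left_diff_distrib)
    then show ?thesis unfolding d_def by linarith
  qed
  moreover have "ball z (min r d) \<subseteq> \<Omega>" using r by auto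
  ultimately show ?thesis using that[of "min r d" d] r d by auto
qed

lemma integrable_expo_ray:
  assumes z: "z \<in> \<Omega>" and m: "m > 0" and \<eta>: "\<eta> \<ge> 0"
  shows "integrable half_line
    (\<lambda>t. exp (\<i> * of_real m * (\<sigma> * of_real t)) * (s * (\<sigma> * of_real t - z)) powr of_real (- \<eta>) * \<sigma>)"
proof -
  let ?d = "\<bar>Im (z * cnj \<sigma>)\<bar>"
  have d: "?d > 0" using off_line[OF z] by simp
  have h: "integrable half_line (\<lambda>t. exp (- (m * Im \<sigma> * t)) * ?d powr (- \<eta>))"
    using m \<sigma> by (intro integrable_mult_left integrable_exp_half_line) auto
  show ?thesis
  proof (rule Bochner_Integration.integrable_bound[OF h measurable_expo_ray[OF z]], intro AE_I2)
    fix t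
    show "norm (exp (\<i> * of_real m * (\<sigma> * of_real t)) * (s * (\<sigma> * of_real t - z)) powr of_real (- \<eta>) * \<sigma>)
        \<le> norm (exp (- (m * Im \<sigma> * t)) * ?d powr (- \<eta>))"
      using norm_ray_powr_le[OF d order_refl \<eta>, of t] \<sigma>(2)
      by (simp only: norm_mult norm_exp_i_ray mult_1_right) (simp add: mult_left_mono)
  qed
qed

lemma has_field_derivative_expo_ray:
  assumes z: "z \<in> \<Omega>" and m: "m > 0" and \<eta>: "\<eta> \<ge> 0"
  shows "(expo_ray \<eta> s \<sigma> m has_field_derivative (of_real \<eta> * s * expo_ray (\<eta> + 1) s \<sigma> m z)) (at z)"
proof -
  obtain r d where r: "r > 0" "d > 0" "ball z r \<subseteq> \<Omega>" "\<forall>w\<in>ball z r. d \<le> \<bar>Im (w * cnj \<sigma>)\<bar>"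
    using uniformly_off_line[OF z] by blast
  let ?f = "\<lambda>z t. exp (\<i> * of_real m * (\<sigma> * of_real t)) * (s * (\<sigma> * of_real t - z)) powr of_real (- \<eta>) * \<sigma>"
  let ?g = "\<lambda>z t. exp (\<i> * of_real m * (\<sigma> * of_real t)) * (s * (\<sigma> * of_real t - z)) powr of_real (- (\<eta> + 1)) * \<sigma>"
  have der: "((\<lambda>z. ?f z t) has_field_derivative (of_real \<eta> * s * ?g w t)) (at w)"
    if "w \<in> \<Omega>" "t > 0" for w t
  proof -
    have "((\<lambda>z. s * (\<sigma> * of_real t - z)) has_field_derivative - s) (at w)"
      by (auto intro!: derivative_eq_intros)
    from DERIV_chain2[OF has_field_derivative_powr this, of "of_real (- \<eta>)"] off_slit[of w t] that
    have "((\<lambda>z. (s * (\<sigma> * of_real t - z)) powr of_real (- \<eta>)) has_field_derivative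
        of_real (- \<eta>) * (s * (\<sigma> * of_real t - w)) powr (of_real (- \<eta>) - 1) * - s) (at w)"
      by simp
    from DERIV_cmult_right[OF DERIV_cmult[OF this]]
    have "((\<lambda>z. ?f z t) has_field_derivative
        exp (\<i> * of_real m * (\<sigma> * of_real t)) *
        (of_real (- \<eta>) * (s * (\<sigma> * of_real t - w)) powr (of_real (- \<eta>) - 1) * - s) * \<sigma>) (at w)" .
    moreover have e: "complex_of_real (- \<eta>) - 1 = of_real (- (\<eta> + 1))" by simp
    have "exp (\<i> * of_real m * (\<sigma> * of_real t)) *
        (of_real (- \<eta>) * (s * (\<sigma> * of_real t - w)) powr (of_real (- \<eta>) - 1) * - s) * \<sigma>
        = of_real \<eta> * s * ?g w t"
      unfolding e by simp
    ultimately show ?thesis by (simp only:)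
  qed
  have h: "integrable half_line (\<lambda>t. exp (- (m * Im \<sigma> * t)) * d powr (- \<eta>))"
    using m \<sigma> by (intro integrable_mult_left integrable_exp_half_line) auto
  have "((\<lambda>w. \<integral>t. ?f w t \<partial>half_line) has_field_derivative (\<integral>t. deriv (\<lambda>w. ?f w t) z \<partial>half_line)) (at z)"
  proof (rule has_field_derivative_integral[where f = ?f and r = r and M = half_line, OF r(1) _ _ h])
    fix w assume "w \<in> ball z r"
    then have "w \<in> \<Omega>" using r by blast
    then show "?f w \<in> borel_measurable half_line" by (rule measurable_expo_ray)
  next
    fix t :: real assume "t \<in> space half_line"
    then have t: "t > 0" by simp
    show "(\<lambda>w. ?f w t) holomorphic_on ball z r"
    proof (rule holomorphic_onI)
      fix w assume "w \<in> ball z r"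
      then have "w \<in> \<Omega>" using r by blast
      from has_field_derivative_at_within[OF der[OF this t]]
      show "(\<lambda>w. ?f w t) field_differentiable (at w within ball z r)"
        unfolding field_differentiable_def by (rule exI)
    qed
  next
    fix w and t :: real assume w: "w \<in> ball z r"
    then have d: "d \<le> \<bar>Im (w * cnj \<sigma>)\<bar>" using r by blast
    show "norm (?f w t) \<le> exp (- (m * Im \<sigma> * t)) * d powr (- \<eta>)"
      using norm_ray_powr_le[OF r(2) d \<eta>, of t] \<sigma>(2)
      by (simp only: norm_mult norm_exp_i_ray mult_1_right) (simp add: mult_left_mono)
  qed
  moreover have "(\<integral>t. deriv (\<lambda>w. ?f w t) z \<partial>half_line) = of_real \<eta> * s * expo_ray (\<eta> + 1) s \<sigma> m z"
  proof -
    have "deriv (\<lambda>w. ?f w t) z = of_real \<eta> * s * ?g z t" if "t \<in> space half_line" for t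
      by (rule DERIV_imp_deriv, rule der[OF z]) (use that in simp)
    then have "(\<integral>t. deriv (\<lambda>w. ?f w t) z \<partial>half_line) = (\<integral>t. of_real \<eta> * s * ?g z t \<partial>half_line)"
      by (intro Bochner_Integration.integral_cong refl)
    then show ?thesis unfolding expo_ray_def integral_mult_right_zero .
  qed
  ultimately show ?thesis unfolding expo_ray_def[abs_def] by (rule DERIV_cong)
qed

text \<open>
  For the derivative with respect to \<open>z\<close> this is a linear differential equation whose inhomogeneous part is
  the integrand at the starting point of the ray; for \<open>\<eta> = 1/2\<close> it also reduces the non-integrable
  exponent \<open>3/2\<close> to \<open>1/2\<close>.
\<close>

lemma expo_ray_by_parts:
  assumes z: "z \<in> \<Omega>" and m: "m > 0" and \<eta>: "\<eta> \<ge> 0"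
  shows "of_real \<eta> * s * expo_ray (\<eta> + 1) s \<sigma> m z
    = \<i> * of_real m * expo_ray \<eta> s \<sigma> m z + (- (s * z)) powr of_real (- \<eta>)"
proof -
  let ?e = "\<lambda>t. exp (\<i> * of_real m * (\<sigma> * of_real t))"
  let ?F = "\<lambda>t. ?e t * (s * (\<sigma> * of_real t - z)) powr of_real (- \<eta>)"
  let ?f = "\<lambda>\<eta> t. ?e t * (s * (\<sigma> * of_real t - z)) powr of_real (- \<eta>) * \<sigma>"
  let ?G = "\<lambda>t. \<i> * of_real m * ?f \<eta> t - of_real \<eta> * s * ?f (\<eta> + 1) t"
  have i1: "integrable half_line (\<lambda>t. \<i> * of_real m * ?f \<eta> t)"
    by (intro integrable_mult_right integrable_expo_ray assms)
  have i2: "integrable half_line (\<lambda>t. of_real \<eta> * s * ?f (\<eta> + 1) t)"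
    using \<eta> by (intro integrable_mult_right integrable_expo_ray assms) auto
  have "(\<integral>t. ?G t \<partial>half_line) = 0 - (- (s * z)) powr of_real (- \<eta>)"
  proof (rule half_line_FTC)
    fix t :: real assume t: "t > 0"
    have "((\<lambda>w. s * (\<sigma> * w - z)) has_field_derivative s * \<sigma>) (at (of_real t))"
      by (auto intro!: derivative_eq_intros)
    from DERIV_chain2[OF has_field_derivative_powr this, of "of_real (- \<eta>)"] off_slit[OF z, of t] t
    have "((\<lambda>w. (s * (\<sigma> * w - z)) powr of_real (- \<eta>)) has_field_derivative
        of_real (- \<eta>) * (s * (\<sigma> * of_real t - z)) powr (of_real (- \<eta>) - 1) * (s * \<sigma>)) (at (of_real t))"
      by simp
    moreover have "((\<lambda>w. exp (\<i> * of_real m * (\<sigma> * w))) has_field_derivative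
        ?e t * (\<i> * of_real m * \<sigma>)) (at (of_real t))"
      by (auto intro!: derivative_eq_intros)
    ultimately have "((\<lambda>w. exp (\<i> * of_real m * (\<sigma> * w)) * (s * (\<sigma> * w - z)) powr of_real (- \<eta>)) has_field_derivative
        ?e t * (\<i> * of_real m * \<sigma>) * (s * (\<sigma> * of_real t - z)) powr of_real (- \<eta>) +
        of_real (- \<eta>) * (s * (\<sigma> * of_real t - z)) powr (of_real (- \<eta>) - 1) * (s * \<sigma>) * ?e t) (at (of_real t))"
      by (intro DERIV_mult)
    moreover have "complex_of_real (- \<eta>) - 1 = of_real (- (\<eta> + 1))" by simp
    moreover have "?e t * (\<i> * of_real m * \<sigma>) * (s * (\<sigma> * of_real t - z)) powr of_real (- \<eta>) +
        of_real (- \<eta>) * (s * (\<sigma> * of_real t - z)) powr of_real (- (\<eta> + 1)) * (s * \<sigma>) * ?e t = ?G t"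
      by (simp add: mult_ac)
    ultimately have "((\<lambda>w. exp (\<i> * of_real m * (\<sigma> * w)) * (s * (\<sigma> * w - z)) powr of_real (- \<eta>))
        has_field_derivative ?G t) (at (of_real t))" by (simp only:)
    then show "(?F has_vector_derivative ?G t) (at t)"
      by (rule has_vector_derivative_real_field)
  next
    show "continuous_on {0<..} ?G"
      by (rule continuous_on_diff[OF continuous_on_mult[OF continuous_on_const continuous_expo_ray[OF z]]
            continuous_on_mult[OF continuous_on_const continuous_expo_ray[OF z]]])
    show "integrable half_line ?G"
      by (rule Bochner_Integration.integrable_diff[OF i1 i2])
    have "isCont ?F 0"
      using off_slit[OF z, of 0] by (intro continuous_intros) auto
    then have "(?F \<longlongrightarrow> ?F 0) (at_right 0)"
      unfolding isCont_def by (rule filterlim_mono) (auto simp: at_within_le_at)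
    then show "(?F \<longlongrightarrow> (- (s * z)) powr of_real (- \<eta>)) (at_right 0)"
      by simp
    let ?d = "\<bar>Im (z * cnj \<sigma>)\<bar>"
    have d: "?d > 0" using off_line[OF z] by simp
    show "(?F \<longlongrightarrow> 0) at_top"
    proof (rule Lim_null_comparison)
      show "\<forall>\<^sub>F t in at_top. norm (?F t) \<le> exp (- (m * Im \<sigma> * t)) * ?d powr (- \<eta>)"
        using norm_ray_powr_le[OF d order_refl \<eta>]
        by (intro always_eventually allI) (simp only: norm_mult norm_exp_i_ray mult_left_mono exp_ge_zero)
      have "filterlim (\<lambda>t. m * Im \<sigma> * t) at_top at_top"
        using m \<sigma> by (intro filterlim_tendsto_pos_mult_at_top[OF tendsto_const] filterlim_ident) auto
      then have "((\<lambda>t. exp (- (m * Im \<sigma> * t))) \<longlongrightarrow> 0) at_top"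
        by (intro filterlim_compose[OF exp_at_bot] filterlim_compose[OF filterlim_uminus_at_bot_at_top])
      then show "((\<lambda>t. exp (- (m * Im \<sigma> * t)) * ?d powr (- \<eta>)) \<longlongrightarrow> 0) at_top"
        by (rule tendsto_mult_left_zero)
    qed
  qed
  moreover have "(\<integral>t. ?G t \<partial>half_line) = \<i> * of_real m * expo_ray \<eta> s \<sigma> m z - of_real \<eta> * s * expo_ray (\<eta> + 1) s \<sigma> m z"
    unfolding Bochner_Integration.integral_diff[OF i1 i2] integral_mult_right_zero expo_ray_def ..
  ultimately show ?thesis by (simp add: algebra_simps)
qed

text \<open>
  The branch point moves into the starting point of the ray. It stays in a fixed direction, so its
  distance from the point with parameter \<open>t\<close> is at least a multiple of \<open>t\<close>, and \<open>t powr - \<eta>\<close> is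
  integrable at \<open>0\<close> for \<open>\<eta> < 1\<close>.
\<close>

lemma expo_ray_tendsto:
  assumes z: "z \<in> \<Omega>" and cone: "\<And>y. y > 0 \<Longrightarrow> of_real y * z \<in> \<Omega>"
    and m: "m > 0" and \<eta>: "0 \<le> \<eta>" "\<eta> < 1"
  shows "(\<lambda>n. expo_ray \<eta> s \<sigma> m (of_real (1 / (real n + 1)) * z)) \<longlonglongrightarrow>
    (\<integral>t. exp (\<i> * of_real m * (\<sigma> * of_real t)) * (s * (\<sigma> * of_real t)) powr of_real (- \<eta>) * \<sigma> \<partial>half_line)"
  unfolding expo_ray_def
proof (rule integral_dominated_convergence)
  define c where "c = \<bar>Im (z * cnj \<sigma>)\<bar> / norm z"
  have z0: "z \<noteq> 0" using off_line[OF z] by auto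
  then have c: "c > 0" using off_line[OF z] by (simp add: c_def)
  have ge: "c * t \<le> norm (s * (\<sigma> * of_real t - of_real y * z))" if "t > 0" for t y :: real
  proof -
    have "Im ((\<sigma> * of_real t - of_real y * z) * cnj z) = - t * Im (z * cnj \<sigma>)"
      by (simp add: algebra_simps)
    then have "t * \<bar>Im (z * cnj \<sigma>)\<bar> \<le> norm ((\<sigma> * of_real t - of_real y * z) * cnj z)"
      using abs_Im_le_cmod[of "(\<sigma> * of_real t - of_real y * z) * cnj z"] that
      by (simp add: abs_mult)
    then have "t * \<bar>Im (z * cnj \<sigma>)\<bar> \<le> norm (\<sigma> * of_real t - of_real y * z) * norm z"
      unfolding norm_mult[of "\<sigma> * of_real t - of_real y * z"] complex_mod_cnj .
    then have "t * \<bar>Im (z * cnj \<sigma>)\<bar> / norm z \<le> norm (\<sigma> * of_real t - of_real y * z)"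
      using z0 by (simp add: divide_le_eq)
    then show ?thesis unfolding c_def norm_s_mult by (simp add: mult.commute)
  qed
  let ?h = "\<lambda>t. c powr (- \<eta>) * (t powr ((1 - \<eta>) - 1) * exp (- (m * Im \<sigma> * t)))"
  show "integrable half_line ?h"
    using m \<sigma> \<eta> by (intro integrable_mult_right integrable_powr_exp) auto
  show "(\<lambda>t. exp (\<i> * of_real m * (\<sigma> * of_real t)) *
      (s * (\<sigma> * of_real t - of_real (1 / (real n + 1)) * z)) powr of_real (- \<eta>) * \<sigma>)
      \<in> borel_measurable half_line" for n
    by (intro measurable_expo_ray cone) auto
  have off: "s * (\<sigma> * of_real t) \<notin> \<real>\<^sub>\<le>\<^sub>0" if "t > 0" for t
    using s \<sigma> that by (auto simp: complex_nonpos_Reals_iff)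
  show "(\<lambda>t. exp (\<i> * of_real m * (\<sigma> * of_real t)) *
      (s * (\<sigma> * of_real t)) powr of_real (- \<eta>) * \<sigma>) \<in> borel_measurable half_line"
    by (intro measurable_half_line continuous_intros continuous_on_powr_off_slit) (use off in auto)
  show "AE t in half_line. (\<lambda>n. exp (\<i> * of_real m * (\<sigma> * of_real t)) *
      (s * (\<sigma> * of_real t - of_real (1 / (real n + 1)) * z)) powr of_real (- \<eta>) * \<sigma>)
      \<longlonglongrightarrow> exp (\<i> * of_real m * (\<sigma> * of_real t)) * (s * (\<sigma> * of_real t)) powr of_real (- \<eta>) * \<sigma>"
  proof (intro AE_I2)
    fix t assume "t \<in> space half_line"
    then have t: "t > 0" by simp
    have "(\<lambda>n. 1 / (real n + 1)) \<longlonglongrightarrow> 0"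
      using LIMSEQ_inverse_real_of_nat by (simp add: inverse_eq_divide add.commute)
    then have "(\<lambda>n. s * (\<sigma> * of_real t - of_real (1 / (real n + 1)) * z)) \<longlonglongrightarrow> s * (\<sigma> * of_real t - of_real 0 * z)"
      by (intro tendsto_intros)
    then have "(\<lambda>n. s * (\<sigma> * of_real t - of_real (1 / (real n + 1)) * z)) \<longlonglongrightarrow> s * (\<sigma> * of_real t)"
      by simp
    from tendsto_powr_complex[OF off[OF t] this tendsto_const]
    show "(\<lambda>n. exp (\<i> * of_real m * (\<sigma> * of_real t)) *
        (s * (\<sigma> * of_real t - of_real (1 / (real n + 1)) * z)) powr of_real (- \<eta>) * \<sigma>)
        \<longlonglongrightarrow> exp (\<i> * of_real m * (\<sigma> * of_real t)) * (s * (\<sigma> * of_real t)) powr of_real (- \<eta>) * \<sigma>"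
      by (intro tendsto_mult_left tendsto_mult_right)
  qed
  show "AE t in half_line. norm (exp (\<i> * of_real m * (\<sigma> * of_real t)) *
      (s * (\<sigma> * of_real t - of_real (1 / (real n + 1)) * z)) powr of_real (- \<eta>) * \<sigma>) \<le> ?h t" for n
  proof (intro AE_I2)
    fix t assume "t \<in> space half_line"
    then have t: "t > 0" by simp
    let ?v = "s * (\<sigma> * of_real t - of_real (1 / (real n + 1)) * z)"
    have "norm ?v powr (- \<eta>) \<le> (c * t) powr (- \<eta>)"
      by (rule powr_mono2'[OF _ _ ge[OF t]]) (use c t \<eta> in auto)
    also have "(c * t) powr (- \<eta>) = c powr (- \<eta>) * t powr (- \<eta>)"
      using c t by (simp add: powr_mult)
    finally have "exp (- (m * Im \<sigma> * t)) * norm ?v powr (- \<eta>)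
        \<le> exp (- (m * Im \<sigma> * t)) * (c powr (- \<eta>) * t powr (- \<eta>))"
      by (intro mult_left_mono) auto
    then show "norm (exp (\<i> * of_real m * (\<sigma> * of_real t)) * ?v powr of_real (- \<eta>) * \<sigma>) \<le> ?h t"
      unfolding norm_mult[of _ \<sigma>] norm_mult[of "exp _"] norm_exp_i_ray norm_powr_of_real \<sigma>(2)
      by (simp only: mult_1_right mult_ac) simp
  qed
qed

end

section \<open>Two rays on either side of the branch point\<close>

text \<open>
  The open sector between the rays of directions \<open>\<phi>\<close> and \<open>\<pi> - \<phi>\<close>.
\<close>

definition cone :: "real \<Rightarrow> complex set" where
  "cone \<phi> = {z. \<bar>Re z\<bar> * sin \<phi> < Im z * cos \<phi>}"

lemma cone_scale: "y > 0 \<Longrightarrow> z \<in> cone \<phi> \<Longrightarrow> of_real y * z \<in> cone \<phi>"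
  by (simp add: cone_def abs_mult)

lemma open_cone: "open (cone \<phi>)"
  unfolding cone_def by (intro open_Collect_less continuous_intros)

lemma convex_cone:
  assumes "0 \<le> \<phi>" "\<phi> \<le> pi"
  shows "convex (cone \<phi>)"
proof -
  have s: "sin \<phi> \<ge> 0" using assms sin_ge_zero by blast
  show ?thesis
  proof (rule convexI)
    fix x y :: complex and u v :: real
    assume x: "x \<in> cone \<phi>" and y: "y \<in> cone \<phi>" and uv: "u \<ge> 0" "v \<ge> 0" "u + v = 1"
    have "\<bar>Re (u *\<^sub>R x + v *\<^sub>R y)\<bar> \<le> u * \<bar>Re x\<bar> + v * \<bar>Re y\<bar>"
      using abs_triangle_ineq[of "u * Re x" "v * Re y"] uv by (simp add: abs_mult)
    then have "\<bar>Re (u *\<^sub>R x + v *\<^sub>R y)\<bar> * sin \<phi> \<le> (u * \<bar>Re x\<bar> + v * \<bar>Re y\<bar>) * sin \<phi>"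
      using s by (rule mult_right_mono)
    also have "\<dots> = u * (\<bar>Re x\<bar> * sin \<phi>) + v * (\<bar>Re y\<bar> * sin \<phi>)" by (simp add: algebra_simps)
    also have "\<dots> < u * (Im x * cos \<phi>) + v * (Im y * cos \<phi>)"
    proof (cases "u = 0")
      case True
      then show ?thesis using y uv by (simp add: cone_def)
    next
      case False
      then show ?thesis using x y uv
        by (intro add_less_le_mono mult_strict_left_mono mult_left_mono) (auto simp: cone_def)
    qed
    also have "\<dots> = Im (u *\<^sub>R x + v *\<^sub>R y) * cos \<phi>" by (simp add: algebra_simps)
    finally show "u *\<^sub>R x + v *\<^sub>R y \<in> cone \<phi>" by (simp add: cone_def)
  qed
qed

context
  fixes \<phi> :: real
  assumes \<phi>: "0 < \<phi>" "\<phi> < pi / 2"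
begin

lemma sin_cos_pos: "sin \<phi> > 0" "cos \<phi> > 0"
  using \<phi> by (auto intro: sin_gt_zero cos_gt_zero)

lemma cone_Im_pos: "z \<in> cone \<phi> \<Longrightarrow> Im z > 0"
proof -
  assume "z \<in> cone \<phi>"
  then have "\<bar>Re z\<bar> * sin \<phi> < Im z * cos \<phi>" by (simp add: cone_def)
  moreover have "\<bar>Re z\<bar> * sin \<phi> \<ge> 0" using sin_cos_pos by simp
  ultimately have "0 < Im z * cos \<phi>" by linarith
  then show "Im z > 0" using sin_cos_pos by (simp add: zero_less_mult_iff)
qed

lemma cone_not_ge:
  assumes "z \<in> cone \<phi>" "Im z = t * sin \<phi>" "t * cos \<phi> \<le> \<bar>Re z\<bar>"
  shows False
proof -
  have "t * cos \<phi> * sin \<phi> \<le> \<bar>Re z\<bar> * sin \<phi>"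
    using assms sin_cos_pos by (intro mult_right_mono) auto
  also have "\<dots> < t * sin \<phi> * cos \<phi>" using assms by (simp add: cone_def)
  finally show False by simp
qed

lemma slit_ray_right: "slit_ray (cis \<phi>) 1 (cone \<phi>)"
proof
  fix z assume z: "z \<in> cone \<phi>"
  have "Re z * sin \<phi> \<le> \<bar>Re z\<bar> * sin \<phi>" using sin_cos_pos by (intro mult_right_mono) auto
  then show "Im (z * cnj (cis \<phi>)) \<noteq> 0" using z by (simp add: cone_def)
  fix t :: real assume "t \<ge> 0"
  show "1 * (cis \<phi> * of_real t - z) \<notin> \<real>\<^sub>\<le>\<^sub>0"
  proof
    assume "1 * (cis \<phi> * of_real t - z) \<in> \<real>\<^sub>\<le>\<^sub>0"
    then have "Im z = t * sin \<phi>" "t * cos \<phi> \<le> \<bar>Re z\<bar>"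
      by (auto simp: complex_nonpos_Reals_iff mult_ac)
    then show False using cone_not_ge[OF z] by blast
  qed
qed (use sin_cos_pos open_cone in auto)

lemma slit_ray_left: "slit_ray (cis (pi - \<phi>)) (-1) (cone \<phi>)"
proof
  fix z assume z: "z \<in> cone \<phi>"
  have "- Re z * sin \<phi> \<le> \<bar>Re z\<bar> * sin \<phi>" using sin_cos_pos by (intro mult_right_mono) auto
  then show "Im (z * cnj (cis (pi - \<phi>))) \<noteq> 0" using z by (simp add: cone_def)
  fix t :: real assume "t \<ge> 0"
  show "-1 * (cis (pi - \<phi>) * of_real t - z) \<notin> \<real>\<^sub>\<le>\<^sub>0"
  proof
    assume "-1 * (cis (pi - \<phi>) * of_real t - z) \<in> \<real>\<^sub>\<le>\<^sub>0"
    then have "Im z = t * sin \<phi>" "t * cos \<phi> \<le> \<bar>Re z\<bar>"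
      by (auto simp: complex_nonpos_Reals_iff mult_ac)
    then show False using cone_not_ge[OF z] by blast
  qed
qed (use sin_cos_pos open_cone in auto)

end

context
  fixes \<phi> m :: real
  assumes \<phi>: "0 < \<phi>" "\<phi> < pi / 2" and m: "m > 0"
begin

text \<open>
  The phase makes the two branches agree above \<open>z\<close>. Both rays are directed from \<open>0\<close> to infinity.
\<close>

definition two_rays :: "real \<Rightarrow> complex \<Rightarrow> complex" where
  "two_rays \<eta> z = expo_ray \<eta> 1 (cis \<phi>) m z + cis (- pi * \<eta>) * expo_ray \<eta> (-1) (cis (pi - \<phi>)) m z"

text \<open>
  Below \<open>z\<close>, and in particular at \<open>0\<close>, the two branches are opposite, so the boundary terms of the two
  integrations by parts cancel.
\<close>

lemma two_rays_3_2:
  assumes z: "z \<in> cone \<phi>"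
  shows "two_rays (3/2) z = 2 * \<i> * of_real m * two_rays (1/2) z"
proof -
  interpret R: slit_ray "cis \<phi>" 1 "cone \<phi>" by (rule slit_ray_right[OF \<phi>])
  interpret L: slit_ray "cis (pi - \<phi>)" "-1" "cone \<phi>" by (rule slit_ray_left[OF \<phi>])
  have Rp: "expo_ray (3/2) 1 (cis \<phi>) m z
      = 2 * (\<i> * of_real m * expo_ray (1/2) 1 (cis \<phi>) m z + (- z) powr of_real (- (1/2)))"
    using R.expo_ray_by_parts[OF z m, of "1/2"] by (simp add: field_simps)
  have Lp: "expo_ray (3/2) (-1) (cis (pi - \<phi>)) m z
      = - 2 * (\<i> * of_real m * expo_ray (1/2) (-1) (cis (pi - \<phi>)) m z + z powr of_real (- (1/2)))"
  proof -
    have "- (1/2) * expo_ray (3/2) (-1) (cis (pi - \<phi>)) m z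
        = \<i> * of_real m * expo_ray (1/2) (-1) (cis (pi - \<phi>)) m z + z powr of_real (- (1/2))"
      using L.expo_ray_by_parts[OF z m, of "1/2"] by simp
    then have "- 2 * (- (1/2) * expo_ray (3/2) (-1) (cis (pi - \<phi>)) m z)
        = - 2 * (\<i> * of_real m * expo_ray (1/2) (-1) (cis (pi - \<phi>)) m z + z powr of_real (- (1/2)))"
      by (simp only:)
    then show ?thesis by simp
  qed
  have Imz: "Im z > 0" by (rule cone_Im_pos[OF \<phi> z])
  then have z0: "z \<noteq> 0" by auto
  have "Ln (- z) = Ln z - \<i> * of_real pi"
    using Imz z0 by (subst Ln_minus) auto
  then have "(- z) powr of_real (- (1/2)) = exp (\<i> * of_real (pi / 2)) * z powr of_real (- (1/2))"
  proof -
    have "of_real (- (1/2)) * (Ln z - \<i> * of_real pi) = \<i> * of_real (pi / 2) + of_real (- (1/2)) * Ln z"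
      by (simp add: algebra_simps)
    with \<open>Ln (- z) = Ln z - \<i> * of_real pi\<close> show ?thesis
      using z0 by (simp only: powr_def exp_add[symmetric] neg_equal_0_iff_equal if_False)
  qed
  also have "exp (\<i> * of_real (pi / 2)) = \<i>"
    by (simp only: cis_conv_exp[symmetric] cis_pi_half)
  finally have mz: "(- z) powr of_real (- (1/2)) = \<i> * z powr of_real (- (1/2))" .
  have c1: "cis (- pi * (1/2)) = - \<i>" by (simp add: complex_eq_iff)
  have "cis (- pi * (3/2)) = cis (- pi * (1/2)) * cis (- pi)"
    unfolding cis_mult by (intro arg_cong[of _ _ cis]) simp
  then have c3: "cis (- pi * (3/2)) = \<i>" unfolding c1 by (simp add: complex_eq_iff)
  show ?thesis
    unfolding two_rays_def Rp Lp mz c1 c3 by (simp add: algebra_simps)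
qed

lemma has_field_derivative_two_rays:
  assumes z: "z \<in> cone \<phi>"
  shows "(two_rays (1/2) has_field_derivative \<i> * of_real m * two_rays (1/2) z) (at z)"
proof -
  interpret R: slit_ray "cis \<phi>" 1 "cone \<phi>" by (rule slit_ray_right[OF \<phi>])
  interpret L: slit_ray "cis (pi - \<phi>)" "-1" "cone \<phi>" by (rule slit_ray_left[OF \<phi>])
  have h: "(0::real) \<le> 1/2" "(1/2::real) + 1 = 3/2" by simp_all
  have c: "cis (- pi * (3/2)) = - cis (- pi * (1/2))"
  proof -
    have "cis (- pi * (3/2)) = cis (- pi * (1/2)) * cis (- pi)"
      unfolding cis_mult by (intro arg_cong[of _ _ cis]) simp
    moreover have "cis (- pi) = -1" by (simp add: complex_eq_iff)
    ultimately show ?thesis by simp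
  qed
  note 1 = R.has_field_derivative_expo_ray[OF z m h(1), unfolded h(2)]
  note 2 = L.has_field_derivative_expo_ray[OF z m h(1), unfolded h(2)]
  have "(two_rays (1/2) has_field_derivative (1/2) * two_rays (3/2) z) (at z)"
    unfolding two_rays_def[abs_def]
    by (rule DERIV_cong[OF DERIV_add[OF 1 DERIV_cmult[OF 2, of "cis (- pi * (1/2))"]]])
       (simp only: c, simp add: algebra_simps)
  then show ?thesis unfolding two_rays_3_2[OF z] by (simp add: mult.assoc)
qed

text \<open>
  Branch point and starting point coincide: a Gamma integral in a complex direction. The result depends
  only on the branch, and for the two rays it is the same up to the phase in \<open>two_rays\<close>.
\<close>

lemma expo_ray_vertex:
  assumes \<psi>: "0 < \<psi>" "\<psi> < pi" and \<omega>: "- pi < \<omega>" "\<omega> < pi" and s: "s * cis \<psi> = cis \<omega>"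
  shows "(\<integral>t. exp (\<i> * of_real m * (cis \<psi> * of_real t)) * (s * (cis \<psi> * of_real t)) powr of_real (- (1/2)) * cis \<psi> \<partial>half_line)
    = of_real (Gamma (1/2) * m powr (- (1/2))) * cis (\<psi> / 2 - \<omega> / 2 + pi / 4)"
proof -
  let ?z = "of_real m * cis (\<psi> - pi / 2)"
  have zeq: "?z = - \<i> * of_real m * cis \<psi>"
    by (simp add: complex_eq_iff cos_diff sin_diff)
  have z: "Re ?z > 0" using \<psi> m sin_gt_zero by (simp add: cos_diff)
  have eq: "exp (\<i> * of_real m * (cis \<psi> * of_real t)) * (s * (cis \<psi> * of_real t)) powr of_real (- (1/2)) * cis \<psi>
      = (of_real t powr of_real (1/2 - 1) * exp (- (?z * of_real t))) * (cis (- (1/2) * \<omega>) * cis \<psi>)"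
    if "t \<in> space half_line" for t
  proof -
    have t: "t > 0" using that by simp
    have e: "s * (cis \<psi> * of_real t) = of_real t * cis \<omega>"
      unfolding s[symmetric] by (simp only: mult_ac)
    have "(s * (cis \<psi> * of_real t)) powr of_real (- (1/2)) = of_real (t powr (- (1/2))) * cis (- (1/2) * \<omega>)"
      unfolding e by (rule powr_of_real_cis[OF t \<omega>])
    moreover have "of_real t powr of_real (1/2 - 1) = complex_of_real (t powr (- (1/2)))"
      using powr_of_real[of t "- (1/2)"] t by simp
    moreover have "exp (\<i> * of_real m * (cis \<psi> * of_real t)) = exp (- (?z * of_real t))"
      unfolding zeq by (simp add: mult_ac)
    ultimately show ?thesis by (simp only: mult_ac)
  qed
  have "(\<integral>t. exp (\<i> * of_real m * (cis \<psi> * of_real t)) * (s * (cis \<psi> * of_real t)) powr of_real (- (1/2)) * cis \<psi> \<partial>half_line)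
    = (\<integral>t. (of_real t powr of_real (1/2 - 1) * exp (- (?z * of_real t))) * (cis (- (1/2) * \<omega>) * cis \<psi>) \<partial>half_line)"
    by (rule Bochner_Integration.integral_cong[OF refl eq])
  moreover have "\<dots> = of_real (Gamma (1/2)) * ?z powr of_real (- (1/2)) * (cis (- (1/2) * \<omega>) * cis \<psi>)"
    unfolding integral_mult_left_zero using laplace_powr[OF _ z, of "1/2"] by simp
  moreover have "?z powr of_real (- (1/2)) = of_real (m powr (- (1/2))) * cis (- (1/2) * (\<psi> - pi / 2))"
    using \<psi> by (intro powr_of_real_cis[OF m]) auto
  moreover have "of_real (Gamma (1/2)) * (of_real (m powr (- (1/2))) * cis (- (1/2) * (\<psi> - pi / 2))) * (cis (- (1/2) * \<omega>) * cis \<psi>)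
      = of_real (Gamma (1/2) * m powr (- (1/2))) * (cis (- (1/2) * (\<psi> - pi / 2)) * (cis (- (1/2) * \<omega>) * cis \<psi>))"
    by simp
  moreover have "cis (- (1/2) * (\<psi> - pi / 2)) * (cis (- (1/2) * \<omega>) * cis \<psi>) = cis (\<psi> / 2 - \<omega> / 2 + pi / 4)"
    unfolding cis_mult by (intro arg_cong[of _ _ cis]) (simp add: field_simps)
  ultimately show ?thesis by (simp only:)
qed

lemma two_rays_1_2:
  assumes z: "z \<in> cone \<phi>"
  shows "two_rays (1/2) z = 2 * of_real (Gamma (1/2) * m powr (- (1/2))) * cis (pi / 4) * exp (\<i> * of_real m * z)"
proof -
  interpret R: slit_ray "cis \<phi>" 1 "cone \<phi>" by (rule slit_ray_right[OF \<phi>])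
  interpret L: slit_ray "cis (pi - \<phi>)" "-1" "cone \<phi>" by (rule slit_ray_left[OF \<phi>])
  let ?V = "of_real (Gamma (1/2) * m powr (- (1/2))) * cis (pi / 4) :: complex"
  let ?H = "\<lambda>z. exp (- (\<i> * of_real m * z)) * two_rays (1/2) z"
  have der: "(?H has_field_derivative 0) (at z within cone \<phi>)" if "z \<in> cone \<phi>" for z
  proof -
    have "((\<lambda>z. exp (- (\<i> * of_real m * z))) has_field_derivative
        exp (- (\<i> * of_real m * z)) * - (\<i> * of_real m)) (at z)"
      by (auto intro!: derivative_eq_intros)
    from DERIV_mult[OF this has_field_derivative_two_rays[OF that]]
    have "(?H has_field_derivative 0) (at z)"
      by (rule DERIV_cong) (simp add: algebra_simps)
    then show ?thesis by (rule has_field_derivative_at_within)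
  qed
  have "\<exists>c. \<forall>z\<in>cone \<phi>. ?H z = c"
    by (rule has_field_derivative_zero_constant[OF convex_cone der]) (use \<phi> in auto)
  then obtain c where c: "\<And>z. z \<in> cone \<phi> \<Longrightarrow> ?H z = c" by blast
  let ?y = "\<lambda>n::nat. of_real (1 / (real n + 1)) * z"
  have y: "?y n \<in> cone \<phi>" for n by (rule cone_scale[OF _ z]) simp
  have h: "(0::real) \<le> 1/2" "(1/2::real) < 1" by simp_all
  have "(\<lambda>n. two_rays (1/2) (?y n)) \<longlonglongrightarrow> ?V + cis (- pi * (1/2)) * (of_real (Gamma (1/2) * m powr (- (1/2))) * cis (pi / 4 + pi / 2))"
    unfolding two_rays_def
  proof (intro tendsto_add tendsto_mult_left)
    show "(\<lambda>n. expo_ray (1/2) 1 (cis \<phi>) m (?y n)) \<longlonglongrightarrow> ?V"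
      using R.expo_ray_tendsto[OF z cone_scale[OF _ z] m h] expo_ray_vertex[of \<phi> \<phi> 1] \<phi> by simp
    have "- 1 * cis (pi - \<phi>) = cis (- \<phi>)" by (simp add: complex_eq_iff)
    moreover have "(pi - \<phi>) / 2 - - \<phi> / 2 + pi / 4 = pi / 4 + pi / 2" by (simp add: field_simps)
    ultimately show "(\<lambda>n. expo_ray (1/2) (-1) (cis (pi - \<phi>)) m (?y n)) \<longlonglongrightarrow>
        of_real (Gamma (1/2) * m powr (- (1/2))) * cis (pi / 4 + pi / 2)"
      using L.expo_ray_tendsto[OF z cone_scale[OF _ z] m h] expo_ray_vertex[of "pi - \<phi>" "- \<phi>" "-1"] \<phi>
      by (simp only:)
  qed
  moreover have "cis (- pi * (1/2)) * (of_real (Gamma (1/2) * m powr (- (1/2))) * cis (pi / 4 + pi / 2)) = ?V"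
  proof -
    have "cis (- pi * (1/2)) * cis (pi / 4 + pi / 2) = cis (pi / 4)"
      unfolding cis_mult by (intro arg_cong[of _ _ cis]) simp
    then show ?thesis unfolding mult.left_commute[of "cis (- pi * (1/2))"] by (simp only:)
  qed
  ultimately have lim1: "(\<lambda>n. two_rays (1/2) (?y n)) \<longlonglongrightarrow> ?V + ?V" by (simp only:)
  have "(\<lambda>n. 1 / (real n + 1)) \<longlonglongrightarrow> 0"
    using LIMSEQ_inverse_real_of_nat by (simp add: inverse_eq_divide add.commute)
  then have "(\<lambda>n. exp (- (\<i> * of_real m * ?y n))) \<longlonglongrightarrow> exp (- (\<i> * of_real m * (of_real 0 * z)))"
    by (intro tendsto_intros)
  from tendsto_mult[OF this lim1] have "(\<lambda>n. ?H (?y n)) \<longlonglongrightarrow> ?V + ?V" by simp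
  moreover have "(\<lambda>n. ?H (?y n)) \<longlonglongrightarrow> c" unfolding c[OF y] by (rule tendsto_const)
  ultimately have "?V + ?V = c" by (rule LIMSEQ_unique)
  then have "exp (- (\<i> * of_real m * z)) * two_rays (1/2) z = 2 * ?V"
    using c[OF z] by (simp only: mult_2)
  then have "exp (\<i> * of_real m * z) * (exp (- (\<i> * of_real m * z)) * two_rays (1/2) z)
      = exp (\<i> * of_real m * z) * (2 * ?V)" by (simp only:)
  then have "two_rays (1/2) z = exp (\<i> * of_real m * z) * (2 * ?V)"
    by (simp add: mult.assoc[symmetric] exp_minus_inverse)
  then show ?thesis by (simp only: mult_ac)
qed

text \<open>
  For \<open>\<eta> = 1/2\<close> the differential equation leaves one constant, found by letting \<open>z\<close> tend to \<open>0\<close>; the case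
  \<open>\<eta> = 3/2\<close> is reduced to it by integration by parts, in accordance with \<open>\<Gamma>(-1/2) = - 2 \<Gamma>(1/2)\<close>.
\<close>

theorem two_rays_eq:
  assumes z: "z \<in> cone \<phi>" and \<eta>: "\<eta> \<in> {1/2, 3/2}"
  shows "two_rays \<eta> z = 2 * of_real (Gamma (1 - \<eta>) * m powr (\<eta> - 1)) * cis ((1 - \<eta>) * pi / 2) * exp (\<i> * of_real m * z)"
proof (cases "\<eta> = 1/2")
  case True
  show ?thesis unfolding True two_rays_1_2[OF z] by simp
next
  case False
  then have \<eta>: "\<eta> = 3/2" using \<eta> by simp
  have "(-1/2::real) \<notin> \<int>\<^sub>\<le>\<^sub>0"
  proof
    assume "(-1/2::real) \<in> \<int>\<^sub>\<le>\<^sub>0"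
    then obtain n where "(-1/2::real) = of_int n" by (auto elim!: nonpos_Ints_cases)
    then have "of_int (2 * n) = (of_int (-1) :: real)" by simp
    then have "2 * n = -1" by (simp only: of_int_eq_iff)
    then show False by presburger
  qed
  from Gamma_plus1[OF this] have "Gamma (1/2::real) = - (1/2) * Gamma (-1/2)" by simp
  then have g: "Gamma (-1/2::real) = - 2 * Gamma (1/2)" by simp
  have p: "m powr (1/2) = m * m powr (- (1/2))"
    using m powr_add[of m 1 "- (1/2)"] by simp
  have "cis (pi / 4) = \<i> * cis (- pi / 4)"
  proof -
    have "\<i> * cis (- pi / 4) = cis (pi / 2 + - pi / 4)" by (simp only: cis_mult[symmetric] cis_pi_half)
    also have "pi / 2 + - pi / 4 = pi / 4" by simp
    finally show ?thesis ..
  qed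
  then show ?thesis
    unfolding \<eta> two_rays_3_2[OF z] two_rays_1_2[OF z] using g p by simp
qed

end

section \<open>Fourier series along the two rays\<close>

lemma exponents_has_sum_iff:
  "(f has_sum S) (exponents \<alpha>) \<longleftrightarrow>
    ((\<lambda>n. if \<alpha> + real n > 0 then f (\<alpha> + real n) else 0) has_sum S) UNIV"
proof -
  have e: "exponents \<alpha> = (\<lambda>n. \<alpha> + real n) ` {n. \<alpha> + real n > 0}"
    by (auto simp: exponents_def)
  have "(f has_sum S) (exponents \<alpha>) \<longleftrightarrow> ((f \<circ> (\<lambda>n. \<alpha> + real n)) has_sum S) {n. \<alpha> + real n > 0}"
    unfolding e by (rule has_sum_reindex) (auto simp: inj_on_def)
  also have "\<dots> \<longleftrightarrow> ((\<lambda>n. if \<alpha> + real n > 0 then f (\<alpha> + real n) else 0) has_sum S) UNIV"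
    by (rule has_sum_cong_neutral) auto
  finally show ?thesis .
qed

lemma exponents_summable_on_iff:
  "f summable_on (exponents \<alpha>) \<longleftrightarrow>
    (\<lambda>n. if \<alpha> + real n > 0 then f (\<alpha> + real n) else 0) summable_on UNIV"
  by (simp add: summable_on_def exponents_has_sum_iff)

lemma exponents_integral_has_sum:
  fixes f :: "real \<Rightarrow> real \<Rightarrow> complex"
  assumes int: "\<And>\<mu>. \<mu> \<in> exponents \<alpha> \<Longrightarrow> integrable half_line (f \<mu>)"
    and norm_int: "(\<lambda>\<mu>. \<integral>t. norm (f \<mu> t) \<partial>half_line) summable_on exponents \<alpha>"
    and sum: "\<And>t. t > 0 \<Longrightarrow> ((\<lambda>\<mu>. f \<mu> t) has_sum F t) (exponents \<alpha>)"
  shows "((\<lambda>\<mu>. \<integral>t. f \<mu> t \<partial>half_line) has_sum (\<integral>t. F t \<partial>half_line)) (exponents \<alpha>)"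
proof -
  define g where "g n = (if \<alpha> + real n > 0 then f (\<alpha> + real n) else (\<lambda>_. 0))" for n
  have mem: "\<alpha> + real n \<in> exponents \<alpha>" if "\<alpha> + real n > 0" for n
    using that by (auto simp: exponents_def)
  have i: "integrable half_line (g n)" for n
    using int[OF mem] by (simp add: g_def)
  have eq: "(\<lambda>n. if \<alpha> + real n > 0 then f (\<alpha> + real n) t else 0) = (\<lambda>n. g n t)" for t
    by (simp add: g_def fun_eq_iff)
  have s: "((\<lambda>n. g n t) has_sum F t) UNIV" if "t > 0" for t
    using sum[OF that] unfolding exponents_has_sum_iff eq .
  have sn: "summable (\<lambda>n. norm (g n t))" if "t > 0" for t
  proof -
    have "(\<lambda>n. g n t) summable_on UNIV" using s[OF that] by (auto simp: summable_on_def)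
    then have "(\<lambda>n. norm (g n t)) summable_on UNIV"
      by (simp only: summable_on_iff_abs_summable_on_complex)
    then show ?thesis by (simp add: summable_on_UNIV_nonneg_real_iff)
  qed
  have "(\<lambda>n. if \<alpha> + real n > 0 then \<integral>t. norm (f (\<alpha> + real n) t) \<partial>half_line else 0)
      = (\<lambda>n. \<integral>t. norm (g n t) \<partial>half_line)"
    by (simp add: g_def fun_eq_iff)
  then have "(\<lambda>n. \<integral>t. norm (g n t) \<partial>half_line) summable_on UNIV"
    using norm_int unfolding exponents_summable_on_iff by simp
  then have sni: "summable (\<lambda>n. \<integral>t. norm (g n t) \<partial>half_line)"
    by (simp add: summable_on_UNIV_nonneg_real_iff Bochner_Integration.integral_nonneg)
  have "(\<lambda>n. \<integral>t. g n t \<partial>half_line) sums (\<integral>t. (\<Sum>n. g n t) \<partial>half_line)"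
    by (rule sums_integral[OF i _ sni]) (use sn in \<open>auto intro!: AE_I2\<close>)
  moreover have "(\<integral>t. (\<Sum>n. g n t) \<partial>half_line) = (\<integral>t. F t \<partial>half_line)"
    by (rule Bochner_Integration.integral_cong[OF refl])
       (use s in \<open>auto intro!: sums_unique[symmetric] has_sum_imp_sums\<close>)
  moreover have "summable (\<lambda>n. norm (\<integral>t. g n t \<partial>half_line))"
    by (rule summable_comparison_test'[OF sni, of 0]) simp
  ultimately have "((\<lambda>n. \<integral>t. g n t \<partial>half_line) has_sum (\<integral>t. F t \<partial>half_line)) UNIV"
    by (intro norm_summable_imp_has_sum) auto
  moreover have "(\<lambda>n. if \<alpha> + real n > 0 then \<integral>t. f (\<alpha> + real n) t \<partial>half_line else 0)
      = (\<lambda>n. \<integral>t. g n t \<partial>half_line)"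
    by (simp add: g_def fun_eq_iff)
  ultimately show ?thesis unfolding exponents_has_sum_iff by simp
qed

lemma norm_qpow: "norm (qpow \<tau> \<mu>) = exp (- (2 * pi * \<mu> * Im \<tau>))"
  by (simp add: qpow_def norm_exp_eq_Re)

lemma qpow_add: "qpow (p + w) \<mu> = qpow p \<mu> * exp (\<i> * of_real (2 * pi * \<mu>) * w)"
  by (simp add: qpow_def exp_add[symmetric] algebra_simps)

lemma exponents_pos: "\<mu> \<in> exponents \<alpha> \<Longrightarrow> \<mu> > 0"
  by (simp add: exponents_def)

lemma exponents_lower_bound:
  assumes "\<alpha> \<ge> 0"
  obtains \<mu>0 where "\<mu>0 > 0" "\<forall>\<mu>\<in>exponents \<alpha>. \<mu>0 \<le> \<mu>"
proof -
  define \<mu>0 where "\<mu>0 = (if \<alpha> = 0 then 1 else \<alpha>)"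
  have "\<mu>0 \<le> \<mu>" if "\<mu> \<in> exponents \<alpha>" for \<mu>
  proof -
    from that obtain n :: nat where n: "\<mu> = \<alpha> + real n" "\<mu> > 0"
      unfolding exponents_def by blast
    show ?thesis
    proof (cases n)
      case 0
      then show ?thesis using n by (simp add: \<mu>0_def)
    next
      case (Suc k)
      then show ?thesis using n assms by (simp add: \<mu>0_def)
    qed
  qed
  moreover have "\<mu>0 > 0" using assms by (simp add: \<mu>0_def)
  ultimately show ?thesis using that by blast
qed

locale fourier_series =
  fixes \<alpha> \<beta> :: real and a :: "real \<Rightarrow> complex" and G :: "complex \<Rightarrow> complex"
  assumes \<alpha>: "0 \<le> \<alpha>"
    and expansion: "\<And>\<tau>. Im \<tau> > 0 \<Longrightarrow> ((\<lambda>\<mu>. a \<mu> * qpow \<tau> \<mu>) has_sum G \<tau>) (exponents \<alpha>)"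
    and growth: "\<exists>C. \<forall>\<mu>\<in>exponents \<alpha>. norm (a \<mu>) \<le> C * \<mu> powr \<beta>"
begin

lemma norm_summable:
  assumes "Im \<tau> > 0"
  shows "(\<lambda>\<mu>. norm (a \<mu> * qpow \<tau> \<mu>)) summable_on exponents \<alpha>"
proof -
  have "(\<lambda>\<mu>. a \<mu> * qpow \<tau> \<mu>) summable_on exponents \<alpha>"
    using expansion[OF assms] by (auto simp: summable_on_def)
  then show ?thesis by (simp only: summable_on_iff_abs_summable_on_complex)
qed

text \<open>
  The rate is that of the smallest exponent, at the cost of staying at a fixed height \<open>v\<close> above the
  real axis.
\<close>

lemma exp_decay:
  assumes v: "v > 0" and \<mu>0: "\<forall>\<mu>\<in>exponents \<alpha>. \<mu>0 \<le> \<mu>"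
  obtains C where "C \<ge> 0" "\<forall>w. Im w \<ge> v \<longrightarrow> norm (G w) \<le> C * exp (- (2 * pi * \<mu>0 * Im w))"
proof -
  define A where "A = infsum (\<lambda>\<mu>. norm (a \<mu> * qpow (\<i> * of_real v) \<mu>)) (exponents \<alpha>)"
  have sA: "((\<lambda>\<mu>. norm (a \<mu> * qpow (\<i> * of_real v) \<mu>)) has_sum A) (exponents \<alpha>)"
    unfolding A_def using norm_summable[of "\<i> * of_real v"] v by simp
  have "norm (G w) \<le> (A * exp (2 * pi * \<mu>0 * v)) * exp (- (2 * pi * \<mu>0 * Im w))" if w: "Im w \<ge> v" for w
  proof -
    have Imw: "Im w > 0" using w v by simp
    define B where "B = infsum (\<lambda>\<mu>. norm (a \<mu> * qpow w \<mu>)) (exponents \<alpha>)"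
    have sB: "((\<lambda>\<mu>. norm (a \<mu> * qpow w \<mu>)) has_sum B) (exponents \<alpha>)"
      unfolding B_def using norm_summable[OF Imw] by simp
    have "norm (G w) \<le> B" by (rule norm_has_sum_bound[OF sB expansion[OF Imw]])
    also have "B \<le> exp (- (2 * pi * \<mu>0 * (Im w - v))) * A"
    proof (rule has_sum_mono[OF sB has_sum_cmult_right[OF sA]])
      fix \<mu> assume "\<mu> \<in> exponents \<alpha>"
      then have "\<mu>0 \<le> \<mu>" using \<mu>0 by blast
      then have "2 * pi * \<mu>0 * (Im w - v) \<le> 2 * pi * \<mu> * (Im w - v)"
        using w by (intro mult_right_mono) auto
      then have "exp (- (2 * pi * \<mu> * Im w)) \<le> exp (- (2 * pi * \<mu>0 * (Im w - v))) * exp (- (2 * pi * \<mu> * v))"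
        unfolding exp_add[symmetric] by (simp add: algebra_simps)
      then have "norm (a \<mu>) * exp (- (2 * pi * \<mu> * Im w))
          \<le> norm (a \<mu>) * (exp (- (2 * pi * \<mu>0 * (Im w - v))) * exp (- (2 * pi * \<mu> * v)))"
        by (intro mult_left_mono) auto
      then show "norm (a \<mu> * qpow w \<mu>)
          \<le> exp (- (2 * pi * \<mu>0 * (Im w - v))) * norm (a \<mu> * qpow (\<i> * of_real v) \<mu>)"
        by (simp add: norm_mult norm_qpow mult_ac)
    qed
    also have "exp (- (2 * pi * \<mu>0 * (Im w - v))) * A = (A * exp (2 * pi * \<mu>0 * v)) * exp (- (2 * pi * \<mu>0 * Im w))"
      by (simp add: exp_add[symmetric] algebra_simps)
    finally show ?thesis .
  qed
  moreover have "A \<ge> 0" unfolding A_def by (intro infsum_nonneg) auto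
  ultimately show ?thesis using that[of "A * exp (2 * pi * \<mu>0 * v)"] by simp
qed

text \<open>
  Integration term by term is legitimate on a ray that starts at \<open>p\<close> in the open upper half-plane; on a
  ray from \<open>0\<close> the coefficient bound would not suffice for absolute convergence.
\<close>

lemma shifted_ray_has_sum:
  assumes ray: "slit_ray \<sigma> s \<Omega>" and p: "Im p > 0" and z: "\<tau> - p \<in> \<Omega>" and \<eta>: "\<eta> \<ge> 0"
  shows "((\<lambda>\<mu>. a \<mu> * qpow p \<mu> * expo_ray \<eta> s \<sigma> (2 * pi * \<mu>) (\<tau> - p)) has_sum
    (\<integral>t. G (p + \<sigma> * of_real t) * (s * (p + \<sigma> * of_real t - \<tau>)) powr of_real (- \<eta>) * \<sigma> \<partial>half_line)) (exponents \<alpha>)"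
proof -
  interpret slit_ray \<sigma> s \<Omega> by (rule ray)
  let ?b = "\<lambda>t. (s * (\<sigma> * of_real t - (\<tau> - p))) powr of_real (- \<eta>)"
  let ?e = "\<lambda>\<mu> t. exp (\<i> * of_real (2 * pi * \<mu>) * (\<sigma> * of_real t)) * ?b t * \<sigma>"
  let ?f = "\<lambda>\<mu> t. a \<mu> * qpow p \<mu> * ?e \<mu> t"
  let ?d = "\<bar>Im ((\<tau> - p) * cnj \<sigma>)\<bar>"
  have d: "?d > 0" using off_line[OF z] by simp
  obtain \<mu>0 where \<mu>0: "\<mu>0 > 0" "\<forall>\<mu>\<in>exponents \<alpha>. \<mu>0 \<le> \<mu>"
    using exponents_lower_bound[OF \<alpha>] by blast
  let ?h = "\<lambda>t. ?d powr (- \<eta>) * exp (- (2 * pi * \<mu>0 * Im \<sigma> * t))"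
  have h: "integrable half_line ?h"
    using \<mu>0 \<sigma> by (intro integrable_mult_right integrable_exp_half_line) auto
  have i: "integrable half_line (?f \<mu>)" if "\<mu> \<in> exponents \<alpha>" for \<mu>
    using exponents_pos[OF that] by (intro integrable_mult_right integrable_expo_ray z \<eta>) auto
  have le: "norm (?f \<mu> t) \<le> norm (a \<mu> * qpow p \<mu>) * ?h t" if "\<mu> \<in> exponents \<alpha>" "t > 0" for \<mu> t
  proof -
    have "2 * pi * \<mu>0 * Im \<sigma> * t \<le> 2 * pi * \<mu> * Im \<sigma> * t"
      using \<mu>0 that \<sigma> by (intro mult_right_mono mult_left_mono) auto
    then have "exp (- (2 * pi * \<mu> * Im \<sigma> * t)) * norm (?b t) \<le> exp (- (2 * pi * \<mu>0 * Im \<sigma> * t)) * ?d powr (- \<eta>)"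
      using norm_ray_powr_le[OF d order_refl \<eta>, of t] by (intro mult_mono) auto
    then have "norm (a \<mu> * qpow p \<mu>) * (exp (- (2 * pi * \<mu> * Im \<sigma> * t)) * norm (?b t))
        \<le> norm (a \<mu> * qpow p \<mu>) * (exp (- (2 * pi * \<mu>0 * Im \<sigma> * t)) * ?d powr (- \<eta>))"
      by (rule mult_left_mono) simp
    then show ?thesis
      unfolding norm_mult[of "a \<mu> * qpow p \<mu>"] norm_mult[of _ \<sigma>] norm_mult[of "exp _"] norm_exp_i_ray \<sigma>(2)
      by (simp only: mult_1_right mult_ac)
  qed
  have "((\<lambda>\<mu>. \<integral>t. ?f \<mu> t \<partial>half_line) has_sum
      (\<integral>t. G (p + \<sigma> * of_real t) * (s * (p + \<sigma> * of_real t - \<tau>)) powr of_real (- \<eta>) * \<sigma> \<partial>half_line)) (exponents \<alpha>)"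
  proof (rule exponents_integral_has_sum[OF i])
    show "(\<lambda>\<mu>. \<integral>t. norm (?f \<mu> t) \<partial>half_line) summable_on exponents \<alpha>"
    proof (rule summable_on_comparison_test)
      show "(\<lambda>\<mu>. norm (a \<mu> * qpow p \<mu>) * (\<integral>t. ?h t \<partial>half_line)) summable_on exponents \<alpha>"
        by (intro summable_on_cmult_left norm_summable p)
      show "(\<integral>t. norm (?f \<mu> t) \<partial>half_line) \<le> norm (a \<mu> * qpow p \<mu>) * (\<integral>t. ?h t \<partial>half_line)"
        if "\<mu> \<in> exponents \<alpha>" for \<mu>
      proof -
        have "(\<integral>t. norm (?f \<mu> t) \<partial>half_line) \<le> (\<integral>t. norm (a \<mu> * qpow p \<mu>) * ?h t \<partial>half_line)"
          by (rule Bochner_Integration.integral_mono[OF integrable_norm[OF i[OF that]] integrable_mult_right[OF h]])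
             (use le[OF that] in simp)
        then show ?thesis unfolding integral_mult_right_zero .
      qed
    qed (simp add: Bochner_Integration.integral_nonneg)
    fix t :: real assume t: "t > 0"
    have "Im (p + \<sigma> * of_real t) > 0" using p \<sigma> t by (simp add: add_pos_pos)
    from has_sum_cmult_left[OF expansion[OF this], of "?b t * \<sigma>"]
    have "((\<lambda>\<mu>. a \<mu> * qpow (p + \<sigma> * of_real t) \<mu> * (?b t * \<sigma>)) has_sum G (p + \<sigma> * of_real t) * (?b t * \<sigma>)) (exponents \<alpha>)" .
    moreover have "a \<mu> * qpow (p + \<sigma> * of_real t) \<mu> * (?b t * \<sigma>) = ?f \<mu> t" for \<mu>
      unfolding qpow_add by (simp only: mult_ac)
    moreover have "\<sigma> * of_real t - (\<tau> - p) = p + \<sigma> * of_real t - \<tau>" by simp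
    ultimately show "((\<lambda>\<mu>. ?f \<mu> t) has_sum
        G (p + \<sigma> * of_real t) * (s * (p + \<sigma> * of_real t - \<tau>)) powr of_real (- \<eta>) * \<sigma>) (exponents \<alpha>)"
      by (simp only: mult.assoc)
  qed
  moreover have "(\<integral>t. ?f \<mu> t \<partial>half_line) = a \<mu> * qpow p \<mu> * expo_ray \<eta> s \<sigma> (2 * pi * \<mu>) (\<tau> - p)" for \<mu>
    unfolding integral_mult_right_zero expo_ray_def ..
  ultimately show ?thesis by (simp only:)
qed

end

text \<open>
  The starting point moves to \<open>0\<close> along the segment from \<open>\<tau>\<close>. All the shifted rays lie in one sector, so the
  sector decay of \<open>G\<close> dominates.
\<close>

lemma shifted_ray_tendsto:
  assumes ray: "slit_ray \<sigma> s \<Omega>" and \<tau>: "Im \<tau> > 0" "\<And>y. y > 0 \<Longrightarrow> of_real y * \<tau> \<in> \<Omega>" and \<eta>: "\<eta> \<ge> 0"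
    and dec: "sector_decay G" and hol: "G holomorphic_on {z. Im z > 0}"
  defines "p \<equiv> \<lambda>n::nat. of_real (1 / (real n + 2)) * \<tau>"
  shows "(\<lambda>n. \<integral>t. G (p n + \<sigma> * of_real t) * (s * (p n + \<sigma> * of_real t - \<tau>)) powr of_real (- \<eta>) * \<sigma> \<partial>half_line)
    \<longlonglongrightarrow> (\<integral>t. G (\<sigma> * of_real t) * (s * (\<sigma> * of_real t - \<tau>)) powr of_real (- \<eta>) * \<sigma> \<partial>half_line)"
proof -
  interpret slit_ray \<sigma> s \<Omega> by (rule ray)
  have \<tau>\<Omega>: "\<tau> \<in> \<Omega>" using \<tau>(2)[of 1] by simp
  have \<tau>0: "\<tau> \<noteq> 0" using \<tau> by auto
  have cont: "continuous_on {z. Im z > 0} G" using hol by (rule holomorphic_on_imp_continuous_on)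
  define \<delta> where "\<delta> = min (Im \<tau> / norm \<tau>) (Im \<sigma>)"
  have \<delta>: "\<delta> > 0" "\<delta> * norm \<tau> \<le> Im \<tau>" "\<delta> \<le> Im \<sigma>"
    using \<tau> \<tau>0 \<sigma> by (auto simp: \<delta>_def min_def field_simps)
  obtain C c where C: "C \<ge> 0" "c > 0"
    and bd: "\<And>w. w \<noteq> 0 \<Longrightarrow> Im w \<ge> \<delta> * norm w \<Longrightarrow> norm (G w) \<le> C * exp (- (c * (norm w + 1 / norm w)))"
    using sector_decayE[OF dec \<delta>(1)] by blast
  \<comment> \<open>The starting point is at most half way to \<open>\<tau>\<close> (hence the \<open>n + 2\<close>), so the branch point keeps half its distance from the line.\<close>
  define d where "d = \<bar>Im (\<tau> * cnj \<sigma>)\<bar> / 2"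
  have d: "d > 0" using off_line[OF \<tau>\<Omega>] by (simp add: d_def)
  have y: "0 < 1 / (real n + 2)" "1 / (real n + 2) \<le> 1 / 2" for n by (auto simp: field_simps)
  have diff: "\<tau> - p n = of_real (1 - 1 / (real n + 2)) * \<tau>" for n by (simp add: p_def algebra_simps)
  have dle: "d \<le> \<bar>Im ((\<tau> - p n) * cnj \<sigma>)\<bar>" for n
  proof -
    have "Im ((\<tau> - p n) * cnj \<sigma>) = (1 - 1 / (real n + 2)) * Im (\<tau> * cnj \<sigma>)"
      unfolding diff mult.assoc by (simp only: Im_complex_of_real times_complex.sel Re_complex_of_real)
    moreover have "(1 - 1 / (real n + 2)) * \<bar>Im (\<tau> * cnj \<sigma>)\<bar> \<ge> (1/2) * \<bar>Im (\<tau> * cnj \<sigma>)\<bar>"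
      using y[of n] by (intro mult_right_mono) auto
    ultimately show ?thesis using y[of n] by (simp add: d_def abs_mult)
  qed
  have in\<Omega>: "\<tau> - p n \<in> \<Omega>" for n
    unfolding diff using y[of n] by (intro \<tau>(2)) auto
  have re: "p n + \<sigma> * of_real t - \<tau> = \<sigma> * of_real t - (\<tau> - p n)" for n t by simp
  let ?h = "\<lambda>t. C * exp (- (c * Im \<sigma> * t)) * d powr (- \<eta>)"
  have meas: "(\<lambda>t. G (q + \<sigma> * of_real t) * (s * (\<sigma> * of_real t - z)) powr of_real (- \<eta>) * \<sigma>) \<in> borel_measurable half_line"
    if "Im q \<ge> 0" "z \<in> \<Omega>" for q z
  proof (intro measurable_half_line continuous_on_mult continuous_ray_powr[OF that(2)] continuous_on_const)
    show "continuous_on {0<..} (\<lambda>t. G (q + \<sigma> * of_real t))"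
      by (rule continuous_on_compose2[OF cont]) (use that \<sigma> in \<open>auto intro!: continuous_intros add_nonneg_pos\<close>)
  qed
  show ?thesis
  proof (rule integral_dominated_convergence[where w = ?h])
    show "integrable half_line ?h"
      using C \<sigma> by (intro integrable_mult_left integrable_mult_right integrable_exp_half_line) auto
    show "(\<lambda>t. G (p n + \<sigma> * of_real t) * (s * (p n + \<sigma> * of_real t - \<tau>)) powr of_real (- \<eta>) * \<sigma>) \<in> borel_measurable half_line" for n
      unfolding re by (rule meas[OF _ in\<Omega>]) (use \<tau> y in \<open>simp add: p_def\<close>)
    show "(\<lambda>t. G (\<sigma> * of_real t) * (s * (\<sigma> * of_real t - \<tau>)) powr of_real (- \<eta>) * \<sigma>) \<in> borel_measurable half_line"
      using meas[of 0 \<tau>] \<tau>\<Omega> by simp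
    show "AE t in half_line. (\<lambda>n. G (p n + \<sigma> * of_real t) * (s * (p n + \<sigma> * of_real t - \<tau>)) powr of_real (- \<eta>) * \<sigma>)
        \<longlonglongrightarrow> G (\<sigma> * of_real t) * (s * (\<sigma> * of_real t - \<tau>)) powr of_real (- \<eta>) * \<sigma>"
    proof (intro AE_I2)
      fix t assume "t \<in> space half_line"
      then have t: "t > 0" by simp
      have "(\<lambda>n. 1 / (real n + 2)) \<longlonglongrightarrow> 0"
        using LIMSEQ_ignore_initial_segment[OF LIMSEQ_inverse_real_of_nat, of 1]
        by (simp add: inverse_eq_divide add.commute)
      then have "(\<lambda>n. p n) \<longlonglongrightarrow> of_real 0 * \<tau>" unfolding p_def by (intro tendsto_intros)
      then have p0: "(\<lambda>n. p n) \<longlonglongrightarrow> 0" by simp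
      have "(\<lambda>n. p n + \<sigma> * of_real t) \<longlonglongrightarrow> 0 + \<sigma> * of_real t" by (intro tendsto_intros p0)
      then have l1: "(\<lambda>n. p n + \<sigma> * of_real t) \<longlonglongrightarrow> \<sigma> * of_real t" by simp
      have "isCont G (\<sigma> * of_real t)"
        using cont \<sigma> t by (simp add: continuous_on_eq_continuous_at open_halfspace_Im_gt)
      then have A: "(\<lambda>n. G (p n + \<sigma> * of_real t)) \<longlonglongrightarrow> G (\<sigma> * of_real t)"
        using l1 by (rule isCont_tendsto_compose)
      have B: "(\<lambda>n. s * (p n + \<sigma> * of_real t - \<tau>)) \<longlonglongrightarrow> s * (\<sigma> * of_real t - \<tau>)"
        by (intro tendsto_mult_left tendsto_diff l1 tendsto_const)
      have off: "s * (\<sigma> * of_real t - \<tau>) \<notin> \<real>\<^sub>\<le>\<^sub>0" using off_slit[OF \<tau>\<Omega>] t by simp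
      show "(\<lambda>n. G (p n + \<sigma> * of_real t) * (s * (p n + \<sigma> * of_real t - \<tau>)) powr of_real (- \<eta>) * \<sigma>)
        \<longlonglongrightarrow> G (\<sigma> * of_real t) * (s * (\<sigma> * of_real t - \<tau>)) powr of_real (- \<eta>) * \<sigma>"
        by (rule tendsto_mult[OF tendsto_mult[OF A tendsto_powr_complex[OF off B tendsto_const]] tendsto_const])
    qed
    show "AE t in half_line. norm (G (p n + \<sigma> * of_real t) * (s * (p n + \<sigma> * of_real t - \<tau>)) powr of_real (- \<eta>) * \<sigma>) \<le> ?h t" for n
    proof (intro AE_I2)
      fix t assume "t \<in> space half_line"
      then have t: "t > 0" by simp
      let ?w = "p n + \<sigma> * of_real t"
      have Imw: "Im ?w = 1 / (real n + 2) * Im \<tau> + Im \<sigma> * t" by (simp add: p_def)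
      have "1 / (real n + 2) * Im \<tau> > 0" using y[of n] \<tau> by (intro mult_pos_pos)
      then have Imw_ge: "Im \<sigma> * t \<le> Im ?w" unfolding Imw by simp
      have pos: "Im \<sigma> * t > 0" using \<sigma> t by simp
      then have "Im ?w > 0" using Imw_ge by linarith
      then have w0: "?w \<noteq> 0" by (metis less_irrefl zero_complex.sel(2))
      have "norm ?w \<le> 1 / (real n + 2) * norm \<tau> + t"
      proof -
        have "norm (p n) = 1 / (real n + 2) * norm \<tau>"
          unfolding p_def norm_mult norm_of_real using y(1)[of n] by simp
        then show ?thesis
          using norm_triangle_ineq[of "p n" "\<sigma> * of_real t"] \<sigma> t by (simp add: norm_mult)
      qed
      then have "\<delta> * norm ?w \<le> \<delta> * (1 / (real n + 2) * norm \<tau> + t)" using \<delta> by (intro mult_left_mono) auto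
      also have "\<dots> = 1 / (real n + 2) * (\<delta> * norm \<tau>) + \<delta> * t" by (simp add: algebra_simps)
      also have "\<dots> \<le> Im ?w"
        unfolding Imw using \<delta> y(1)[of n] t by (intro add_mono mult_left_mono mult_right_mono) auto
      finally have "norm (G ?w) \<le> C * exp (- (c * (norm ?w + 1 / norm ?w)))" by (rule bd[OF w0])
      also have "\<dots> \<le> C * exp (- (c * Im \<sigma> * t))"
      proof -
        have "Im \<sigma> * t \<le> norm ?w" using Imw_ge abs_Im_le_cmod[of ?w] by linarith
        then have "Im \<sigma> * t \<le> norm ?w + 1 / norm ?w" by (simp add: add_increasing2)
        then have "c * (Im \<sigma> * t) \<le> c * (norm ?w + 1 / norm ?w)" using C by (intro mult_left_mono) auto
        then show ?thesis using C by (intro mult_left_mono) (auto simp: mult.assoc)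
      qed
      finally have "norm (G ?w) * norm ((s * (\<sigma> * of_real t - (\<tau> - p n))) powr of_real (- \<eta>))
          \<le> C * exp (- (c * Im \<sigma> * t)) * d powr (- \<eta>)"
        using C by (intro mult_mono norm_ray_powr_le[OF d dle \<eta>]) auto
      then show "norm (G ?w * (s * (?w - \<tau>)) powr of_real (- \<eta>) * \<sigma>) \<le> ?h t"
        unfolding re norm_mult \<sigma>(2) by (simp only: norm_mult mult_1_right)
    qed
  qed
qed

context fourier_series
begin

text \<open>
  For rays starting at a point \<open>p\<close> on the segment from \<open>0\<close> to \<open>\<tau>\<close>, the factor \<open>exp\<close> at \<open>p\<close> and the value of
  \<open>two_rays\<close> at \<open>\<tau> - p\<close> multiply to a term independent of \<open>p\<close>. The sum is therefore constant in \<open>p\<close> and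
  equals its limit as \<open>p\<close> tends to \<open>0\<close>.
\<close>

theorem two_ray_integral:
  assumes dec: "sector_decay G" and hol: "G holomorphic_on {z. Im z > 0}"
    and \<phi>: "0 < \<phi>" "\<phi> < pi / 2" and \<tau>: "\<tau> \<in> cone \<phi>" and \<eta>: "\<eta> \<in> {1/2, 3/2}"
  shows "((\<lambda>\<mu>. a \<mu> * qpow \<tau> \<mu> *
      (2 * of_real (Gamma (1 - \<eta>) * (2 * pi * \<mu>) powr (\<eta> - 1)) * cis ((1 - \<eta>) * pi / 2))) has_sum
    ray_integral (\<lambda>w. G w * (w - \<tau>) powr of_real (- \<eta>)) (cis \<phi>) +
    ray_integral (\<lambda>w. G w * (cis (- pi * \<eta>) * (- (w - \<tau>)) powr of_real (- \<eta>))) (cis (pi - \<phi>))) (exponents \<alpha>)"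
proof -
  note ray_R = slit_ray_right[OF \<phi>] and ray_L = slit_ray_left[OF \<phi>]
  have \<eta>0: "\<eta> \<ge> 0" using \<eta> by auto
  have Im\<tau>: "Im \<tau> > 0" by (rule cone_Im_pos[OF \<phi> \<tau>])
  define p where "p n = of_real (1 / (real n + 2)) * \<tau>" for n :: nat
  let ?J = "\<lambda>s \<sigma> q. \<integral>t. G (q + \<sigma> * of_real t) * (s * (q + \<sigma> * of_real t - \<tau>)) powr of_real (- \<eta>) * \<sigma> \<partial>half_line"
  let ?K = "\<lambda>s \<sigma>. \<integral>t. G (\<sigma> * of_real t) * (s * (\<sigma> * of_real t - \<tau>)) powr of_real (- \<eta>) * \<sigma> \<partial>half_line"
  let ?c = "cis (- pi * \<eta>)"
  let ?T = "\<lambda>\<mu>. a \<mu> * qpow \<tau> \<mu> *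
      (2 * of_real (Gamma (1 - \<eta>) * (2 * pi * \<mu>) powr (\<eta> - 1)) * cis ((1 - \<eta>) * pi / 2))"
  have sum: "(?T has_sum (?J 1 (cis \<phi>) (p n) + ?c * ?J (-1) (cis (pi - \<phi>)) (p n))) (exponents \<alpha>)" for n
  proof -
    have y: "0 < 1 / (real n + 2)" "0 < 1 - 1 / (real n + 2)" by (auto simp: field_simps)
    have Imp: "Im (p n) > 0" using y(1) Im\<tau> unfolding p_def by simp
    have "\<tau> - p n = of_real (1 - 1 / (real n + 2)) * \<tau>" by (simp add: p_def algebra_simps)
    then have z: "\<tau> - p n \<in> cone \<phi>" using cone_scale[OF y(2) \<tau>] by simp
    have "((\<lambda>\<mu>. a \<mu> * qpow (p n) \<mu> * expo_ray \<eta> 1 (cis \<phi>) (2 * pi * \<mu>) (\<tau> - p n) +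
        ?c * (a \<mu> * qpow (p n) \<mu> * expo_ray \<eta> (-1) (cis (pi - \<phi>)) (2 * pi * \<mu>) (\<tau> - p n))) has_sum
        (?J 1 (cis \<phi>) (p n) + ?c * ?J (-1) (cis (pi - \<phi>)) (p n))) (exponents \<alpha>)"
      by (intro has_sum_add has_sum_cmult_right shifted_ray_has_sum[OF ray_R Imp z \<eta>0]
          shifted_ray_has_sum[OF ray_L Imp z \<eta>0])
    moreover have "a \<mu> * qpow (p n) \<mu> * expo_ray \<eta> 1 (cis \<phi>) (2 * pi * \<mu>) (\<tau> - p n) +
        ?c * (a \<mu> * qpow (p n) \<mu> * expo_ray \<eta> (-1) (cis (pi - \<phi>)) (2 * pi * \<mu>) (\<tau> - p n)) = ?T \<mu>"
      if "\<mu> \<in> exponents \<alpha>" for \<mu>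
    proof -
      have m: "2 * pi * \<mu> > 0" using exponents_pos[OF that] by simp
      have "a \<mu> * qpow (p n) \<mu> * expo_ray \<eta> 1 (cis \<phi>) (2 * pi * \<mu>) (\<tau> - p n) +
          ?c * (a \<mu> * qpow (p n) \<mu> * expo_ray \<eta> (-1) (cis (pi - \<phi>)) (2 * pi * \<mu>) (\<tau> - p n))
          = a \<mu> * qpow (p n) \<mu> * two_rays \<phi> (2 * pi * \<mu>) \<eta> (\<tau> - p n)"
        unfolding two_rays_def[OF \<phi> m] by (simp add: algebra_simps)
      also have "\<dots> = a \<mu> * (qpow (p n) \<mu> * exp (\<i> * of_real (2 * pi * \<mu>) * (\<tau> - p n))) *
          (2 * of_real (Gamma (1 - \<eta>) * (2 * pi * \<mu>) powr (\<eta> - 1)) * cis ((1 - \<eta>) * pi / 2))"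
        unfolding two_rays_eq[OF \<phi> m z \<eta>] by (simp only: mult_ac)
      also have "qpow (p n) \<mu> * exp (\<i> * of_real (2 * pi * \<mu>) * (\<tau> - p n)) = qpow \<tau> \<mu>"
        unfolding qpow_add[symmetric] by simp
      finally show ?thesis .
    qed
    ultimately show ?thesis by (rule has_sum_cong[THEN iffD1, rotated])
  qed
  have "?J 1 (cis \<phi>) (p n) + ?c * ?J (-1) (cis (pi - \<phi>)) (p n) = infsum ?T (exponents \<alpha>)" for n
    using infsumI[OF sum[of n]] by (rule sym)
  moreover have "(\<lambda>n. ?J 1 (cis \<phi>) (p n) + ?c * ?J (-1) (cis (pi - \<phi>)) (p n)) \<longlonglongrightarrow>
      ?K 1 (cis \<phi>) + ?c * ?K (-1) (cis (pi - \<phi>))"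
    unfolding p_def
    by (intro tendsto_add tendsto_mult_left shifted_ray_tendsto[OF ray_R Im\<tau> cone_scale[OF _ \<tau>] \<eta>0 dec hol]
        shifted_ray_tendsto[OF ray_L Im\<tau> cone_scale[OF _ \<tau>] \<eta>0 dec hol])
  ultimately have "(\<lambda>n. infsum ?T (exponents \<alpha>)) \<longlonglongrightarrow> ?K 1 (cis \<phi>) + ?c * ?K (-1) (cis (pi - \<phi>))"
    by (simp only:)
  then have "infsum ?T (exponents \<alpha>) = ?K 1 (cis \<phi>) + ?c * ?K (-1) (cis (pi - \<phi>))"
    by (rule LIMSEQ_unique[OF tendsto_const])
  moreover have "?K 1 (cis \<phi>) = ray_integral (\<lambda>w. G w * (w - \<tau>) powr of_real (- \<eta>)) (cis \<phi>)"
    unfolding ray_integral_def by (simp only: mult_1)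
  moreover have "?c * ?K (-1) (cis (pi - \<phi>))
      = ray_integral (\<lambda>w. G w * (?c * (- (w - \<tau>)) powr of_real (- \<eta>))) (cis (pi - \<phi>))"
    unfolding ray_integral_def integral_mult_right_zero[symmetric] mult_minus1 by (simp only: mult_ac)
  moreover have "?T summable_on exponents \<alpha>" using sum[of 0] unfolding summable_on_def by blast
  ultimately show ?thesis using has_sum_infsum by fastforce
qed

end

section \<open>The Mellin transform and the L-function\<close>

lemma half_line_inverse:
  fixes f :: "real \<Rightarrow> complex"
  assumes cont: "continuous_on {0<..} f" and int: "integrable half_line f"
  shows "(\<integral>t. f t \<partial>half_line) = (\<integral>r. f (1 / r) / of_real (r ^ 2) \<partial>half_line)"
proof -
  let ?g = "\<lambda>r::real. 1 / r" and ?h = "\<lambda>r::real. - (1 / r ^ 2)"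
  let ?F = "\<lambda>r. \<bar>?h r\<bar> *\<^sub>R f (?g r)"
  have abs_iff: "k absolutely_integrable_on {0<..} \<longleftrightarrow> integrable half_line k"
    if "continuous_on {0<..} k" for k :: "real \<Rightarrow> complex"
  proof -
    have "(\<lambda>t. indicator {0<..} t *\<^sub>R k t) \<in> borel_measurable lborel"
      using borel_measurable_continuous_on_indicator[of "{0<..}" k] that by simp
    then show ?thesis
      using integrable_completion[of "\<lambda>t. indicator {0<..} t *\<^sub>R k t" lborel]
      by (simp add: set_integrable_def integrable_half_line)
  qed
  have integral_eq: "(\<integral>t. k t \<partial>half_line) = integral {0<..} k"
    if "integrable half_line k" for k :: "real \<Rightarrow> complex"
    using that set_borel_integral_eq_integral(2)[of "{0<..}" k]
    by (simp add: integrable_half_line integral_half_line)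
  have img: "?g ` {0<..} = {0<..}"
  proof (intro equalityI subsetI)
    fix x :: real assume "x \<in> {0<..}"
    then show "x \<in> ?g ` {0<..}" by (intro image_eqI[of _ _ "1 / x"]) auto
  qed auto
  have contF: "continuous_on {0<..} ?F"
    by (intro continuous_intros continuous_on_compose2[OF cont]) auto
  have "?F absolutely_integrable_on {0<..} \<and> integral {0<..} ?F = integral {0<..} f
      \<longleftrightarrow> f absolutely_integrable_on ?g ` {0<..} \<and> integral (?g ` {0<..}) f = integral {0<..} f"
    by (rule has_absolute_integral_change_of_variables_real)
       (auto intro!: derivative_eq_intros simp: inj_on_def power2_eq_square)
  then have "integrable half_line ?F" "integral {0<..} ?F = integral {0<..} f"
    using abs_iff[OF cont] abs_iff[OF contF] int img by auto
  then have "(\<integral>t. f t \<partial>half_line) = (\<integral>t. ?F t \<partial>half_line)"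
    using integral_eq int by simp
  also have "\<dots> = (\<integral>r. f (1 / r) / of_real (r ^ 2) \<partial>half_line)"
    by (rule Bochner_Integration.integral_cong[OF refl]) (simp add: scaleR_conv_of_real field_simps)
  finally show ?thesis .
qed

lemma sector_decay_mult_powr: "sector_decay G \<Longrightarrow> sector_decay (\<lambda>w. G w * w powr of_real b)"
  by (erule sector_decay_powr[where a = b]) (simp add: norm_mult norm_powr_of_real mult.commute)

lemma holomorphic_mult_powr:
  "G holomorphic_on {z. Im z > 0} \<Longrightarrow> (\<lambda>w. G w * w powr of_real b) holomorphic_on {z. Im z > 0}"
  by (intro holomorphic_intros) (auto simp: complex_nonpos_Reals_iff)

lemma integrable_imaginary_axis:
  assumes dec: "sector_decay G" and hol: "G holomorphic_on {z. Im z > 0}"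
  shows "integrable half_line (\<lambda>y. norm (G (\<i> * of_real y)) * y powr b)"
proof -
  have "integrable half_line (\<lambda>y. norm (G (\<i> * of_real y) * (\<i> * of_real y) powr of_real b))"
    by (intro integrable_norm integrable_ray[where f = "\<lambda>w. G w * w powr of_real b"] sector_decay_mult_powr dec
        holomorphic_on_imp_continuous_on holomorphic_mult_powr hol) simp
  then show ?thesis
    by (rule Bochner_Integration.integrable_cong[THEN iffD1, rotated 2])
       (auto simp: norm_mult norm_powr_of_real)
qed

lemma exponents_summable_powr:
  assumes "p > 1"
  shows "(\<lambda>\<mu>. \<mu> powr (- p)) summable_on exponents \<alpha>"
proof -
  let ?f = "\<lambda>n. if \<alpha> + real n > 0 then (\<alpha> + real n) powr (- p) else 0"
  define N where "N = nat \<lceil>2 * \<bar>\<alpha>\<bar>\<rceil> + 1"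
  have "summable (\<lambda>n. (1/2) powr (- p) * real n powr (- p))"
    using assms by (intro summable_mult) (simp add: summable_real_powr_iff)
  then have "summable ?f"
  proof (rule summable_comparison_test'[of _ N])
    fix n assume "n \<ge> N"
    then have "2 * \<bar>\<alpha>\<bar> \<le> real n" "n > 0" unfolding N_def by linarith+
    then have a: "real n / 2 \<le> \<alpha> + real n" "real n / 2 > 0" by auto
    then have "(\<alpha> + real n) powr (- p) \<le> (real n / 2) powr (- p)"
      using assms by (intro powr_mono2') auto
    also have "(real n / 2) powr (- p) = (1/2) powr (- p) * real n powr (- p)"
      using powr_mult[of "1/2" "real n" "- p"] by simp
    finally show "norm (?f n) \<le> (1/2) powr (- p) * real n powr (- p)" using a by simp
  qed
  then show ?thesis unfolding exponents_summable_on_iff by (simp add: summable_on_UNIV_nonneg_real_iff)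
qed

context fourier_series
begin

definition mellin :: "complex \<Rightarrow> complex" where
  "mellin s = (\<integral>y. G (\<i> * of_real y) * of_real y powr (s - 1) \<partial>half_line)"

context
  assumes dec: "sector_decay G" and hol: "G holomorphic_on {z. Im z > 0}"
begin

text \<open>
  The decay of \<open>G\<close> at both ends of the imaginary axis makes the Mellin transform entire, and with it the
  L-function, since the reciprocal of the Gamma factor is entire.
\<close>

lemma holomorphic_mellin: "mellin holomorphic_on UNIV"
  unfolding mellin_def[abs_def]
proof (rule holomorphic_on_integral)
  fix s0 :: complex
  let ?h = "\<lambda>y. norm (G (\<i> * of_real y)) * y powr (Re s0 - 2) + norm (G (\<i> * of_real y)) * y powr (Re s0)"
  have "integrable half_line ?h"
    by (intro Bochner_Integration.integrable_add integrable_imaginary_axis dec hol)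
  moreover have "norm (G (\<i> * of_real y) * of_real y powr (s - 1)) \<le> ?h y"
    if s: "s \<in> ball s0 1" and y: "y > 0" for s y
  proof -
    have "\<bar>Re s0 - Re s\<bar> \<le> 1"
      using abs_Re_le_cmod[of "s0 - s"] s by (simp add: dist_norm)
    then have r: "Re s0 - 2 \<le> Re s - 1" "Re s - 1 \<le> Re s0" by linarith+
    have "y powr (Re s - 1) \<le> y powr (Re s0 - 2) + y powr (Re s0)"
    proof (cases "y \<ge> 1")
      case True
      then have "y powr (Re s - 1) \<le> y powr (Re s0)" using r by (intro powr_mono) auto
      then show ?thesis by (simp add: add_increasing)
    next
      case False
      then have "y powr (Re s - 1) \<le> y powr (Re s0 - 2)" using r y by (intro powr_mono') auto
      then show ?thesis by (simp add: add_increasing2)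
    qed
    then have "norm (G (\<i> * of_real y)) * y powr (Re s - 1)
        \<le> norm (G (\<i> * of_real y)) * (y powr (Re s0 - 2) + y powr (Re s0))"
      by (rule mult_left_mono) simp
    then show ?thesis using y by (simp add: norm_mult norm_powr_real_powr distrib_left)
  qed
  ultimately show "\<exists>r>0. \<exists>h. ball s0 r \<subseteq> UNIV \<and> integrable half_line h \<and>
      (\<forall>w\<in>ball s0 r. \<forall>x\<in>space half_line. norm (G (\<i> * of_real x) * of_real x powr (w - 1)) \<le> h x)"
    by (intro exI[of _ 1] conjI exI[of _ ?h]) auto
next
  fix s :: complex
  show "(\<lambda>y. G (\<i> * of_real y) * of_real y powr (s - 1)) \<in> borel_measurable half_line"
  proof (intro measurable_half_line continuous_on_mult continuous_on_powr_off_slit)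
    show "continuous_on {0<..} (\<lambda>y. G (\<i> * of_real y))"
      by (rule continuous_on_compose2[OF holomorphic_on_imp_continuous_on[OF hol]])
         (auto intro!: continuous_intros)
  qed (auto intro!: continuous_intros)
next
  fix y :: real assume "y \<in> space half_line"
  then show "(\<lambda>s. G (\<i> * of_real y) * of_real y powr (s - 1)) holomorphic_on UNIV"
    by (intro holomorphic_intros) auto
qed

lemma mellin_has_sum:
  assumes s: "Re s > 0" "Re s > \<beta> + 1"
  shows "((\<lambda>\<mu>. a \<mu> * (Gamma s * of_real (2 * pi * \<mu>) powr (- s))) has_sum mellin s) (exponents \<alpha>)"
proof -
  let ?k = "\<lambda>\<mu> y. of_real y powr (s - 1) * exp (- (of_real (2 * pi * \<mu>) * of_real y)) :: complex"
  have pos: "2 * pi * \<mu> > 0" if "\<mu> \<in> exponents \<alpha>" for \<mu> using exponents_pos[OF that] by simp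
  obtain C where C: "\<And>\<mu>. \<mu> \<in> exponents \<alpha> \<Longrightarrow> norm (a \<mu>) \<le> C * \<mu> powr \<beta>" using growth by blast
  have i: "integrable half_line (\<lambda>y. a \<mu> * ?k \<mu> y)" if "\<mu> \<in> exponents \<alpha>" for \<mu>
    by (intro integrable_mult_right integrable_Gamma_integral_real_rate s(1) pos[OF that])
  have ni: "(\<integral>y. norm (a \<mu> * ?k \<mu> y) \<partial>half_line) = norm (a \<mu>) * (Gamma (Re s) * (2 * pi * \<mu>) powr (- Re s))"
    if "\<mu> \<in> exponents \<alpha>" for \<mu>
  proof -
    have "(\<integral>y. norm (a \<mu> * ?k \<mu> y) \<partial>half_line)
        = (\<integral>y. norm (a \<mu>) * (y powr (Re s - 1) * exp (- ((2 * pi * \<mu>) * y))) \<partial>half_line)"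
      by (rule Bochner_Integration.integral_cong[OF refl]) (auto simp: norm_mult norm_powr_real_powr)
    then show ?thesis unfolding integral_mult_right_zero integral_powr_exp[OF s(1) pos[OF that]] .
  qed
  have "(\<lambda>\<mu>. C * Gamma (Re s) * (2 * pi) powr (- Re s) * \<mu> powr (- (Re s - \<beta>))) summable_on exponents \<alpha>"
    using s by (intro summable_on_cmult_right exponents_summable_powr) auto
  then have sm: "(\<lambda>\<mu>. \<integral>y. norm (a \<mu> * ?k \<mu> y) \<partial>half_line) summable_on exponents \<alpha>"
  proof (rule summable_on_comparison_test)
    fix \<mu> assume \<mu>: "\<mu> \<in> exponents \<alpha>"
    have "(\<integral>y. norm (a \<mu> * ?k \<mu> y) \<partial>half_line) \<le> (C * \<mu> powr \<beta>) * (Gamma (Re s) * (2 * pi * \<mu>) powr (- Re s))"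
      unfolding ni[OF \<mu>] using C[OF \<mu>] Gamma_real_pos[of "Re s"] s by (intro mult_right_mono) auto
    also have "(2 * pi * \<mu>) powr (- Re s) = (2 * pi) powr (- Re s) * \<mu> powr (- Re s)"
      by (rule powr_mult)
    also have "(C * \<mu> powr \<beta>) * (Gamma (Re s) * ((2 * pi) powr (- Re s) * \<mu> powr (- Re s)))
        = C * Gamma (Re s) * (2 * pi) powr (- Re s) * (\<mu> powr \<beta> * \<mu> powr (- Re s))"
      by (simp only: mult_ac)
    also have "\<mu> powr \<beta> * \<mu> powr (- Re s) = \<mu> powr (- (Re s - \<beta>))"
      by (simp add: powr_add[symmetric])
    finally show "(\<integral>y. norm (a \<mu> * ?k \<mu> y) \<partial>half_line)
        \<le> C * Gamma (Re s) * (2 * pi) powr (- Re s) * \<mu> powr (- (Re s - \<beta>))" .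
  qed (simp add: Bochner_Integration.integral_nonneg)
  have "((\<lambda>\<mu>. \<integral>y. a \<mu> * ?k \<mu> y \<partial>half_line) has_sum mellin s) (exponents \<alpha>)"
    unfolding mellin_def
  proof (rule exponents_integral_has_sum[OF i sm])
    fix y :: real assume y: "y > 0"
    have "Im (\<i> * of_real y) > 0" using y by simp
    from has_sum_cmult_left[OF expansion[OF this], of "of_real y powr (s - 1)"]
    have "((\<lambda>\<mu>. a \<mu> * qpow (\<i> * of_real y) \<mu> * of_real y powr (s - 1)) has_sum
        G (\<i> * of_real y) * of_real y powr (s - 1)) (exponents \<alpha>)" .
    moreover have q: "qpow (\<i> * of_real y) \<mu> = exp (- (of_real (2 * pi * \<mu>) * of_real y))" for \<mu>
    proof -
      have "2 * of_real pi * \<i> * of_real \<mu> * (\<i> * of_real y) = - (of_real (2 * pi * \<mu>) * of_real y :: complex)"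
        by (simp add: complex_eq_iff)
      then show ?thesis unfolding qpow_def by (simp only:)
    qed
    moreover have "a \<mu> * qpow (\<i> * of_real y) \<mu> * of_real y powr (s - 1) = a \<mu> * ?k \<mu> y" for \<mu>
      unfolding q by (simp only: mult_ac)
    ultimately show "((\<lambda>\<mu>. a \<mu> * ?k \<mu> y) has_sum G (\<i> * of_real y) * of_real y powr (s - 1)) (exponents \<alpha>)"
      by (simp only:)
  qed
  moreover have "(\<integral>y. a \<mu> * ?k \<mu> y \<partial>half_line) = a \<mu> * (Gamma s * of_real (2 * pi * \<mu>) powr (- s))"
    if "\<mu> \<in> exponents \<alpha>" for \<mu>
    unfolding integral_mult_right_zero Gamma_integral_real_rate[OF s(1) pos[OF that]] ..
  ultimately show ?thesis by (rule has_sum_cong[THEN iffD1, rotated])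
qed

lemma L_function_eq: "L_function \<alpha> a s = of_real (2 * pi) powr s * rGamma s * mellin s"
proof -
  let ?F = "\<lambda>s. of_real (2 * pi) powr s * rGamma s * mellin s"
  have F_sum: "((\<lambda>\<mu>. a \<mu> * of_real \<mu> powr (- s)) has_sum ?F s) (exponents \<alpha>)"
    if "Re s > \<bar>\<beta>\<bar> + 1" for s
  proof -
    have s: "Re s > 0" "Re s > \<beta> + 1" using that by auto
    have G: "rGamma s * Gamma s = 1"
      using s(1) Gamma_eq_zero_iff[of s] by (auto simp: rGamma_inverse_Gamma elim!: nonpos_Ints_cases)
    have "of_real (2 * pi) powr s * rGamma s * (a \<mu> * (Gamma s * of_real (2 * pi * \<mu>) powr (- s)))
        = a \<mu> * of_real \<mu> powr (- s)" if "\<mu> \<in> exponents \<alpha>" for \<mu>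
    proof -
      have "of_real (2 * pi * \<mu>) powr (- s) = (of_real (2 * pi) powr (- s) * of_real \<mu> powr (- s) :: complex)"
        using exponents_pos[OF that] powr_times_real[of "of_real (2 * pi)" "of_real \<mu>" "- s"] by simp
      then have e1: "of_real (2 * pi) powr s * rGamma s * (a \<mu> * (Gamma s * of_real (2 * pi * \<mu>) powr (- s)))
          = (rGamma s * Gamma s) * (of_real (2 * pi) powr s * of_real (2 * pi) powr (- s)) * (a \<mu> * of_real \<mu> powr (- s))"
        by (simp only: mult_ac)
      have e2: "of_real (2 * pi) powr s * of_real (2 * pi) powr (- s) = (1 :: complex)"
        by (simp add: powr_add[symmetric] del: of_real_mult)
      show ?thesis unfolding e1 e2 G by simp
    qed
    then show ?thesis
      by (rule has_sum_cong[THEN iffD1, OF _ has_sum_cmult_right[OF mellin_has_sum[OF s]]])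
  qed
  have F_hol: "?F holomorphic_on UNIV"
    by (intro holomorphic_intros holomorphic_mellin)
  have "L_function \<alpha> a = ?F"
    unfolding L_function_def
  proof (rule the_equality)
    show "?F holomorphic_on UNIV \<and> (\<exists>\<sigma>. \<forall>s. \<sigma> < Re s \<longrightarrow>
        ((\<lambda>\<mu>. a \<mu> * of_real \<mu> powr (- s)) has_sum ?F s) (exponents \<alpha>))"
      using F_hol F_sum by (intro conjI exI[of _ "\<bar>\<beta>\<bar> + 1"]) auto
    fix H assume H: "H holomorphic_on UNIV \<and> (\<exists>\<sigma>. \<forall>s. \<sigma> < Re s \<longrightarrow>
        ((\<lambda>\<mu>. a \<mu> * of_real \<mu> powr (- s)) has_sum H s) (exponents \<alpha>))"
    then obtain \<sigma> where \<sigma>: "\<And>s. \<sigma> < Re s \<Longrightarrow> ((\<lambda>\<mu>. a \<mu> * of_real \<mu> powr (- s)) has_sum H s) (exponents \<alpha>)"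
      by blast
    \<comment> \<open>Two entire functions with the same Dirichlet series agree on a common half-plane of convergence.\<close>
    define m where "m = max \<sigma> (\<bar>\<beta>\<bar> + 1)"
    have "of_real (m + 1) \<in> {s. Re s > m}" by simp
    then have ne: "{s. Re s > m} \<noteq> {}" by blast
    have "H s = ?F s" for s
    proof (rule analytic_continuation_open[of "{s. Re s > m}" UNIV H ?F])
      show "H z = ?F z" if "z \<in> {s. Re s > m}" for z
        using that by (intro has_sum_unique[OF \<sigma> F_sum]) (auto simp: m_def)
    qed (use H F_hol ne open_halfspace_Re_gt in auto)
    then show "H = ?F" by (rule ext)
  qed
  then show ?thesis by simp
qed

lemma L_function_nat:
  "L_function \<alpha> a (of_nat (l + 1)) =
    of_real ((2 * pi) ^ (l + 1)) / fact l * (\<integral>y. G (\<i> * of_real y) * of_real y ^ l \<partial>half_line)"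
proof -
  have "mellin (of_nat (l + 1)) = (\<integral>y. G (\<i> * of_real y) * of_real y ^ l \<partial>half_line)"
    unfolding mellin_def
  proof (rule Bochner_Integration.integral_cong[OF refl])
    fix y :: real assume "y \<in> space half_line"
    then show "G (\<i> * of_real y) * of_real y powr (of_nat (l + 1) - 1) = G (\<i> * of_real y) * of_real y ^ l"
      by (simp add: powr_nat')
  qed
  moreover have "rGamma (of_nat (l + 1)) = (1 / fact l :: complex)"
    using Gamma_fact[of l, where 'a = complex] by (simp add: rGamma_inverse_Gamma inverse_eq_divide add.commute)
  moreover have "of_real (2 * pi) powr of_nat (l + 1) = (of_real ((2 * pi) ^ (l + 1)) :: complex)"
    by (subst powr_nat') auto
  ultimately show ?thesis unfolding L_function_eq by simp
qed

end

end

section \<open>Components of a cusp form\<close>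

lemma S_mat_in_SL2Z: "S_mat \<in> SL2Z"
  by (simp add: SL2Z_def S_mat_def det_2)

lemma cusp_form_S_transform:
  fixes g :: "complex \<Rightarrow> complex^'r" and \<rho> :: "int^2^2 \<Rightarrow> complex^'r^'r"
  assumes cusp: "cusp_form \<kappa> \<rho> \<alpha> g a" and \<tau>: "Im \<tau> > 0"
  shows "g (- 1 / \<tau>) $ k = \<tau> powr of_real \<kappa> * (\<Sum>j\<in>UNIV. \<rho> S_mat $ k $ j * g \<tau> $ j)"
proof -
  have "g (moebius S_mat \<tau>) = cocycle_factor \<kappa> \<tau> S_mat *s (\<rho> S_mat *v g \<tau>)"
    using cusp S_mat_in_SL2Z \<tau> unfolding cusp_form_def upper_half_plane_def by blast
  moreover have "moebius S_mat \<tau> = - 1 / \<tau>" "cocycle_factor \<kappa> \<tau> S_mat = \<tau> powr of_real \<kappa>"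
    by (simp_all add: moebius_def S_mat_def cocycle_factor_def)
  ultimately show ?thesis by (simp add: matrix_vector_mult_def)
qed

context
  fixes \<kappa> :: real and \<rho> :: "int^2^2 \<Rightarrow> complex^'r^'r" and \<alpha> :: "'r \<Rightarrow> real"
    and g :: "complex \<Rightarrow> complex^'r" and a :: "'r \<Rightarrow> real \<Rightarrow> complex"
  assumes cusp: "cusp_form \<kappa> \<rho> \<alpha> g a" and \<alpha>: "\<And>k. 0 \<le> \<alpha> k"
begin

lemma component_holomorphic: "(\<lambda>\<tau>. g \<tau> $ k) holomorphic_on {z. Im z > 0}"
  using cusp unfolding cusp_form_def upper_half_plane_def by blast

lemma component_fourier_series: "fourier_series (\<alpha> k) (\<kappa> / 2) (a k) (\<lambda>\<tau>. g \<tau> $ k)"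
proof
  show "0 \<le> \<alpha> k" by (rule \<alpha>)
  show "((\<lambda>\<mu>. a k \<mu> * qpow \<tau> \<mu>) has_sum (g \<tau> $ k)) (exponents (\<alpha> k))" if "Im \<tau> > 0" for \<tau>
    using cusp that unfolding cusp_form_def upper_half_plane_def by blast
  show "\<exists>C. \<forall>\<mu>\<in>exponents (\<alpha> k). norm (a k \<mu>) \<le> C * \<mu> powr (\<kappa> / 2)"
    using cusp unfolding cusp_form_def by blast
qed

text \<open>
  At infinity the Fourier series gives the decay; near \<open>0\<close> the transformation under \<open>S\<close> carries it over from
  \<open>- 1 / w\<close>, whose imaginary part is at least \<open>\<delta> / \<bar>w\<bar>\<close> in the sector. The factor \<open>\<bar>w\<bar> powr - \<kappa>\<close> costs
  part of the rate.
\<close>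

lemma component_sector_decay: "sector_decay (\<lambda>\<tau>. g \<tau> $ k)"
  unfolding sector_decay_def
proof (intro allI impI)
  fix \<delta> :: real assume \<delta>: "\<delta> > 0"
  have "\<exists>\<mu>0. \<mu>0 > 0 \<and> (\<forall>\<mu>\<in>exponents (\<alpha> j). \<mu>0 \<le> \<mu>)" for j
    using exponents_lower_bound[OF \<alpha>[of j]] by blast
  then have "\<forall>j. \<exists>\<mu>0. \<mu>0 > 0 \<and> (\<forall>\<mu>\<in>exponents (\<alpha> j). \<mu>0 \<le> \<mu>)" by (rule allI)
  from choice[OF this] obtain m where m: "\<And>j. m j > 0" "\<And>j. \<forall>\<mu>\<in>exponents (\<alpha> j). m j \<le> \<mu>"
    by blast
  define \<mu>0 where "\<mu>0 = Min (range m)"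
  have \<mu>0: "\<mu>0 > 0" using m(1) by (auto simp: \<mu>0_def)
  have \<mu>0_le: "\<forall>\<mu>\<in>exponents (\<alpha> j). \<mu>0 \<le> \<mu>" for j
  proof
    fix \<mu> assume "\<mu> \<in> exponents (\<alpha> j)"
    then have "m j \<le> \<mu>" using m(2) by blast
    moreover have "\<mu>0 \<le> m j" unfolding \<mu>0_def by (rule Min_le) auto
    ultimately show "\<mu>0 \<le> \<mu>" by linarith
  qed
  let ?P = "\<lambda>j C. C \<ge> 0 \<and> (\<forall>w. Im w \<ge> \<delta> \<longrightarrow> norm (g w $ j) \<le> C * exp (- (2 * pi * \<mu>0 * Im w)))"
  have "\<exists>C. ?P j C" for j
  proof -
    obtain C where "C \<ge> 0" "\<forall>w. Im w \<ge> \<delta> \<longrightarrow> norm (g w $ j) \<le> C * exp (- (2 * pi * \<mu>0 * Im w))"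
      by (rule fourier_series.exp_decay[OF component_fourier_series[of j] \<delta> \<mu>0_le[of j]])
    then show ?thesis by (intro exI[of _ C] conjI)
  qed
  then have "\<forall>j. \<exists>C. ?P j C" by (rule allI)
  from choice[OF this] obtain C where P: "\<forall>j. ?P j (C j)" by (rule exE)
  have C: "\<And>j. C j \<ge> 0"
    "\<And>j w. Im w \<ge> \<delta> \<Longrightarrow> norm (g w $ j) \<le> C j * exp (- (2 * pi * \<mu>0 * Im w))"
    using P by simp_all
  define c where "c = 2 * pi * \<mu>0 * \<delta>"
  have c: "c > 0" using \<mu>0 \<delta> by (simp add: c_def)
  then have "c / 4 > 0" by simp
  then obtain D where D: "D \<ge> 0" "\<And>r. r > 0 \<Longrightarrow> r powr (- \<kappa>) \<le> D * exp (c / 4 * (r + 1 / r))"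
    using powr_le_exp[of "c / 4" "- \<kappa>"] by blast
  define E where "E = (\<Sum>j\<in>UNIV. norm (\<rho> S_mat $ k $ j) * C j)"
  have E: "E \<ge> 0" unfolding E_def using C(1) by (intro sum_nonneg mult_nonneg_nonneg) auto
  have "norm (g w $ k) \<le> (C k + D * E) * exp (- (c / 4 * (norm w + 1 / norm w)))"
    if w0: "w \<noteq> 0" and w: "Im w \<ge> \<delta> * norm w" for w
  proof -
    let ?r = "norm w"
    have r: "?r > 0" using w0 by simp
    have Imw: "Im w > 0" using w r \<delta> by (smt (verit) mult_pos_pos)
    let ?e = "exp (- (c / 4 * (?r + 1 / ?r)))"
    show ?thesis
    proof (cases "?r \<ge> 1")
      case True
      then have "\<delta> * 1 \<le> \<delta> * ?r" using \<delta> by (intro mult_left_mono) auto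
      then have "norm (g w $ k) \<le> C k * exp (- (2 * pi * \<mu>0 * Im w))" using w by (intro C(2)) auto
      also have "\<dots> \<le> C k * ?e"
      proof -
        have "1 / ?r \<le> 1" using True r by (simp add: divide_le_eq)
        then have "c / 4 * (?r + 1 / ?r) \<le> c / 4 * (4 * ?r)" using True c by (intro mult_left_mono) auto
        also have "\<dots> = 2 * pi * \<mu>0 * (\<delta> * ?r)" by (simp add: c_def)
        also have "\<dots> \<le> 2 * pi * \<mu>0 * Im w" using w \<mu>0 by (intro mult_left_mono) auto
        finally show ?thesis using C(1) by (intro mult_left_mono) auto
      qed
      also have "\<dots> \<le> (C k + D * E) * ?e" using D E by (intro mult_right_mono) auto
      finally show ?thesis .
    next
      case False
      let ?v = "- 1 / w"
      have Imv: "Im ?v = Im w / ?r ^ 2"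
        using w0 by (simp add: Im_divide cmod_power2)
      have v: "?v \<noteq> 0" "- 1 / ?v = w" using w0 by auto
      have Imv_ge: "\<delta> / ?r \<le> Im ?v"
      proof -
        have "\<delta> * ?r / ?r ^ 2 \<le> Im w / ?r ^ 2" using w by (intro divide_right_mono) auto
        then show ?thesis unfolding Imv using r by (simp add: power2_eq_square)
      qed
      have "\<delta> \<le> \<delta> / ?r" using False r \<delta> by (simp add: le_divide_eq)
      then have Imv_ge': "\<delta> \<le> Im ?v" using Imv_ge by linarith
      then have Imv0: "Im ?v > 0" using \<delta> by linarith
      have ex: "exp (- (2 * pi * \<mu>0 * Im ?v)) \<le> exp (- (c / 2 * (?r + 1 / ?r)))"
      proof -
        have "1 \<le> 1 / ?r" using False r by (simp add: le_divide_eq)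
        then have "?r + 1 / ?r \<le> 2 * (1 / ?r)" using False by linarith
        then have "c / 2 * (?r + 1 / ?r) \<le> c / 2 * (2 * (1 / ?r))" using c by (intro mult_left_mono) auto
        also have "\<dots> = 2 * pi * \<mu>0 * (\<delta> / ?r)" by (simp add: c_def)
        also have "\<dots> \<le> 2 * pi * \<mu>0 * Im ?v" using Imv_ge \<mu>0 by (intro mult_left_mono) auto
        finally show ?thesis by (simp only: exp_le_cancel_iff neg_le_iff_le)
      qed
      have "g w $ k = ?v powr of_real \<kappa> * (\<Sum>j\<in>UNIV. \<rho> S_mat $ k $ j * g ?v $ j)"
        using cusp_form_S_transform[OF cusp Imv0, of k] unfolding v(2) .
      moreover have "norm (?v powr of_real \<kappa>) = ?r powr (- \<kappa>)"
        unfolding norm_powr_of_real using r by (simp add: norm_divide powr_def ln_div)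
      ultimately have "norm (g w $ k) = ?r powr (- \<kappa>) * norm (\<Sum>j\<in>UNIV. \<rho> S_mat $ k $ j * g ?v $ j)"
        by (simp only: norm_mult)
      also have "\<dots> \<le> (D * exp (c / 4 * (?r + 1 / ?r))) * (E * exp (- (c / 2 * (?r + 1 / ?r))))"
      proof (intro mult_mono D(2)[OF r])
        have "norm (\<Sum>j\<in>UNIV. \<rho> S_mat $ k $ j * g ?v $ j)
            \<le> (\<Sum>j\<in>UNIV. norm (\<rho> S_mat $ k $ j) * (C j * exp (- (c / 2 * (?r + 1 / ?r)))))"
        proof (rule sum_norm_le)
          fix j
          have "norm (g ?v $ j) \<le> C j * exp (- (2 * pi * \<mu>0 * Im ?v))" using Imv_ge' by (rule C(2))
          also have "\<dots> \<le> C j * exp (- (c / 2 * (?r + 1 / ?r)))" using ex C(1) by (intro mult_left_mono) auto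
          finally have "norm (\<rho> S_mat $ k $ j) * norm (g ?v $ j)
              \<le> norm (\<rho> S_mat $ k $ j) * (C j * exp (- (c / 2 * (?r + 1 / ?r))))"
            by (rule mult_left_mono) simp
          then show "norm (\<rho> S_mat $ k $ j * g ?v $ j)
              \<le> norm (\<rho> S_mat $ k $ j) * (C j * exp (- (c / 2 * (?r + 1 / ?r))))"
            by (simp only: norm_mult)
        qed
        then show "norm (\<Sum>j\<in>UNIV. \<rho> S_mat $ k $ j * g ?v $ j) \<le> E * exp (- (c / 2 * (?r + 1 / ?r)))"
          unfolding E_def sum_distrib_right by (simp only: mult.assoc)
      qed (use D(1) in auto)
      also have "\<dots> = D * E * ?e"
      proof -
        have "exp (c / 4 * (?r + 1 / ?r)) * exp (- (c / 2 * (?r + 1 / ?r))) = ?e"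
          unfolding exp_add[symmetric] by (intro arg_cong[of _ _ exp]) (simp add: field_simps)
        then show ?thesis by (metis mult.assoc mult.left_commute)
      qed
      also have "\<dots> \<le> (C k + D * E) * ?e" using C(1) by (intro mult_right_mono) auto
      finally show ?thesis .
    qed
  qed
  moreover have "C k + D * E \<ge> 0" using C(1) D E by simp
  ultimately show "\<exists>C\<ge>0. \<exists>c>0. \<forall>w. w \<noteq> 0 \<longrightarrow> Im w \<ge> \<delta> * norm w \<longrightarrow>
     norm (g w $ k) \<le> C * exp (- (c * (norm w + 1 / norm w)))"
    using \<open>c / 4 > 0\<close> by blast
qed

definition weighted :: "'r \<Rightarrow> complex \<Rightarrow> complex" where
  "weighted k w = g w $ k * w powr of_real (- (2 - \<kappa>))"

lemma decaying_weighted: "decaying (weighted k)"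
  unfolding weighted_def[abs_def]
  by unfold_locales (intro holomorphic_mult_powr component_holomorphic sector_decay_mult_powr component_sector_decay)+

text \<open>
  With this constant, \<open>asymptotic_coeff\<close> is \<open>borel_constant\<close> times \<open>decaying.coeff\<close>. The power of \<open>\<i>\<close> is the
  one left over when the moments along the imaginary axis are written as integrals in \<open>w = \<i> r\<close>.
\<close>

definition borel_constant :: complex where
  "borel_constant = of_real (sin (pi * (\<kappa> - 1)) / pi * (2 * pi) powr (\<kappa> - 1)) * cis ((1 - \<kappa>) * (pi / 2))"

text \<open>
  The substitution \<open>y = 1 / r\<close> and the transformation under \<open>S\<close> at \<open>\<i> / r\<close> eliminate the matrix \<open>\<rho>(S)\<close>, and
  with it the other components of the form.
\<close>

lemma S_matrix_moment:
  "(\<Sum>j\<in>UNIV. \<rho> S_mat $ k $ j * (\<integral>y. g (\<i> * of_real y) $ j * of_real y ^ l \<partial>half_line))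
    = cis ((1 - 2 * \<kappa> + real l) * (pi / 2)) * decaying.moment (weighted k) l"
proof -
  let ?f = "\<lambda>y. (\<Sum>j\<in>UNIV. \<rho> S_mat $ k $ j * (g (\<i> * of_real y) $ j * of_real y ^ l))"
  have half: "- pi < pi / 2" "pi / 2 < pi" using pi_gt_zero by linarith+
  have cis_half: "cis (pi / 2) = \<i>" by simp
  have cont: "continuous_on {0<..} (\<lambda>y. g (\<i> * of_real y) $ j)" for j
    by (rule continuous_on_compose2[OF holomorphic_on_imp_continuous_on[OF component_holomorphic]])
       (auto intro!: continuous_intros)
  have int: "integrable half_line (\<lambda>y. \<rho> S_mat $ k $ j * (g (\<i> * of_real y) $ j * of_real y ^ l))" for j
  proof -
    have "integrable half_line (\<lambda>y. g (\<i> * of_real y) $ j * of_real y ^ l)"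
    proof (rule Bochner_Integration.integrable_bound)
      show "integrable half_line (\<lambda>y. norm (g (\<i> * of_real y) $ j) * y powr real l)"
        by (intro integrable_imaginary_axis component_sector_decay component_holomorphic)
      show "(\<lambda>y. g (\<i> * of_real y) $ j * of_real y ^ l) \<in> borel_measurable half_line"
        by (intro measurable_half_line continuous_on_mult cont continuous_intros)
      show "AE y in half_line. norm (g (\<i> * of_real y) $ j * of_real y ^ l)
          \<le> norm (norm (g (\<i> * of_real y) $ j) * y powr real l)"
        by (intro AE_I2) (simp add: norm_mult norm_power powr_realpow)
    qed
    then show ?thesis by (rule integrable_mult_right)
  qed
  have contf: "continuous_on {0<..} ?f"
    by (intro continuous_on_sum continuous_on_mult cont continuous_intros)
  have intf: "integrable half_line ?f" by (rule Bochner_Integration.integrable_sum[OF int])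
  have "(\<Sum>j\<in>UNIV. \<rho> S_mat $ k $ j * (\<integral>y. g (\<i> * of_real y) $ j * of_real y ^ l \<partial>half_line))
      = (\<integral>y. ?f y \<partial>half_line)"
    unfolding Bochner_Integration.integral_sum[OF int] integral_mult_right_zero ..
  moreover have "(\<integral>y. ?f y \<partial>half_line) = (\<integral>r. ?f (1 / r) / of_real (r ^ 2) \<partial>half_line)"
    by (rule half_line_inverse[OF contf intf])
  moreover have "(\<integral>r. ?f (1 / r) / of_real (r ^ 2) \<partial>half_line)
      = (\<integral>r. cis ((1 - 2 * \<kappa> + real l) * (pi / 2)) *
          (weighted k (\<i> * of_real r) / (\<i> * of_real r) ^ l * \<i>) \<partial>half_line)"
  proof (rule Bochner_Integration.integral_cong[OF refl])
    fix r assume "r \<in> space half_line"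
    then have r: "r > 0" by simp
    let ?y = "\<i> * of_real (1 / r)"
    have Imy: "Im ?y > 0" using r by simp
    have y0: "?y \<noteq> 0" using r by simp
    have ycis: "?y = of_real (1 / r) * cis (pi / 2)" unfolding cis_half by (rule mult.commute)
    have rcis: "\<i> * of_real r = of_real r * cis (pi / 2)" unfolding cis_half by (rule mult.commute)
    have inv: "- 1 / ?y = \<i> * of_real r" using r by (simp add: field_simps)
    have y_powr: "?y powr of_real \<kappa> = of_real (r powr (- \<kappa>)) * cis (\<kappa> * (pi / 2))"
    proof -
      have "(1 / r) powr \<kappa> = r powr (- \<kappa>)" using r by (simp add: powr_def ln_div)
      then show ?thesis unfolding ycis using powr_of_real_cis[of "1 / r", OF _ half, of \<kappa>] r by simp
    qed
    have r_powr: "(\<i> * of_real r) powr of_real (- (2 - \<kappa>))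
        = of_real (r powr (\<kappa> - 2)) * cis ((\<kappa> - 2) * (pi / 2))"
      unfolding rcis using powr_of_real_cis[OF r half, of "- (2 - \<kappa>)"] by simp
    have "g (\<i> * of_real r) $ k = ?y powr of_real \<kappa> * (\<Sum>j\<in>UNIV. \<rho> S_mat $ k $ j * g ?y $ j)"
      using cusp_form_S_transform[OF cusp Imy, of k] unfolding inv .
    then have G: "g (\<i> * of_real r) $ k = of_real (r powr (- \<kappa>)) * cis (\<kappa> * (pi / 2)) * (\<Sum>j\<in>UNIV. \<rho> S_mat $ k $ j * g ?y $ j)"
      unfolding y_powr .
    let ?S = "\<Sum>j\<in>UNIV. \<rho> S_mat $ k $ j * g ?y $ j"
    have "?f (1 / r) / of_real (r ^ 2) = ?S * (of_real (1 / r) ^ l / of_real (r ^ 2))"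
      unfolding sum_distrib_right sum_divide_distrib by (intro sum.cong refl) (simp add: mult.assoc)
    also have "of_real (1 / r) ^ l / of_real (r ^ 2) = (of_real (r powr (- 2 - real l)) :: complex)"
    proof -
      have "r powr (- 2 - real l) = r powr (- real (l + 2))"
        by (rule arg_cong[of _ _ "\<lambda>x. r powr x"]) simp
      also have "\<dots> = inverse (r ^ (l + 2))" unfolding powr_minus using r by (simp only: powr_realpow)
      also have "\<dots> = (1 / r) ^ l / r ^ 2" by (simp add: power_add power_one_over divide_inverse power_inverse power2_eq_square)
      finally show ?thesis by (simp only: of_real_divide of_real_power)
    qed
    finally have lhs: "?f (1 / r) / of_real (r ^ 2) = ?S * of_real (r powr (- 2 - real l))" .
    have il: "(\<i> * of_real r) ^ l = of_real (r powr real l) * cis (real l * (pi / 2))"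
      unfolding rcis power_mult_distrib Complex.DeMoivre[symmetric] using r by (simp only: powr_realpow of_real_power)
    have ii: "\<i> = cis (pi / 2)" by simp
    have "weighted k (\<i> * of_real r) / (\<i> * of_real r) ^ l * \<i>
        = ?S * (of_real (r powr (- \<kappa>)) * of_real (r powr (\<kappa> - 2)) / of_real (r powr real l)) *
          (cis (\<kappa> * (pi / 2)) * cis ((\<kappa> - 2) * (pi / 2)) / cis (real l * (pi / 2)) * cis (pi / 2))"
      unfolding weighted_def G r_powr il cis_half by (simp add: mult_ac)
    also have "of_real (r powr (- \<kappa>)) * of_real (r powr (\<kappa> - 2)) / of_real (r powr real l)
        = (of_real (r powr (- 2 - real l)) :: complex)"
      using r by (simp add: powr_add[symmetric] powr_diff[symmetric] of_real_mult[symmetric] of_real_divide[symmetric]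
          del: of_real_mult of_real_divide)
    also have "cis (\<kappa> * (pi / 2)) * cis ((\<kappa> - 2) * (pi / 2)) / cis (real l * (pi / 2)) * cis (pi / 2)
        = cis (- ((1 - 2 * \<kappa> + real l) * (pi / 2)))"
      unfolding cis_mult cis_divide by (intro arg_cong[of _ _ cis]) (simp add: field_simps)
    finally have rhs: "weighted k (\<i> * of_real r) / (\<i> * of_real r) ^ l * \<i>
        = ?S * of_real (r powr (- 2 - real l)) * cis (- ((1 - 2 * \<kappa> + real l) * (pi / 2)))" .
    have "cis ((1 - 2 * \<kappa> + real l) * (pi / 2)) * cis (- ((1 - 2 * \<kappa> + real l) * (pi / 2))) = 1"
      unfolding cis_mult by simp
    then have "cis ((1 - 2 * \<kappa> + real l) * (pi / 2)) * (?S * of_real (r powr (- 2 - real l)) *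
        cis (- ((1 - 2 * \<kappa> + real l) * (pi / 2)))) = ?S * of_real (r powr (- 2 - real l))"
      by (simp only: mult.left_commute[of "cis ((1 - 2 * \<kappa> + real l) * (pi / 2))"] mult_1_right)
    then show "?f (1 / r) / of_real (r ^ 2) = cis ((1 - 2 * \<kappa> + real l) * (pi / 2)) *
        (weighted k (\<i> * of_real r) / (\<i> * of_real r) ^ l * \<i>)"
      unfolding lhs rhs by (rule sym)
  qed
  ultimately show ?thesis
    unfolding decaying.moment_def[OF decaying_weighted] ray_integral_def integral_mult_right_zero by (simp only:)
qed

lemma asymptotic_coeff_eq:
  "asymptotic_coeff \<kappa> \<rho> \<alpha> a l $ k = borel_constant * decaying.coeff (weighted k) (2 - \<kappa>) l"
proof -
  have half: "- pi < pi / 2" "pi / 2 < pi" using pi_gt_zero by linarith+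
  have L: "L_function (\<alpha> j) (a j) (of_nat (l + 1)) = of_real ((2 * pi) ^ (l + 1)) / fact l *
      (\<integral>y. g (\<i> * of_real y) $ j * of_real y ^ l \<partial>half_line)" for j
    by (rule fourier_series.L_function_nat[OF component_fourier_series component_sector_decay component_holomorphic])
  have "(\<Sum>j\<in>UNIV. \<rho> S_mat $ k $ j * L_function (\<alpha> j) (a j) (of_nat (l + 1)))
      = of_real ((2 * pi) ^ (l + 1)) / fact l *
        (\<Sum>j\<in>UNIV. \<rho> S_mat $ k $ j * (\<integral>y. g (\<i> * of_real y) $ j * of_real y ^ l \<partial>half_line))"
    unfolding L sum_distrib_left by (intro sum.cong refl) (rule mult.left_commute)
  then have sum: "(\<Sum>j\<in>UNIV. \<rho> S_mat $ k $ j * L_function (\<alpha> j) (a j) (of_nat (l + 1)))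
      = of_real ((2 * pi) ^ (l + 1)) / fact l *
        (cis ((1 - 2 * \<kappa> + real l) * (pi / 2)) * decaying.moment (weighted k) l)"
    unfolding S_matrix_moment .
  have ik: "\<i> powr of_real \<kappa> = cis (\<kappa> * (pi / 2))"
    using powr_of_real_cis[of 1, OF _ half, of \<kappa>] by simp
  have il: "(2 * of_real pi * \<i>) ^ l = of_real ((2 * pi) ^ l) * cis (real l * (pi / 2))"
  proof -
    have "cis (real l * (pi / 2)) = \<i> ^ l" by (simp only: Complex.DeMoivre[symmetric] cis_pi_half)
    then show ?thesis by (simp add: power_mult_distrib)
  qed
  have c: "cis (\<kappa> * (pi / 2)) * cis ((1 - 2 * \<kappa> + real l) * (pi / 2)) = cis ((1 - \<kappa>) * (pi / 2)) * cis (real l * (pi / 2))"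
    unfolding cis_mult by (intro arg_cong[of _ _ cis]) (simp add: field_simps)
  have p: "(2 * pi) powr (\<kappa> - 1) = (2 * pi) powr (\<kappa> - 2) * (2 * pi)"
  proof -
    have "(2 * pi) powr (\<kappa> - 1) = (2 * pi) powr ((\<kappa> - 2) + 1)" by simp
    then show ?thesis by (simp only: powr_add) simp
  qed
  have z: "cis (real l * (pi / 2)) \<noteq> 0" "of_real ((2 * pi) ^ l) \<noteq> (0 :: complex)" by simp_all
  let ?s = "of_real (sin (pi * (\<kappa> - 1)) / pi) :: complex" and ?p = "of_real ((2 * pi) powr (\<kappa> - 2)) :: complex"
    and ?Gam = "of_real (Gamma (2 - \<kappa> + real l)) :: complex" and ?M = "decaying.moment (weighted k) l"
  have "asymptotic_coeff \<kappa> \<rho> \<alpha> a l $ k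
      = cis (\<kappa> * (pi / 2)) * (?s * ?p) * ?Gam / (of_real ((2 * pi) ^ l) * cis (real l * (pi / 2))) *
        (of_real ((2 * pi) ^ (l + 1)) / fact l * (cis ((1 - 2 * \<kappa> + real l) * (pi / 2)) * ?M))"
    unfolding asymptotic_coeff_def sum[symmetric] ik[symmetric] il[symmetric]
    by (simp add: matrix_vector_mult_def)
  also have "\<dots> = (cis (\<kappa> * (pi / 2)) * cis ((1 - 2 * \<kappa> + real l) * (pi / 2))) / cis (real l * (pi / 2)) *
      (of_real ((2 * pi) ^ (l + 1)) / of_real ((2 * pi) ^ l)) * (?s * ?p) * (?Gam / fact l * ?M)"
    by (simp only: divide_inverse inverse_mult_distrib mult_ac)
  also have "(cis (\<kappa> * (pi / 2)) * cis ((1 - 2 * \<kappa> + real l) * (pi / 2))) / cis (real l * (pi / 2)) = cis ((1 - \<kappa>) * (pi / 2))"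
    unfolding c using z by simp
  also have "of_real ((2 * pi) ^ (l + 1)) / of_real ((2 * pi) ^ l) = (of_real (2 * pi) :: complex)"
    using z by simp
  also have "cis ((1 - \<kappa>) * (pi / 2)) * of_real (2 * pi) * (?s * ?p) * (?Gam / fact l * ?M)
      = borel_constant * (?Gam / fact l * ?M)"
    unfolding borel_constant_def p of_real_mult by (simp only: mult_ac)
  finally show ?thesis unfolding decaying.coeff_def[OF decaying_weighted] .
qed

end

section \<open>Lateral sums, median sum and asymptotic expansion\<close>

lemma Re_cis_divide:
  "Re (cis \<theta> / \<tau>) = (cos \<theta> * Re \<tau> + sin \<theta> * Im \<tau>) / (norm \<tau>) ^ 2"
  by (simp add: Re_divide cmod_power2)

lemma Re_cis_right: "Re (cis (pi / 2 + \<epsilon>) / \<tau>) = (Im \<tau> * cos \<epsilon> - Re \<tau> * sin \<epsilon>) / (norm \<tau>) ^ 2"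
  unfolding Re_cis_divide by (simp add: cos_add sin_add mult.commute)

lemma Re_cis_left: "Re (cis (pi / 2 - \<epsilon>) / \<tau>) = (Im \<tau> * cos \<epsilon> + Re \<tau> * sin \<epsilon>) / (norm \<tau>) ^ 2"
  unfolding Re_cis_divide by (simp add: cos_diff sin_diff mult.commute)

lemma abs_mult_sin_bounds:
  fixes x \<epsilon> :: real
  assumes "0 < \<epsilon>" "\<epsilon> < pi / 2"
  shows "x * sin \<epsilon> \<le> \<bar>x\<bar> * sin \<epsilon>" "- (\<bar>x\<bar> * sin \<epsilon>) \<le> x * sin \<epsilon>"
proof -
  have s: "sin \<epsilon> \<ge> 0" using assms by (intro sin_ge_zero) auto
  then show "x * sin \<epsilon> \<le> \<bar>x\<bar> * sin \<epsilon>" by (intro mult_right_mono) auto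
  have "- \<bar>x\<bar> * sin \<epsilon> \<le> x * sin \<epsilon>" using s by (intro mult_right_mono) auto
  then show "- (\<bar>x\<bar> * sin \<epsilon>) \<le> x * sin \<epsilon>" by simp
qed

text \<open>
  The sector \<open>cone \<epsilon>\<close> is exactly the set of \<open>\<tau>\<close> for which both Laplace integrals, in the directions
  \<open>\<pi>/2 \<plusminus> \<epsilon>\<close>, converge.
\<close>

lemma cone_directions:
  assumes \<epsilon>: "0 < \<epsilon>" "\<epsilon> < pi / 2" and \<tau>: "\<tau> \<in> cone \<epsilon>"
  shows "Re (cis (pi / 2 + \<epsilon>) / \<tau>) > 0" "Re (cis (pi / 2 - \<epsilon>) / \<tau>) > 0"
proof -
  have "Im \<tau> > 0" by (rule cone_Im_pos[OF \<epsilon> \<tau>])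
  then have "norm \<tau> ^ 2 > 0" by auto
  moreover have "Im \<tau> * cos \<epsilon> - Re \<tau> * sin \<epsilon> > 0" "Im \<tau> * cos \<epsilon> + Re \<tau> * sin \<epsilon> > 0"
    using abs_mult_sin_bounds[OF \<epsilon>, of "Re \<tau>"] \<tau> unfolding cone_def by simp_all
  ultimately show "Re (cis (pi / 2 + \<epsilon>) / \<tau>) > 0" "Re (cis (pi / 2 - \<epsilon>) / \<tau>) > 0"
    unfolding Re_cis_right Re_cis_left by (simp_all only: zero_less_divide_iff) simp_all
qed

lemma cone_half:
  assumes \<epsilon>: "0 < \<epsilon>" "\<epsilon> < pi / 2" and \<tau>: "\<tau> \<in> cone \<epsilon>"
  shows "\<tau> \<in> cone (\<epsilon> / 2)"
proof -
  have c: "cos \<epsilon> > 0" "cos (\<epsilon> / 2) > 0" using \<epsilon> by (auto intro!: cos_gt_zero)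
  have "sin (\<epsilon> - \<epsilon> / 2) \<ge> 0" using \<epsilon> by (intro sin_ge_zero) auto
  then have "sin (\<epsilon> / 2) * cos \<epsilon> \<le> sin \<epsilon> * cos (\<epsilon> / 2)" unfolding sin_diff by (simp add: mult.commute)
  then have "\<bar>Re \<tau>\<bar> * (sin (\<epsilon> / 2) * cos \<epsilon>) \<le> \<bar>Re \<tau>\<bar> * (sin \<epsilon> * cos (\<epsilon> / 2))"
    by (rule mult_left_mono) simp
  also have "\<dots> = (\<bar>Re \<tau>\<bar> * sin \<epsilon>) * cos (\<epsilon> / 2)" by simp
  also have "\<dots> < (Im \<tau> * cos \<epsilon>) * cos (\<epsilon> / 2)"
    using \<tau> c by (intro mult_strict_right_mono) (auto simp: cone_def)
  finally have "(\<bar>Re \<tau>\<bar> * sin (\<epsilon> / 2)) * cos \<epsilon> < (Im \<tau> * cos (\<epsilon> / 2)) * cos \<epsilon>" by (simp add: mult_ac)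
  then show ?thesis using c by (simp add: cone_def)
qed

text \<open>
  Moving \<open>\<xi>\<close> from the imaginary axis by \<open>\<epsilon>\<close> lets the ray for \<open>w\<close> keep the angle \<open>\<epsilon> / 2\<close> from the real axis:
  the argument of \<open>\<xi> / w\<close> is then \<open>\<plusminus>(\<pi>/2 + \<epsilon>/2)\<close>.
\<close>

lemma ray_directions:
  assumes \<epsilon>: "0 < \<epsilon>" "\<epsilon> < pi / 2"
  shows "Im (cis (\<epsilon> / 2)) > 0" "norm (cis (\<epsilon> / 2)) = 1" "Re (cis (pi / 2 + \<epsilon>) / cis (\<epsilon> / 2)) < 0"
    "Im (cis (pi - \<epsilon> / 2)) > 0" "norm (cis (pi - \<epsilon> / 2)) = 1" "Re (cis (pi / 2 - \<epsilon>) / cis (pi - \<epsilon> / 2)) < 0"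
proof -
  have s: "sin (\<epsilon> / 2) > 0" using \<epsilon> by (intro sin_gt_zero) auto
  have "cos (pi / 2 + \<epsilon> - \<epsilon> / 2) = cos (pi / 2 + \<epsilon> / 2)" by (intro arg_cong[of _ _ cos]) simp
  also have "\<dots> = - sin (\<epsilon> / 2)" by (simp add: cos_add)
  finally show "Re (cis (pi / 2 + \<epsilon>) / cis (\<epsilon> / 2)) < 0" unfolding cis_divide using s by simp
  have "cos (pi / 2 - \<epsilon> - (pi - \<epsilon> / 2)) = cos (- (pi / 2 + \<epsilon> / 2))"
    by (intro arg_cong[of _ _ cos]) (simp add: field_simps)
  also have "\<dots> = - sin (\<epsilon> / 2)" unfolding cos_minus by (simp add: cos_add)
  finally show "Re (cis (pi / 2 - \<epsilon>) / cis (pi - \<epsilon> / 2)) < 0" unfolding cis_divide using s by simp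
qed (use \<epsilon> in \<open>auto intro!: sin_gt_zero\<close>)

lemma ray_integral_mult:
  assumes "\<And>t. t > 0 \<Longrightarrow> c * f (\<sigma> * of_real t) = h (\<sigma> * of_real t)"
  shows "c * ray_integral f \<sigma> = ray_integral h \<sigma>"
  unfolding ray_integral_def integral_mult_right_zero[symmetric]
proof (rule Bochner_Integration.integral_cong[OF refl])
  fix t assume "t \<in> space half_line"
  then have "c * f (\<sigma> * of_real t) = h (\<sigma> * of_real t)" using assms by simp
  then show "c * (f (\<sigma> * of_real t) * \<sigma>) = h (\<sigma> * of_real t) * \<sigma>"
    by (simp only: mult.assoc[symmetric])
qed

context
  fixes \<kappa> :: real and \<rho> :: "int^2^2 \<Rightarrow> complex^'r^'r" and \<alpha> :: "'r \<Rightarrow> real"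
    and g :: "complex \<Rightarrow> complex^'r" and a :: "'r \<Rightarrow> real \<Rightarrow> complex"
  assumes cusp: "cusp_form \<kappa> \<rho> \<alpha> g a" and \<alpha>: "\<And>k. 0 \<le> \<alpha> k" and \<kappa>: "\<kappa> \<in> {1/2, 3/2}"
begin

abbreviation (input) K :: complex where "K \<equiv> borel_constant \<kappa>"
abbreviation (input) W :: "'r \<Rightarrow> complex \<Rightarrow> complex" where "W k \<equiv> weighted \<kappa> g k"

text \<open>
  The lateral sum in direction \<open>\<theta>\<close>, with the Borel transform continued by means of the ray \<open>\<sigma>\<close>.
\<close>

definition lateral :: "'r \<Rightarrow> real \<Rightarrow> complex \<Rightarrow> complex \<Rightarrow> complex" where
  "lateral k \<theta> \<sigma> \<tau> = \<tau> powr (- of_real (2 - \<kappa>)) *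
    (K * (\<integral>t. exp (- (of_real t * cis \<theta>) / \<tau>) *
      decaying.borel_transform (W k) (2 - \<kappa>) \<sigma> (of_real t * cis \<theta>) * cis \<theta> \<partial>half_line))"

lemma \<eta>_pos: "2 - \<kappa> > 0" and \<eta>_cases: "2 - \<kappa> \<in> {1/2, 3/2}"
  using \<kappa> by auto

lemma decaying_W: "decaying (W k)"
  by (rule decaying_weighted[OF cusp \<alpha>])

lemma coeff_W: "asymptotic_coeff \<kappa> \<rho> \<alpha> a l $ k = K * decaying.coeff (W k) (2 - \<kappa>) l"
  by (rule asymptotic_coeff_eq[OF cusp \<alpha>])

lemma has_borel_sum_lateral:
  assumes \<theta>: "0 < \<theta>" "\<theta> < pi" and \<sigma>: "Im \<sigma> > 0" "norm \<sigma> = 1" "Re (cis \<theta> / \<sigma>) < 0"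
    and \<tau>: "Re (cis \<theta> / \<tau>) > 0"
  shows "has_borel_sum (2 - \<kappa>) \<theta> (\<lambda>l. asymptotic_coeff \<kappa> \<rho> \<alpha> a l $ k) \<tau> (lateral k \<theta> \<sigma> \<tau>)"
  unfolding has_borel_sum_def
proof (intro exI[of _ "\<lambda>\<xi>. K * decaying.borel_transform (W k) (2 - \<kappa>) \<sigma> \<xi>"] conjI)
  let ?B = "decaying.borel_transform (W k) (2 - \<kappa>) \<sigma>"
  let ?I = "\<lambda>t. exp (- (of_real t * cis \<theta>) / \<tau>) * ?B (of_real t * cis \<theta>) * cis \<theta>"
  let ?J = "\<lambda>t. exp (- (of_real t * cis \<theta>) / \<tau>) * (K * ?B (of_real t * cis \<theta>)) * cis \<theta>"
  show "borel_continuation (2 - \<kappa>) \<theta> (\<lambda>l. asymptotic_coeff \<kappa> \<rho> \<alpha> a l $ k) (\<lambda>\<xi>. K * ?B \<xi>)"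
    unfolding coeff_W by (rule decaying.borel_continuation_borel_transform[OF decaying_W \<theta> \<sigma> \<eta>_pos])
  have eq: "?J = (\<lambda>t. K * ?I t)" by (rule ext) (simp only: mult_ac)
  have int: "integrable half_line ?I"
    by (rule decaying.integrable_laplace_borel[OF decaying_W \<eta>_pos \<theta> \<sigma> \<tau>])
  show "set_integrable lborel {0<..} ?J"
    unfolding eq integrable_half_line[symmetric] by (rule integrable_mult_right[OF int])
  show "lateral k \<theta> \<sigma> \<tau> = \<tau> powr (- of_real (2 - \<kappa>)) * (LINT t:{0<..}|lborel. ?J t)"
    unfolding eq integral_half_line[symmetric] integral_mult_right_zero lateral_def ..
qed

lemma lateral_eq_ray_integral:
  assumes \<theta>: "0 < \<theta>" "\<theta> < pi" and \<sigma>: "Im \<sigma> > 0" "norm \<sigma> = 1" "Re (cis \<theta> / \<sigma>) < 0"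
    and \<tau>: "Re (cis \<theta> / \<tau>) > 0"
    and branch: "\<And>t. t > 0 \<Longrightarrow> \<tau> powr of_real (- (2 - \<kappa>)) * ((\<sigma> * of_real t) powr of_real (- (2 - \<kappa>)) *
      (cis ((2 - \<kappa>) * \<theta>) * (cis \<theta> * (1 / \<tau> - 1 / (\<sigma> * of_real t))) powr of_real (- (2 - \<kappa>)))) = b (\<sigma> * of_real t)"
  shows "lateral k \<theta> \<sigma> \<tau> = K * of_real (Gamma (2 - \<kappa>)) * ray_integral (\<lambda>w. g w $ k * b w) \<sigma>"
proof -
  let ?h = "\<lambda>w. W k w * (cis ((2 - \<kappa>) * \<theta>) * (cis \<theta> * (1 / \<tau> - 1 / w)) powr of_real (- (2 - \<kappa>)))"
  have "\<tau> powr of_real (- (2 - \<kappa>)) * ray_integral ?h \<sigma> = ray_integral (\<lambda>w. g w $ k * b w) \<sigma>"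
  proof (rule ray_integral_mult)
    fix t :: real assume t: "t > 0"
    show "\<tau> powr of_real (- (2 - \<kappa>)) * ?h (\<sigma> * of_real t) = g (\<sigma> * of_real t) $ k * b (\<sigma> * of_real t)"
      unfolding branch[OF t, symmetric] weighted_def[OF cusp \<alpha>] by (simp only: mult_ac)
  qed
  moreover have "lateral k \<theta> \<sigma> \<tau> = \<tau> powr of_real (- (2 - \<kappa>)) * (K * (of_real (Gamma (2 - \<kappa>)) * ray_integral ?h \<sigma>))"
    unfolding lateral_def decaying.laplace_borel_eq_ray_integral[OF decaying_W \<eta>_pos \<theta> \<sigma> \<tau>] of_real_minus ..
  ultimately show ?thesis by (simp only: mult.assoc mult.left_commute[of "\<tau> powr of_real (- (2 - \<kappa>))"])
qed

text \<open>
  The median sum is the Eichler integral. The product of the constants is \<open>1\<close> by the reflection formula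
  for \<open>\<Gamma>(\<eta>) \<Gamma>(1 - \<eta>)\<close>; the factor \<open>2\<close> in \<open>two_ray_integral\<close> is the \<open>2\<close> of the mean.
\<close>

lemma lateral_average:
  assumes \<epsilon>: "0 < \<epsilon>" "\<epsilon> < pi / 2" and \<tau>: "\<tau> \<in> cone \<epsilon>"
  shows "eichler_integral \<kappa> \<alpha> a \<tau> $ k =
    (lateral k (pi / 2 + \<epsilon>) (cis (\<epsilon> / 2)) \<tau> + lateral k (pi / 2 - \<epsilon>) (cis (pi - \<epsilon> / 2)) \<tau>) / 2"
proof -
  let ?\<eta> = "2 - \<kappa>"
  have Im\<tau>: "Im \<tau> > 0" by (rule cone_Im_pos[OF \<epsilon> \<tau>])
  note dirs = cone_directions[OF \<epsilon> \<tau>] and rays = ray_directions[OF \<epsilon>]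
  have pos: "0 < \<epsilon> / 2" "\<epsilon> / 2 < pi / 2" "0 < pi / 2 + \<epsilon>" "pi / 2 + \<epsilon> < pi"
    "0 < pi / 2 - \<epsilon>" "pi / 2 - \<epsilon> < pi" using \<epsilon> by auto
  let ?R = "ray_integral (\<lambda>w. g w $ k * (w - \<tau>) powr of_real (- ?\<eta>)) (cis (\<epsilon> / 2))"
  let ?L = "ray_integral (\<lambda>w. g w $ k * (cis (- pi * ?\<eta>) * (- (w - \<tau>)) powr of_real (- ?\<eta>))) (cis (pi - \<epsilon> / 2))"
  have neg: "Re (cis \<theta> / (\<sigma> * of_real t)) < 0" if "Re (cis \<theta> / \<sigma>) < 0" "t > 0" for \<theta> \<sigma> and t :: real
  proof -
    have "cis \<theta> / (\<sigma> * of_real t) = (cis \<theta> / \<sigma>) / of_real t" by simp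
    then have "Re (cis \<theta> / (\<sigma> * of_real t)) = Re (cis \<theta> / \<sigma>) / t" by (simp only: Re_divide_of_real)
    then show ?thesis using that by (simp add: divide_neg_pos)
  qed
  have R: "lateral k (pi / 2 + \<epsilon>) (cis (\<epsilon> / 2)) \<tau> = K * of_real (Gamma ?\<eta>) * ?R"
    by (rule lateral_eq_ray_integral[OF pos(3,4) rays(1-3) dirs(1)],
        rule branch_right[OF Im\<tau> \<epsilon> dirs(1) _ mult.commute neg[OF rays(3)]])
  have L: "lateral k (pi / 2 - \<epsilon>) (cis (pi - \<epsilon> / 2)) \<tau> = K * of_real (Gamma ?\<eta>) * ?L"
    by (rule lateral_eq_ray_integral[OF pos(5,6) rays(4-6) dirs(2)],
        rule branch_left[OF Im\<tau> \<epsilon> dirs(2) _ mult.commute neg[OF rays(6)]])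
  let ?T = "\<lambda>\<mu>. a k \<mu> * qpow \<tau> \<mu> *
      (2 * of_real (Gamma (1 - ?\<eta>) * (2 * pi * \<mu>) powr (?\<eta> - 1)) * cis ((1 - ?\<eta>) * pi / 2))"
  have sum: "(?T has_sum (?R + ?L)) (exponents (\<alpha> k))"
    by (rule fourier_series.two_ray_integral[OF component_fourier_series[OF cusp \<alpha>]
          component_sector_decay[OF cusp \<alpha>] component_holomorphic[OF cusp \<alpha>] pos(1,2) cone_half[OF \<epsilon> \<tau>] \<eta>_cases])
  let ?c = "K * of_real (Gamma ?\<eta>) / 2"
  have c: "K * of_real (Gamma ?\<eta>) * (of_real (Gamma (1 - ?\<eta>) * (2 * pi) powr (?\<eta> - 1)) * cis ((1 - ?\<eta>) * pi / 2)) = 1"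
  proof -
    have s: "sin (pi * ?\<eta>) = sin (pi * (\<kappa> - 1))"
    proof -
      have "pi * ?\<eta> = pi - pi * (\<kappa> - 1)" by (simp add: algebra_simps)
      then show ?thesis by (simp only: sin_pi_minus)
    qed
    have "sin (pi * ?\<eta>) \<noteq> 0"
    proof -
      have "?\<eta> = 1/2 \<or> ?\<eta> = 3/2" using \<eta>_cases by simp
      then show ?thesis
      proof
        assume "?\<eta> = 1/2"
        then show ?thesis by (simp only:) simp
      next
        assume "?\<eta> = 3/2"
        moreover have "sin (pi * (3/2)) = - 1" using sin_3over2_pi by (simp add: mult.commute)
        ultimately show ?thesis by (simp only:)
      qed
    qed
    moreover have "Gamma ?\<eta> * Gamma (1 - ?\<eta>) = pi / sin (pi * ?\<eta>)"
    proof -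
      have "complex_of_real (Gamma ?\<eta> * Gamma (1 - ?\<eta>)) = Gamma (of_real ?\<eta>) * Gamma (1 - of_real ?\<eta>)"
        unfolding of_real_mult Gamma_complex_of_real[symmetric] by simp
      also have "\<dots> = complex_of_real (pi / sin (pi * ?\<eta>))"
        unfolding Gamma_reflection_complex of_real_divide of_real_mult[symmetric] sin_of_real ..
      finally show ?thesis by (simp only: of_real_eq_iff)
    qed
    moreover have "(2 * pi) powr (\<kappa> - 1) * (2 * pi) powr (?\<eta> - 1) = 1"
      by (simp add: powr_add[symmetric])
    moreover have "sin (pi * (\<kappa> - 1)) / pi * (2 * pi) powr (\<kappa> - 1) * Gamma ?\<eta> * (Gamma (1 - ?\<eta>) * (2 * pi) powr (?\<eta> - 1))
        = sin (pi * (\<kappa> - 1)) / pi * (Gamma ?\<eta> * Gamma (1 - ?\<eta>)) * ((2 * pi) powr (\<kappa> - 1) * (2 * pi) powr (?\<eta> - 1))"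
      by (simp only: mult_ac)
    ultimately have r: "sin (pi * (\<kappa> - 1)) / pi * (2 * pi) powr (\<kappa> - 1) * Gamma ?\<eta> * (Gamma (1 - ?\<eta>) * (2 * pi) powr (?\<eta> - 1)) = 1"
      unfolding s by simp
    have "cis ((1 - \<kappa>) * (pi / 2)) * cis ((1 - ?\<eta>) * pi / 2) = 1"
    proof -
      have "(1 - \<kappa>) * (pi / 2) + (1 - ?\<eta>) * pi / 2 = 0" by (simp add: field_simps)
      then show ?thesis unfolding cis_mult by simp
    qed
    moreover have "K * of_real (Gamma ?\<eta>) * (of_real (Gamma (1 - ?\<eta>) * (2 * pi) powr (?\<eta> - 1)) * cis ((1 - ?\<eta>) * pi / 2))
        = of_real (sin (pi * (\<kappa> - 1)) / pi * (2 * pi) powr (\<kappa> - 1) * Gamma ?\<eta> * (Gamma (1 - ?\<eta>) * (2 * pi) powr (?\<eta> - 1)))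
          * (cis ((1 - \<kappa>) * (pi / 2)) * cis ((1 - ?\<eta>) * pi / 2))"
      unfolding borel_constant_def[OF cusp \<alpha>] of_real_mult by (simp only: mult_ac)
    ultimately show ?thesis unfolding r by simp
  qed
  \<comment> \<open>The mean of the lateral sums is \<open>?c\<close> times the sum of the two ray integrals.\<close>
  have "((\<lambda>\<mu>. ?c * ?T \<mu>) has_sum (?c * (?R + ?L))) (exponents (\<alpha> k))"
    by (rule has_sum_cmult_right[OF sum])
  moreover have "?c * ?T \<mu> = of_real (\<mu> powr (1 - \<kappa>)) * a k \<mu> * qpow \<tau> \<mu>" if "\<mu> \<in> exponents (\<alpha> k)" for \<mu>
  proof -
    have e: "?\<eta> - 1 = 1 - \<kappa>" by simp
    have "(2 * pi * \<mu>) powr (?\<eta> - 1) = (2 * pi) powr (?\<eta> - 1) * \<mu> powr (1 - \<kappa>)"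
      unfolding powr_mult e ..
    then have "?c * ?T \<mu> = (K * of_real (Gamma ?\<eta>) *
        (of_real (Gamma (1 - ?\<eta>) * (2 * pi) powr (?\<eta> - 1)) * cis ((1 - ?\<eta>) * pi / 2))) *
        (of_real (\<mu> powr (1 - \<kappa>)) * a k \<mu> * qpow \<tau> \<mu>)"
      by simp
    then show ?thesis unfolding c by simp
  qed
  ultimately have "((\<lambda>\<mu>. of_real (\<mu> powr (1 - \<kappa>)) * a k \<mu> * qpow \<tau> \<mu>) has_sum (?c * (?R + ?L))) (exponents (\<alpha> k))"
    by (rule has_sum_cong[THEN iffD1, rotated])
  then have "eichler_integral \<kappa> \<alpha> a \<tau> $ k = ?c * (?R + ?L)"
    unfolding eichler_integral_def by (simp add: infsumI)
  then show ?thesis unfolding R L by (simp add: algebra_simps add_divide_distrib)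
qed

lemma has_median_sum_eichler:
  assumes \<tau>: "Im \<tau> > 0"
  shows "has_median_sum (2 - \<kappa>) (pi / 2) (\<lambda>l. asymptotic_coeff \<kappa> \<rho> \<alpha> a l $ k) \<tau> (eichler_integral \<kappa> \<alpha> a \<tau> $ k)"
  unfolding has_median_sum_def
proof (intro conjI)
  show "Re (cis (- (pi / 2)) * \<tau>) > 0" using \<tau> by simp
  have "((\<lambda>\<epsilon>. Im \<tau> * cos \<epsilon> - \<bar>Re \<tau>\<bar> * sin \<epsilon>) \<longlongrightarrow> Im \<tau> * cos 0 - \<bar>Re \<tau>\<bar> * sin 0) (at_right 0)"
    by (intro tendsto_intros)
  then have "\<forall>\<^sub>F \<epsilon> in at_right 0. Im \<tau> * cos \<epsilon> - \<bar>Re \<tau>\<bar> * sin \<epsilon> > 0"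
    using \<tau> by (intro order_tendstoD(1)) auto
  moreover have "\<forall>\<^sub>F \<epsilon> in at_right (0::real). \<epsilon> < pi / 2"
    by (rule order_tendstoD(2)[OF tendsto_ident_at]) simp
  moreover have "\<forall>\<^sub>F \<epsilon> in at_right (0::real). \<epsilon> > 0"
    by (rule eventually_at_right_less)
  ultimately show "\<forall>\<^sub>F \<epsilon> in at_right 0. \<exists>s_plus s_minus.
      has_borel_sum (2 - \<kappa>) (pi / 2 + \<epsilon>) (\<lambda>l. asymptotic_coeff \<kappa> \<rho> \<alpha> a l $ k) \<tau> s_plus \<and>
      has_borel_sum (2 - \<kappa>) (pi / 2 - \<epsilon>) (\<lambda>l. asymptotic_coeff \<kappa> \<rho> \<alpha> a l $ k) \<tau> s_minus \<and>
      eichler_integral \<kappa> \<alpha> a \<tau> $ k = (s_plus + s_minus) / 2"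
  proof eventually_elim
    case (elim \<epsilon>)
    then have \<epsilon>: "0 < \<epsilon>" "\<epsilon> < pi / 2" and c: "\<tau> \<in> cone \<epsilon>" by (auto simp: cone_def)
    have pos: "0 < pi / 2 + \<epsilon>" "pi / 2 + \<epsilon> < pi" "0 < pi / 2 - \<epsilon>" "pi / 2 - \<epsilon> < pi" using \<epsilon> by auto
    show ?case
    proof (rule exI[of _ "lateral k (pi / 2 + \<epsilon>) (cis (\<epsilon> / 2)) \<tau>"],
        rule exI[of _ "lateral k (pi / 2 - \<epsilon>) (cis (pi - \<epsilon> / 2)) \<tau>"], intro conjI)
      show "has_borel_sum (2 - \<kappa>) (pi / 2 + \<epsilon>) (\<lambda>l. asymptotic_coeff \<kappa> \<rho> \<alpha> a l $ k) \<tau>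
          (lateral k (pi / 2 + \<epsilon>) (cis (\<epsilon> / 2)) \<tau>)"
        by (rule has_borel_sum_lateral[OF pos(1,2) ray_directions(1-3)[OF \<epsilon>] cone_directions(1)[OF \<epsilon> c]])
      show "has_borel_sum (2 - \<kappa>) (pi / 2 - \<epsilon>) (\<lambda>l. asymptotic_coeff \<kappa> \<rho> \<alpha> a l $ k) \<tau>
          (lateral k (pi / 2 - \<epsilon>) (cis (pi - \<epsilon> / 2)) \<tau>)"
        by (rule has_borel_sum_lateral[OF pos(3,4) ray_directions(4-6)[OF \<epsilon>] cone_directions(2)[OF \<epsilon> c]])
    qed (rule lateral_average[OF \<epsilon> c])
  qed
qed

lemma lateral_remainder:
  assumes \<theta>: "0 < \<theta>" "\<theta> < pi" and \<sigma>: "Im \<sigma> > 0" "norm \<sigma> = 1" "Re (cis \<theta> / \<sigma>) < 0" and c: "c > 0"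
  obtains M where "M \<ge> 0" "\<forall>\<tau>. Im \<tau> > 0 \<longrightarrow> Re (cis \<theta> / \<tau>) \<ge> c / norm \<tau> \<longrightarrow>
    norm (lateral k \<theta> \<sigma> \<tau> - (\<Sum>l<N. asymptotic_coeff \<kappa> \<rho> \<alpha> a l $ k * \<tau> ^ l)) \<le> M * norm \<tau> ^ N"
proof -
  let ?\<eta> = "2 - \<kappa>"
  define A where "A = decaying.abs_moment (W k) \<sigma> N / fact (N - 1) * Gamma (?\<eta> + real N)"
  define M where "M = norm K * (A * c powr (- (?\<eta> + real N)))"
  have A: "A \<ge> 0"
    unfolding A_def using decaying.abs_moment_nonneg[OF decaying_W, of k \<sigma> N] Gamma_real_pos[of "?\<eta> + real N"] \<eta>_pos
    by (intro mult_nonneg_nonneg divide_nonneg_nonneg) auto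
  have "norm (lateral k \<theta> \<sigma> \<tau> - (\<Sum>l<N. asymptotic_coeff \<kappa> \<rho> \<alpha> a l $ k * \<tau> ^ l)) \<le> M * norm \<tau> ^ N"
    if \<tau>: "Im \<tau> > 0" "Re (cis \<theta> / \<tau>) \<ge> c / norm \<tau>" for \<tau>
  proof -
    have \<tau>0: "\<tau> \<noteq> 0" using \<tau> by auto
    have n: "norm \<tau> > 0" using \<tau>0 by simp
    have "c / norm \<tau> > 0" using c n by (rule divide_pos_pos)
    then have pos: "Re (cis \<theta> / \<tau>) > 0" using \<tau>(2) by linarith
    let ?I = "\<integral>t. exp (- (of_real t * cis \<theta>) / \<tau>) *
      decaying.borel_transform (W k) ?\<eta> \<sigma> (of_real t * cis \<theta>) * cis \<theta> \<partial>half_line"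
    let ?S = "\<Sum>l<N. decaying.coeff (W k) ?\<eta> l * \<tau> powr of_real (?\<eta> + real l)"
    have p: "\<tau> powr (- of_real ?\<eta>) * (K * (decaying.coeff (W k) ?\<eta> l * \<tau> powr of_real (?\<eta> + real l)))
        = asymptotic_coeff \<kappa> \<rho> \<alpha> a l $ k * \<tau> ^ l" for l
    proof -
      have "\<tau> powr (- of_real ?\<eta>) * \<tau> powr of_real (?\<eta> + real l) = \<tau> powr (of_nat l)"
        unfolding powr_add[symmetric] by simp
      then have "\<tau> powr (- of_real ?\<eta>) * \<tau> powr of_real (?\<eta> + real l) = \<tau> ^ l" using \<tau>0 by (simp add: powr_nat')
      moreover have "\<tau> powr (- of_real ?\<eta>) * (K * (decaying.coeff (W k) ?\<eta> l * \<tau> powr of_real (?\<eta> + real l)))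
          = K * decaying.coeff (W k) ?\<eta> l * (\<tau> powr (- of_real ?\<eta>) * \<tau> powr of_real (?\<eta> + real l))"
        by (simp only: mult_ac)
      ultimately show ?thesis unfolding coeff_W by (simp only:)
    qed
    have "\<tau> powr (- of_real ?\<eta>) * (K * ?S) = (\<Sum>l<N. asymptotic_coeff \<kappa> \<rho> \<alpha> a l $ k * \<tau> ^ l)"
      unfolding sum_distrib_left p ..
    then have "lateral k \<theta> \<sigma> \<tau> - (\<Sum>l<N. asymptotic_coeff \<kappa> \<rho> \<alpha> a l $ k * \<tau> ^ l)
        = \<tau> powr (- of_real ?\<eta>) * (K * (?I - ?S))"
      unfolding lateral_def right_diff_distrib by (simp only:)
    then have "norm (lateral k \<theta> \<sigma> \<tau> - (\<Sum>l<N. asymptotic_coeff \<kappa> \<rho> \<alpha> a l $ k * \<tau> ^ l))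
        = norm (\<tau> powr (- of_real ?\<eta>)) * (norm K * norm (?I - ?S))"
      by (simp only: norm_mult)
    also have "norm (\<tau> powr (- of_real ?\<eta>)) = norm \<tau> powr (- ?\<eta>)"
      using norm_powr_of_real[of \<tau> "- ?\<eta>"] by (simp only: of_real_minus)
    finally have eq: "norm (lateral k \<theta> \<sigma> \<tau> - (\<Sum>l<N. asymptotic_coeff \<kappa> \<rho> \<alpha> a l $ k * \<tau> ^ l))
        = norm \<tau> powr (- ?\<eta>) * (norm K * norm (?I - ?S))" .
    have "norm (?I - ?S) \<le> A * Re (cis \<theta> / \<tau>) powr (- (?\<eta> + real N))"
      unfolding A_def by (rule decaying.laplace_borel_remainder[OF decaying_W \<eta>_pos \<theta> \<sigma> \<tau>(1) pos])
    also have "\<dots> \<le> A * (c / norm \<tau>) powr (- (?\<eta> + real N))"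
      using A \<tau>(2) \<open>c / norm \<tau> > 0\<close> \<eta>_pos by (intro mult_left_mono powr_mono2') auto
    also have "(c / norm \<tau>) powr (- (?\<eta> + real N)) = c powr (- (?\<eta> + real N)) * norm \<tau> powr (?\<eta> + real N)"
      using c n by (simp add: powr_def ln_div exp_add[symmetric] algebra_simps)
    finally have le: "norm (?I - ?S) \<le> A * (c powr (- (?\<eta> + real N)) * norm \<tau> powr (?\<eta> + real N))" .
    have "norm \<tau> powr (- ?\<eta>) * (norm K * norm (?I - ?S))
        \<le> norm \<tau> powr (- ?\<eta>) * (norm K * (A * (c powr (- (?\<eta> + real N)) * norm \<tau> powr (?\<eta> + real N))))"
      by (intro mult_left_mono le) auto
    also have "\<dots> = M * (norm \<tau> powr (- ?\<eta>) * norm \<tau> powr (?\<eta> + real N))"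
      unfolding M_def by (simp only: mult_ac)
    also have "norm \<tau> powr (- ?\<eta>) * norm \<tau> powr (?\<eta> + real N) = norm \<tau> ^ N"
      unfolding powr_add[symmetric] using n by (simp add: powr_realpow)
    finally show ?thesis unfolding eq .
  qed
  moreover have "M \<ge> 0" unfolding M_def using A by (intro mult_nonneg_nonneg) auto
  ultimately show ?thesis using that by blast
qed

text \<open>
  The angle \<open>\<epsilon>\<close> is chosen so small, in terms of the sector, that both directions \<open>\<pi>/2 \<plusminus> \<epsilon>\<close> are admissible
  for every \<open>\<tau>\<close> in it.
\<close>

lemma has_asymptotic_expansion_eichler:
  "has_asymptotic_expansion_at_0 (\<lambda>\<tau>. eichler_integral \<kappa> \<alpha> a \<tau> $ k) (\<lambda>l. asymptotic_coeff \<kappa> \<rho> \<alpha> a l $ k)"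
  unfolding has_asymptotic_expansion_at_0_def
proof (intro allI impI)
  fix \<delta> :: real and N :: nat assume \<delta>: "\<delta> > 0"
  have "((\<lambda>\<epsilon>. \<delta> * cos \<epsilon> - sin \<epsilon>) \<longlongrightarrow> \<delta> * cos 0 - sin 0) (at_right 0)"
    by (intro tendsto_intros)
  then have "\<forall>\<^sub>F \<epsilon> in at_right 0. \<delta> * cos \<epsilon> - sin \<epsilon> > 0"
    using \<delta> by (intro order_tendstoD(1)) auto
  moreover have "\<forall>\<^sub>F \<epsilon> in at_right (0::real). \<epsilon> < pi / 2"
    by (rule order_tendstoD(2)[OF tendsto_ident_at]) simp
  moreover have "\<forall>\<^sub>F \<epsilon> in at_right (0::real). \<epsilon> > 0"
    by (rule eventually_at_right_less)
  ultimately have "\<forall>\<^sub>F \<epsilon> in at_right 0. \<delta> * cos \<epsilon> - sin \<epsilon> > 0 \<and> \<epsilon> < pi / 2 \<and> \<epsilon> > 0"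
    by eventually_elim simp
  then obtain \<epsilon> where c: "\<delta> * cos \<epsilon> - sin \<epsilon> > 0" and \<epsilon>: "0 < \<epsilon>" "\<epsilon> < pi / 2"
    using eventually_happens'[OF trivial_limit_at_right_real] by blast
  let ?c = "\<delta> * cos \<epsilon> - sin \<epsilon>"
  have pos: "0 < pi / 2 + \<epsilon>" "pi / 2 + \<epsilon> < pi" "0 < pi / 2 - \<epsilon>" "pi / 2 - \<epsilon> < pi" using \<epsilon> by auto
  let ?s = "\<lambda>\<tau>. \<Sum>l<N. asymptotic_coeff \<kappa> \<rho> \<alpha> a l $ k * \<tau> ^ l"
  let ?R = "lateral k (pi / 2 + \<epsilon>) (cis (\<epsilon> / 2))" and ?L = "lateral k (pi / 2 - \<epsilon>) (cis (pi - \<epsilon> / 2))"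
  obtain M1 where M1: "M1 \<ge> 0" "\<forall>\<tau>. Im \<tau> > 0 \<longrightarrow> Re (cis (pi / 2 + \<epsilon>) / \<tau>) \<ge> ?c / norm \<tau> \<longrightarrow>
      norm (?R \<tau> - ?s \<tau>) \<le> M1 * norm \<tau> ^ N"
    by (rule lateral_remainder[OF pos(1,2) ray_directions(1-3)[OF \<epsilon>] c])
  obtain M2 where M2: "M2 \<ge> 0" "\<forall>\<tau>. Im \<tau> > 0 \<longrightarrow> Re (cis (pi / 2 - \<epsilon>) / \<tau>) \<ge> ?c / norm \<tau> \<longrightarrow>
      norm (?L \<tau> - ?s \<tau>) \<le> M2 * norm \<tau> ^ N"
    by (rule lateral_remainder[OF pos(3,4) ray_directions(4-6)[OF \<epsilon>] c])
  have "norm (eichler_integral \<kappa> \<alpha> a \<tau> $ k - ?s \<tau>) \<le> (M1 + M2) * norm (\<tau> ^ N)"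
    if \<tau>: "Im \<tau> > 0" "Im \<tau> \<ge> \<delta> * norm \<tau>" for \<tau>
  proof -
    have \<tau>0: "\<tau> \<noteq> 0" using \<tau> by auto
    have sc: "sin \<epsilon> \<ge> 0" "cos \<epsilon> > 0" using \<epsilon> by (auto intro!: sin_ge_zero cos_gt_zero)
    have "\<bar>Re \<tau>\<bar> * sin \<epsilon> \<le> norm \<tau> * sin \<epsilon>" using sc abs_Re_le_cmod by (intro mult_right_mono) auto
    moreover have "\<delta> * norm \<tau> * cos \<epsilon> \<le> Im \<tau> * cos \<epsilon>" using \<tau> sc by (intro mult_right_mono) auto
    ultimately have ge: "Im \<tau> * cos \<epsilon> - \<bar>Re \<tau>\<bar> * sin \<epsilon> \<ge> ?c * norm \<tau>" by (simp add: algebra_simps)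
    have "?c * norm \<tau> > 0" using c \<tau>0 by simp
    then have cone: "\<tau> \<in> cone \<epsilon>" using ge by (simp add: cone_def)
    have d: "?c / norm \<tau> = ?c * norm \<tau> / (norm \<tau>) ^ 2" using \<tau>0 by (simp add: power2_eq_square)
    have "?c / norm \<tau> \<le> Re (cis (pi / 2 + \<epsilon>) / \<tau>)"
      unfolding d Re_cis_right using ge abs_mult_sin_bounds[OF \<epsilon>, of "Re \<tau>"] by (intro divide_right_mono) auto
    then have r: "norm (?R \<tau> - ?s \<tau>) \<le> M1 * norm \<tau> ^ N" using M1(2) \<tau>(1) by blast
    have "?c / norm \<tau> \<le> Re (cis (pi / 2 - \<epsilon>) / \<tau>)"
      unfolding d Re_cis_left using ge abs_mult_sin_bounds[OF \<epsilon>, of "Re \<tau>"] by (intro divide_right_mono) auto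
    then have l: "norm (?L \<tau> - ?s \<tau>) \<le> M2 * norm \<tau> ^ N" using M2(2) \<tau>(1) by blast
    have "eichler_integral \<kappa> \<alpha> a \<tau> $ k - ?s \<tau> = ((?R \<tau> - ?s \<tau>) + (?L \<tau> - ?s \<tau>)) / 2"
      unfolding lateral_average[OF \<epsilon> cone] by (simp add: field_simps)
    then have "norm (eichler_integral \<kappa> \<alpha> a \<tau> $ k - ?s \<tau>) = norm ((?R \<tau> - ?s \<tau>) + (?L \<tau> - ?s \<tau>)) / 2"
      by (simp only: norm_divide) simp
    moreover have "norm ((?R \<tau> - ?s \<tau>) + (?L \<tau> - ?s \<tau>)) \<le> M1 * norm \<tau> ^ N + M2 * norm \<tau> ^ N"
      by (rule order_trans[OF norm_triangle_ineq add_mono[OF r l]])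
    moreover have "M1 * norm \<tau> ^ N + M2 * norm \<tau> ^ N \<ge> 0" using M1(1) M2(1) by simp
    ultimately have "norm (eichler_integral \<kappa> \<alpha> a \<tau> $ k - ?s \<tau>) \<le> M1 * norm \<tau> ^ N + M2 * norm \<tau> ^ N"
      by linarith
    then show ?thesis by (simp only: norm_power distrib_right)
  qed
  then show "(\<lambda>\<tau>. eichler_integral \<kappa> \<alpha> a \<tau> $ k - ?s \<tau>)
      \<in> O[at 0 within {\<tau> \<in> upper_half_plane. \<delta> * norm \<tau> \<le> Im \<tau>}](\<lambda>\<tau>. \<tau> ^ N)"
    by (intro bigoI[where c = "M1 + M2"]) (auto simp: eventually_at_filter upper_half_plane_def)
qed

end

theorem mainTheorem6:
  fixes \<kappa> :: real
    and \<rho> :: "int^2^2 \<Rightarrow> complex^'r^'r"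
    and \<alpha> :: "'r \<Rightarrow> real"
    and g :: "complex \<Rightarrow> complex^'r"
    and a :: "'r \<Rightarrow> real \<Rightarrow> complex"
  assumes "\<kappa> \<in> {1/2, 3/2}"
    and "multiplier_system \<kappa> \<rho>"
    and "\<forall>\<gamma>\<in>SL2Z. unitary_matrix (\<rho> \<gamma>)"
    and "\<forall>k. \<alpha> k \<in> \<rat> \<and> 0 \<le> \<alpha> k \<and> \<alpha> k < 1"
    and "\<rho> T_mat = (\<chi> i j. if i = j then exp (2 * of_real pi * \<i> * of_real (\<alpha> i)) else 0)"
    and "\<exists>N>0. ((\<lambda>M. \<rho> T_mat ** M) ^^ N) (mat 1) = mat 1"
    and "cusp_form \<kappa> \<rho> \<alpha> g a"
  shows "(\<forall>k. has_asymptotic_expansion_at_0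
            (\<lambda>\<tau>. eichler_integral \<kappa> \<alpha> a \<tau> $ k) (\<lambda>l. asymptotic_coeff \<kappa> \<rho> \<alpha> a l $ k)) \<and>
         (\<forall>k. \<forall>\<tau>\<in>upper_half_plane.
            has_median_sum (2 - \<kappa>) (pi / 2) (\<lambda>l. asymptotic_coeff \<kappa> \<rho> \<alpha> a l $ k) \<tau>
              (eichler_integral \<kappa> \<alpha> a \<tau> $ k))"
proof (intro conjI allI ballI)
  have \<alpha>: "0 \<le> \<alpha> k" for k using assms(4) by blast
  show "has_asymptotic_expansion_at_0
      (\<lambda>\<tau>. eichler_integral \<kappa> \<alpha> a \<tau> $ k) (\<lambda>l. asymptotic_coeff \<kappa> \<rho> \<alpha> a l $ k)" for k
    by (rule has_asymptotic_expansion_eichler[OF assms(7) \<alpha> assms(1)])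
  show "has_median_sum (2 - \<kappa>) (pi / 2) (\<lambda>l. asymptotic_coeff \<kappa> \<rho> \<alpha> a l $ k) \<tau>
      (eichler_integral \<kappa> \<alpha> a \<tau> $ k)" if "\<tau> \<in> upper_half_plane" for k \<tau>
    by (rule has_median_sum_eichler[OF assms(7) \<alpha> assms(1)]) (use that in \<open>simp add: upper_half_plane_def\<close>)
qed

end
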